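(* Let $\mathcal X$ be an infinite dimensional complex Hilbert space and let $A\in B(\mathcal X)$, with adjoint $A^*$. Let $R_A\in B(B(\mathcal X))$ be the operator $R_A(T)=TA$. Then the following statements are equivalent: (i) Generalized $a$-Weyl's theorem holds for $A^*$. (ii) $R_A$ satisfies generalized $a$-Weyl's theorem and $A^*$ satisfies $a$-Browder's theorem.
   Context: For a complex Banach space $\mathcal Z$, $B(\mathcal Z)$ is the Banach algebra of bounded linear operators on $\mathcal Z$. For $T\in B(\mathcal Z)$, $N(T)$, $R(T)$ are the null space and range; $T-\lambda$ means $T-\lambda I$; $\alpha(T)=\dim N(T)$, $\beta(T)=\dim \mathcal Z/R(T)$. $T$ is bounded below if $N(T)=0$ and $R(T)$ is closed; $\sigma_a(T)=\{\lambda\in\mathbb C:T-\lambda\text{ is not bounded below}\}$. $T$ is upper semi-Fredholm if $R(T)$ is closed and $\alpha(T)<\infty$, with index $\mathrm{ind}(T)=\alpha(T)-\beta(T)\in\mathbb Z\cup\{-\infty\}$. $\sigma_{aw}(T)=\{\lambda\in\sigma_a(T): T-\lambda\text{ is not upper semi-Fredholm or }0<\mathrm{ind}(T-\lambda)\}$. $T$ is upper semi B-Fredholm if for some $n\in\mathbb N$ the range $R(T^n)$ is closed and the induced operator $T_n=T|_{R(T^n)}\in B(R(T^n))$ is upper semi-Fredholm; its index is $\mathrm{ind}(T)=\mathrm{ind}(T_n)$ (independent of such $n$). $\sigma_{SBF_+^-}(T)=\{\lambda\in\mathbb C: T-\lambda\text{ is not upper semi B-Fredholm or }0<\mathrm{ind}(T-\lambda)\}$.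 The ascent $\mathrm{asc}(T)$ is the smallest non-negative integer $n$ with $N(T^n)=N(T^{n+1})$, or $\infty$ if none exists. For $K\subseteq\mathbb C$, $\mathrm{iso}\,K$ is the set of isolated points of $K$. $\Pi^a(T)=\{\lambda\in\mathrm{iso}\,\sigma_a(T): a=\mathrm{asc}(T-\lambda)<\infty\text{ and }R((T-\lambda)^{a+1})\text{ is closed}\}$, $\Pi^a_0(T)=\{\lambda\in\Pi^a(T):\alpha(T-\lambda)<\infty\}$, and $E^a(T)=\{\lambda\in\mathrm{iso}\,\sigma_a(T):0<\alpha(T-\lambda)\}$. $T$ satisfies $a$-Browder's theorem if $\sigma_{aw}(T)=\sigma_a(T)\setminus\Pi^a_0(T)$. Generalized $a$-Weyl's theorem holds for (is satisfied by) $T$ if $\sigma_{SBF_+^-}(T)=\sigma_a(T)\setminus E^a(T)$. *)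

theory Defs
  imports "HOL-Analysis.Analysis"
begin

section \<open>Complex Banach and Hilbert spaces\<close>

class complex_banach = banach +
  fixes scaleC :: "complex \<Rightarrow> 'a \<Rightarrow> 'a" (infixr \<open>*\<^sub>C\<close> 75)
  assumes scaleC_add_right: "a *\<^sub>C (x + y) = a *\<^sub>C x + a *\<^sub>C y"
    and scaleC_add_left: "(a + b) *\<^sub>C x = a *\<^sub>C x + b *\<^sub>C x"
    and scaleC_scaleC: "a *\<^sub>C b *\<^sub>C x = (a * b) *\<^sub>C x"
    and scaleR_scaleC: "r *\<^sub>R x = complex_of_real r *\<^sub>C x"
    and norm_scaleC: "norm (a *\<^sub>C x) = cmod a * norm x"

(* The inner product is linear in the first argument. Positive definiteness is contained in
   cinner_self, which also says that the norm is the one induced by the inner product. *)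
class complex_hilbert = complex_banach +
  fixes cinner :: "'a \<Rightarrow> 'a \<Rightarrow> complex"
  assumes cinner_add_left: "cinner (x + y) z = cinner x z + cinner y z"
    and cinner_scaleC_left: "cinner (a *\<^sub>C x) z = a * cinner x z"
    and cinner_commute: "cinner x y = cnj (cinner y x)"
    and cinner_self: "cinner x x = complex_of_real ((norm x)\<^sup>2)"

lemma scaleC_one: "1 *\<^sub>C x = (x :: 'a::complex_banach)"
  using scaleR_scaleC[of 1 x] by simp

global_interpretation complex_vector: vector_space "scaleC :: complex \<Rightarrow> 'a \<Rightarrow> 'a::complex_banach"
  defines cspan = complex_vector.span
    and cdim = complex_vector.dim
  by unfold_locales (auto simp: scaleC_add_right scaleC_add_left scaleC_scaleC scaleC_one)

lemma scaleR_scaleC_commute: "r *\<^sub>R a *\<^sub>C x = a *\<^sub>C r *\<^sub>R (x :: 'a::complex_banach)"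
  by (simp add: scaleR_scaleC scaleC_scaleC mult.commute)

lemma bounded_linear_scaleC: "bounded_linear (\<lambda>x::'a::complex_banach. a *\<^sub>C x)"
  by (rule bounded_linear_intro[where K = "cmod a"])
    (auto simp: scaleC_add_right scaleR_scaleC_commute norm_scaleC mult.commute)

definition finite_dim :: "'z::complex_banach set \<Rightarrow> bool" where
  "finite_dim V \<longleftrightarrow> (\<exists>B. finite B \<and> V \<subseteq> cspan B)"

definition edim :: "'z::complex_banach set \<Rightarrow> enat" where
  "edim V = (if finite_dim V then enat (cdim V) else \<infinity>)"

(* For subspaces W \<subseteq> V: the cosets b + W (b \<in> B) form a basis of the quotient V/W. *)
definition quotient_basis :: "'z::complex_banach set \<Rightarrow> 'z set \<Rightarrow> 'z set \<Rightarrow> bool" where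
  "quotient_basis V W B \<longleftrightarrow> B \<subseteq> V \<and>
     (\<forall>F c. finite F \<and> F \<subseteq> B \<and> (\<Sum>b\<in>F. c b *\<^sub>C b) \<in> W \<longrightarrow> (\<forall>b\<in>F. c b = 0)) \<and>
     (\<forall>v\<in>V. \<exists>F c. finite F \<and> F \<subseteq> B \<and> v - (\<Sum>b\<in>F. c b *\<^sub>C b) \<in> W)"

(* All bases of V/W have the same cardinality, so the infimum is over a singleton, or over the
   empty set if V/W has infinite dimension. *)
definition quotient_dim :: "'z::complex_banach set \<Rightarrow> 'z set \<Rightarrow> enat" where
  "quotient_dim V W = (INF B\<in>{B. finite B \<and> quotient_basis V W B}. enat (card B))"


section \<open>The Banach space of bounded linear operators\<close>

definition bounded_clinear :: "('a::complex_banach \<Rightarrow> 'a) \<Rightarrow> bool" where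
  "bounded_clinear f \<longleftrightarrow> bounded_linear f \<and> (\<forall>a x. f (a *\<^sub>C x) = a *\<^sub>C f x)"

typedef (overloaded) 'a bop = "{f :: 'a::complex_banach \<Rightarrow> 'a. bounded_clinear f}"
  morphisms bop_apply Bop
  by (auto intro!: exI[of _ "\<lambda>x. x"] simp: bounded_clinear_def)

setup_lifting type_definition_bop

instantiation bop :: (complex_banach) real_normed_vector
begin

lift_definition norm_bop :: "'a bop \<Rightarrow> real" is onorm .

lift_definition zero_bop :: "'a bop" is "\<lambda>x. 0"
  by (simp add: bounded_clinear_def)

lift_definition plus_bop :: "'a bop \<Rightarrow> 'a bop \<Rightarrow> 'a bop" is "\<lambda>f g x. f x + g x"
  by (simp add: bounded_clinear_def bounded_linear_add scaleC_add_right)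

lift_definition minus_bop :: "'a bop \<Rightarrow> 'a bop \<Rightarrow> 'a bop" is "\<lambda>f g x. f x - g x"
  by (simp add: bounded_clinear_def bounded_linear_sub complex_vector.scale_right_diff_distrib)

lift_definition uminus_bop :: "'a bop \<Rightarrow> 'a bop" is "\<lambda>f x. - f x"
  by (simp add: bounded_clinear_def bounded_linear_minus)

lift_definition scaleR_bop :: "real \<Rightarrow> 'a bop \<Rightarrow> 'a bop" is "\<lambda>r f x. r *\<^sub>R f x"
  by (simp add: bounded_clinear_def bounded_linear_const_scaleR scaleR_scaleC_commute)

definition dist_bop :: "'a bop \<Rightarrow> 'a bop \<Rightarrow> real" where
  "dist_bop S T = norm (S - T)"

definition [code del]:
  "(uniformity :: ('a bop \<times> 'a bop) filter) = (INF e\<in>{0<..}. principal {(S, T). dist S T < e})"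

definition open_bop :: "'a bop set \<Rightarrow> bool" where
  [code del]: "open_bop U = (\<forall>S\<in>U. \<forall>\<^sub>F (S', T) in uniformity. S' = S \<longrightarrow> T \<in> U)"

definition sgn_bop :: "'a bop \<Rightarrow> 'a bop" where
  "sgn_bop T = scaleR (inverse (norm T)) T"

instance
  apply standard
  unfolding dist_bop_def open_bop_def sgn_bop_def uniformity_bop_def
  apply (rule refl | (transfer, force simp: bounded_clinear_def onorm_triangle onorm_scaleR
        onorm_eq_0 algebra_simps))+
  done

end

lemma bounded_clinear_bop_apply: "bounded_clinear (bop_apply T)"
  using bop_apply by blast

lemma bop_apply_Bop: "bounded_clinear f \<Longrightarrow> bop_apply (Bop f) = f"
  by (simp add: Bop_inverse)

lemma bounded_linear_bop_apply: "bounded_linear (bop_apply T)"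
  using bounded_clinear_bop_apply bounded_clinear_def by blast

lemma bop_apply_scaleC: "bop_apply T (a *\<^sub>C x) = a *\<^sub>C bop_apply T x"
  using bounded_clinear_bop_apply bounded_clinear_def by blast

lemma norm_bop_apply: "norm (bop_apply T x) \<le> norm T * norm x"
  by (simp add: norm_bop.rep_eq onorm bounded_linear_bop_apply)

instance bop :: (complex_banach) banach
proof
  fix X :: "nat \<Rightarrow> 'a bop"
  assume X: "Cauchy X"
  define Y where "Y n = Blinfun (bop_apply (X n))" for n
  have Y: "blinfun_apply (Y n) = bop_apply (X n)" for n
    by (simp add: Y_def bounded_linear_Blinfun_apply bounded_linear_bop_apply)
  have "dist (Y m) (Y n) = dist (X m) (X n)" for m n
    by (simp add: dist_norm norm_blinfun.rep_eq norm_bop.rep_eq minus_blinfun.rep_eq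
        minus_bop.rep_eq Y)
  then have "Cauchy Y"
    using X by (simp add: Cauchy_def)
  then obtain L where L: "Y \<longlonglongrightarrow> L"
    using Cauchy_convergent_iff convergent_def by blast
  have pt: "(\<lambda>n. bop_apply (X n) x) \<longlonglongrightarrow> blinfun_apply L x" for x
    using blinfun.tendsto[OF L tendsto_const[of x]] by (simp add: Y)
  have "blinfun_apply L (a *\<^sub>C x) = a *\<^sub>C blinfun_apply L x" for a x
    using LIMSEQ_unique[OF pt[of "a *\<^sub>C x"]]
      bounded_linear.tendsto[OF bounded_linear_scaleC pt[of x], of a]
    by (simp add: bop_apply_scaleC)
  then have B: "bounded_clinear (blinfun_apply L)"
    by (simp add: bounded_clinear_def blinfun.bounded_linear_right)
  have "dist (X n) (Bop (blinfun_apply L)) = dist (Y n) L" for n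
    by (simp add: dist_norm norm_blinfun.rep_eq norm_bop.rep_eq minus_blinfun.rep_eq
        minus_bop.rep_eq Y bop_apply_Bop[OF B])
  then have "X \<longlonglongrightarrow> Bop (blinfun_apply L)"
    using L tendsto_dist_iff by (metis (no_types, lifting) ext)
  then show "convergent X"
    using convergent_def by blast
qed

instantiation bop :: (complex_banach) complex_banach
begin

lift_definition scaleC_bop :: "complex \<Rightarrow> 'a bop \<Rightarrow> 'a bop" is "\<lambda>a f x. a *\<^sub>C f x"
  by (simp add: bounded_clinear_def bounded_linear_compose[OF bounded_linear_scaleC] mult.commute)

instance
proof
  fix a :: complex and T :: "'a bop"
  show "norm (a *\<^sub>C T) = cmod a * norm T"
  proof (rule antisym)
    show "norm (a *\<^sub>C T) \<le> cmod a * norm T"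
      unfolding norm_bop.rep_eq[of "a *\<^sub>C T"] scaleC_bop.rep_eq
      by (rule onorm_bound)
        (auto simp: norm_scaleC mult.assoc intro!: mult_left_mono norm_bop_apply)
    show "cmod a * norm T \<le> norm (a *\<^sub>C T)"
    proof (cases "a = 0")
      case False
      have "norm T \<le> norm (a *\<^sub>C T) / cmod a"
        unfolding norm_bop.rep_eq[of T]
      proof (rule onorm_bound)
        fix x
        show "norm (bop_apply T x) \<le> norm (a *\<^sub>C T) / cmod a * norm x"
          using norm_bop_apply[of "a *\<^sub>C T" x] False
          by (simp add: scaleC_bop.rep_eq norm_scaleC field_simps)
      qed simp
      then show ?thesis
        using False by (simp add: field_simps)
    qed simp
  qed
qed (transfer; simp add: fun_eq_iff scaleC_add_right scaleC_add_left scaleC_scaleC scaleR_scaleC)+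

end

lift_definition bop_id :: "'a::complex_banach bop" is "\<lambda>x. x"
  by (simp add: bounded_clinear_def)

lift_definition bop_comp :: "'a::complex_banach bop \<Rightarrow> 'a bop \<Rightarrow> 'a bop" is "\<lambda>f g x. f (g x)"
  by (simp add: bounded_clinear_def bounded_linear_compose)

lemma norm_bop_comp: "norm (bop_comp S T) \<le> norm S * norm T"
  unfolding norm_bop.rep_eq[of "bop_comp S T"] bop_comp.rep_eq
proof (rule onorm_bound)
  fix x
  have "norm (bop_apply S (bop_apply T x)) \<le> norm S * norm (bop_apply T x)"
    by (rule norm_bop_apply)
  also have "\<dots> \<le> norm S * (norm T * norm x)"
    by (intro mult_left_mono norm_bop_apply) simp
  finally show "norm (bop_apply S (bop_apply T x)) \<le> norm S * norm T * norm x"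
    by (simp add: mult.assoc)
qed simp

(* R_A(T) = TA *)
definition right_mult :: "'a::complex_banach bop \<Rightarrow> 'a bop bop" where
  "right_mult A = Bop (\<lambda>T. bop_comp T A)"

lemma bop_apply_right_mult: "bop_apply (right_mult A) T = bop_comp T A"
proof -
  have "bounded_linear (\<lambda>T. bop_comp T A)"
  proof (rule bounded_linear_intro[where K = "norm A"])
    show "norm (bop_comp T A) \<le> norm T * norm A" for T
      by (rule norm_bop_comp)
  qed (transfer; simp)+
  moreover have "bop_comp (a *\<^sub>C T) A = a *\<^sub>C bop_comp T A" for a T
    by transfer simp
  ultimately show ?thesis
    by (simp add: right_mult_def bop_apply_Bop bounded_clinear_def)
qed


section \<open>The Hilbert space adjoint\<close>

definition adj :: "'a::complex_hilbert bop \<Rightarrow> 'a bop" where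
  "adj A = (THE B. \<forall>x y. cinner (bop_apply A x) y = cinner x (bop_apply B y))"

lemma cinner_add_right: "cinner x (y + z) = cinner x y + cinner x z"
  by (subst (1 2 3) cinner_commute) (simp add: cinner_add_left)

lemma cinner_scaleC_right: "cinner x (a *\<^sub>C y) = cnj a * cinner x y"
  by (subst (1 2) cinner_commute) (simp add: cinner_scaleC_left)

lemma cinner_diff_left: "cinner (x - y) z = cinner x z - cinner y z"
  by (metis add_diff_cancel_right' cinner_add_left diff_add_cancel)

lemma cinner_diff_right: "cinner x (y - z) = cinner x y - cinner x z"
  by (metis add_diff_cancel_right' cinner_add_right diff_add_cancel)

lemma Re_cinner_scaleR_right: "Re (cinner x (r *\<^sub>R y)) = r * Re (cinner x y)"
  by (simp add: scaleR_scaleC cinner_scaleC_right)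

lemma norm_add_square: "(norm (x + y))\<^sup>2 = (norm x)\<^sup>2 + (norm y)\<^sup>2 + 2 * Re (cinner x y)"
proof -
  have "Re (cinner y x) = Re (cinner x y)"
    by (subst cinner_commute) simp
  moreover have "Re (cinner (x + y) (x + y)) = Re (cinner x x) + Re (cinner y y)
      + Re (cinner x y) + Re (cinner y x)"
    by (simp add: cinner_add_left cinner_add_right)
  ultimately show ?thesis
    by (simp add: cinner_self)
qed

lemma norm_diff_square: "(norm (x - y))\<^sup>2 = (norm x)\<^sup>2 + (norm y)\<^sup>2 - 2 * Re (cinner x y)"
  using norm_add_square[of x "- y"] Re_cinner_scaleR_right[of x "-1" y] by simp

lemma parallelogram:
  "(norm (x + y))\<^sup>2 + (norm (x - y))\<^sup>2 = 2 * (norm x)\<^sup>2 + 2 * (norm (y::'a::complex_hilbert))\<^sup>2"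
  by (simp add: norm_add_square norm_diff_square)

lemma quadratic_nonneg_imp_zero:
  fixes a b :: real
  assumes "\<And>t. 0 \<le> a * t\<^sup>2 + 2 * b * t"
  shows "b = 0"
proof (rule ccontr)
  assume b: "b \<noteq> 0"
  define s where "s = - b / (\<bar>a\<bar> + 1)"
  have bs: "b = - s * (\<bar>a\<bar> + 1)"
    by (simp add: s_def)
  have s: "s \<noteq> 0"
    using b by (simp add: s_def add_nonneg_eq_0_iff)
  have "a * s\<^sup>2 + 2 * b * s = s\<^sup>2 * (a - 2 * \<bar>a\<bar> - 2)"
    by (subst bs) (simp add: power2_eq_square algebra_simps)
  moreover have "s\<^sup>2 * (a - 2 * \<bar>a\<bar> - 2) < 0"
    using s by (intro mult_pos_neg) auto
  ultimately show False
    using assms[of s] by simp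
qed

lemma cinner_ext:
  assumes "\<And>x. cinner x y = cinner x z"
  shows "y = z"
proof -
  have "cinner (y - z) (y - z) = 0"
    using assms[of "y - z"] by (simp add: cinner_diff_right)
  then show ?thesis
    by (simp add: cinner_self)
qed

lemma cauchy_schwarz: "cmod (cinner x y) \<le> norm x * norm y"
proof (cases "cinner x y = 0")
  case False
  define a where "a = cnj (sgn (cinner x y))"
  have a: "cmod a = 1"
    using False by (simp add: a_def norm_sgn)
  have "a * cinner x y = of_real (cmod (cinner x y))"
    using False by (simp add: a_def sgn_eq field_simps flip: complex_norm_square)
      (simp add: complex_norm_square power2_eq_square mult.commute)
  then have re: "Re (cinner (a *\<^sub>C x) y) = cmod (cinner x y)"
    by (simp add: cinner_scaleC_left)
  have "y \<noteq> 0"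
    using False cinner_scaleC_right[of x 0 y] cinner_diff_right[of x y y] by auto
  define t where "t = cmod (cinner x y) / (norm y)\<^sup>2"
  have "0 \<le> (norm (a *\<^sub>C x - t *\<^sub>R y))\<^sup>2"
    by simp
  also have "\<dots> = (norm x)\<^sup>2 + t\<^sup>2 * (norm y)\<^sup>2 - 2 * t * cmod (cinner x y)"
    by (simp add: norm_diff_square norm_scaleC a re Re_cinner_scaleR_right power_mult_distrib)
  also have "\<dots> = (norm x)\<^sup>2 - (cmod (cinner x y))\<^sup>2 / (norm y)\<^sup>2"
    using \<open>y \<noteq> 0\<close> by (simp add: t_def power2_eq_square field_simps)
  finally have "(cmod (cinner x y))\<^sup>2 \<le> (norm x * norm y)\<^sup>2"
    using \<open>y \<noteq> 0\<close> by (simp add: field_simps power_mult_distrib)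
  then show ?thesis
    using power2_le_imp_le by force
qed simp

lemma riesz_representation:
  fixes f :: "'a::complex_hilbert \<Rightarrow> complex"
  assumes bl: "bounded_linear f" and hom: "\<And>a x. f (a *\<^sub>C x) = a * f x"
  shows "\<exists>z. \<forall>x. f x = cinner x z"
proof -
  interpret f: bounded_linear f by (rule bl)
  define J where "J x = (norm x)\<^sup>2 - 2 * Re (f x)" for x
  obtain K where K: "\<And>x. norm (f x) \<le> norm x * K"
    using f.bounded by blast
  have low: "- K\<^sup>2 \<le> J x" for x
  proof -
    have "Re (f x) \<le> norm x * K"
      using K[of x] complex_Re_le_cmod order_trans by blast
    moreover have "0 \<le> (norm x - K)\<^sup>2"
      by simp
    ultimately show ?thesis
      by (simp add: J_def power2_diff)
  qed
  define m where "m = Inf (range J)"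
  have bdd: "bdd_below (range J)"
    using low by (intro bdd_belowI[of _ "- K\<^sup>2"]) auto
  have m: "m \<le> J x" for x
    unfolding m_def using bdd by (intro cInf_lower) auto
  have "\<exists>x. J x < m + 1 / real (Suc n)" for n
    using cInf_lessD[of "range J" "m + 1 / real (Suc n)"] by (auto simp: m_def)
  then obtain X where X: "\<And>n. J (X n) < m + 1 / real (Suc n)"
    by metis
  have mid: "(norm (x - y))\<^sup>2 \<le> 2 * (J x - m) + 2 * (J y - m)" for x y
  proof -
    have "m \<le> J ((1/2) *\<^sub>R (x + y))"
      by (rule m)
    also have "\<dots> = (norm (x + y))\<^sup>2 / 4 - Re (f x) - Re (f y)"
      by (simp add: J_def f.scaleR f.add power_divide add_divide_distrib)
    finally show ?thesis
      using parallelogram[of x y] by (simp add: J_def)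
  qed
  have "Cauchy X"
  proof (rule CauchyI)
    fix e :: real
    assume e: "0 < e"
    then obtain N where N: "4 / e\<^sup>2 < real N"
      using reals_Archimedean2 by blast
    have 1: "1 / real (Suc n) < e\<^sup>2 / 4" if "N \<le> n" for n
    proof -
      have "4 / e\<^sup>2 < real (Suc n)"
        using N that by linarith
      then show ?thesis
        using e by (simp add: field_simps)
    qed
    show "\<exists>N. \<forall>k\<ge>N. \<forall>n\<ge>N. norm (X k - X n) < e"
    proof (intro exI[of _ N] allI impI)
      fix k n
      assume kn: "N \<le> k" "N \<le> n"
      have "J (X i) - m < e\<^sup>2 / 4" if "N \<le> i" for i
        using less_trans[OF X[of i] add_strict_left_mono[OF 1[OF that]]] by simp
      from this[OF kn(1)] this[OF kn(2)] have "(norm (X k - X n))\<^sup>2 < e\<^sup>2"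
        using mid[of "X k" "X n"] by argo
      then show "norm (X k - X n) < e"
        using e power_less_imp_less_base by (metis less_imp_le)
    qed
  qed
  then obtain z where z: "X \<longlonglongrightarrow> z"
    using Cauchy_convergent_iff convergent_def by blast
  have "(\<lambda>n. J (X n)) \<longlonglongrightarrow> J z"
    unfolding J_def by (intro tendsto_intros z f.tendsto)
  moreover have "(\<lambda>n. m + 1 / real (Suc n)) \<longlonglongrightarrow> m + 0"
    by (intro tendsto_intros LIMSEQ_Suc[OF lim_1_over_n])
  ultimately have "J z \<le> m"
    using LIMSEQ_le[of "\<lambda>n. J (X n)" "J z" _ "m + 0"] X by (auto intro: less_imp_le)
  then have min: "J z \<le> J x" for x
    using m[of x] by linarith
  have re: "Re (f x) = Re (cinner x z)" for x
  proof -
    have "Re (cinner z x) - Re (f x) = 0"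
    proof (rule quadratic_nonneg_imp_zero)
      fix t :: real
      have "J (z + t *\<^sub>R x) - J z = (norm x)\<^sup>2 * t\<^sup>2 + 2 * (Re (cinner z x) - Re (f x)) * t"
        by (simp add: J_def norm_add_square Re_cinner_scaleR_right f.add f.scaleR
            power_mult_distrib algebra_simps)
      then show "0 \<le> (norm x)\<^sup>2 * t\<^sup>2 + 2 * (Re (cinner z x) - Re (f x)) * t"
        using min[of "z + t *\<^sub>R x"] by simp
    qed
    then show ?thesis
      by (subst cinner_commute) simp
  qed
  have "Im (f x) = Im (cinner x z)" for x
    using re[of "\<i> *\<^sub>C x"] by (simp add: hom cinner_scaleC_left)
  then show ?thesis
    using re complex_eqI by blast
qed

lemma adj_ex1: "\<exists>!B. \<forall>x y. cinner (bop_apply A x) y = cinner x (bop_apply B y)"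
proof (rule ex_ex1I)
  interpret A: bounded_linear "bop_apply A" by (rule bounded_linear_bop_apply)
  have "\<exists>z. \<forall>x. cinner (bop_apply A x) y = cinner x z" for y
  proof (rule riesz_representation)
    show "bounded_linear (\<lambda>x. cinner (bop_apply A x) y)"
    proof (rule bounded_linear_intro[where K = "norm A * norm y"])
      show "norm (cinner (bop_apply A x) y) \<le> norm x * (norm A * norm y)" for x
      proof -
        have "norm (cinner (bop_apply A x) y) \<le> norm (bop_apply A x) * norm y"
          by (rule cauchy_schwarz)
        also have "\<dots> \<le> norm A * norm x * norm y"
          by (intro mult_right_mono norm_bop_apply) simp
        finally show ?thesis
          by (simp add: ac_simps)
      qed
    qed (simp_all add: A.add A.scaleR cinner_add_left scaleR_scaleC bop_apply_scaleC
        cinner_scaleC_left scaleR_conv_of_real)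
  qed (simp add: bop_apply_scaleC cinner_scaleC_left)
  then obtain g where g: "\<And>x y. cinner (bop_apply A x) y = cinner x (g y)"
    by metis
  have "bounded_clinear g"
    unfolding bounded_clinear_def
  proof (intro conjI allI bounded_linear_intro[where K = "norm A"])
    show sc: "g (a *\<^sub>C y) = a *\<^sub>C g y" for a y
      by (rule cinner_ext) (simp add: cinner_scaleC_right flip: g)
    show "g (y + z) = g y + g z" for y z
      by (rule cinner_ext) (simp add: cinner_add_right flip: g)
    show "g (r *\<^sub>R y) = r *\<^sub>R g y" for r y
      by (simp add: scaleR_scaleC sc)
    show "norm (g y) \<le> norm y * norm A" for y
    proof (cases "g y = 0")
      case False
      have "(norm (g y))\<^sup>2 = cmod (cinner (bop_apply A (g y)) y)"
        by (simp add: g cinner_self norm_power)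
      also have "\<dots> \<le> norm (bop_apply A (g y)) * norm y"
        by (rule cauchy_schwarz)
      also have "\<dots> \<le> norm A * norm (g y) * norm y"
        by (intro mult_right_mono norm_bop_apply) simp
      finally show ?thesis
        using False by (simp add: power2_eq_square ac_simps)
    qed simp
  qed
  then show "\<exists>B. \<forall>x y. cinner (bop_apply A x) y = cinner x (bop_apply B y)"
    using g by (intro exI[of _ "Bop g"]) (simp add: bop_apply_Bop)
next
  fix B C
  assume "\<forall>x y. cinner (bop_apply A x) y = cinner x (bop_apply B y)"
    and "\<forall>x y. cinner (bop_apply A x) y = cinner x (bop_apply C y)"
  then have "bop_apply B y = bop_apply C y" for y
    by (intro cinner_ext) metis
  then show "B = C"
    by (simp add: bop_apply_inject[symmetric] fun_eq_iff)
qed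

lemma cinner_adj: "cinner (bop_apply A x) y = cinner x (bop_apply (adj A) y)"
  using theI'[OF adj_ex1[of A]] unfolding adj_def by blast


section \<open>Semi-Fredholm theory\<close>

(* The notions with suffix "_on" concern the restriction of f to an f-invariant subspace V.
   They are used for V = UNIV and for the closed subspaces V = R(T^n). *)

definition alpha_on :: "'z::complex_banach set \<Rightarrow> ('z \<Rightarrow> 'z) \<Rightarrow> enat" where
  "alpha_on V f = edim {x\<in>V. f x = 0}"

definition beta_on :: "'z::complex_banach set \<Rightarrow> ('z \<Rightarrow> 'z) \<Rightarrow> enat" where
  "beta_on V f = quotient_dim V (f ` V)"

definition upper_semi_Fredholm_on :: "'z::complex_banach set \<Rightarrow> ('z \<Rightarrow> 'z) \<Rightarrow> bool" where
  "upper_semi_Fredholm_on V f \<longleftrightarrow> closed (f ` V) \<and> alpha_on V f < \<infinity>"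

definition index_on :: "'z::complex_banach set \<Rightarrow> ('z \<Rightarrow> 'z) \<Rightarrow> ereal" where
  "index_on V f = ereal_of_enat (alpha_on V f) - ereal_of_enat (beta_on V f)"

definition shift :: "'z::complex_banach bop \<Rightarrow> complex \<Rightarrow> 'z bop" where
  "shift T \<mu> = T - \<mu> *\<^sub>C bop_id"

definition null_pow :: "'z::complex_banach bop \<Rightarrow> nat \<Rightarrow> 'z set" where
  "null_pow T n = {x. (bop_apply T ^^ n) x = 0}"

definition range_pow :: "'z::complex_banach bop \<Rightarrow> nat \<Rightarrow> 'z set" where
  "range_pow T n = range (bop_apply T ^^ n)"

definition alpha :: "'z::complex_banach bop \<Rightarrow> enat" where
  "alpha T = alpha_on UNIV (bop_apply T)"

definition bounded_below :: "'z::complex_banach bop \<Rightarrow> bool" where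
  "bounded_below T \<longleftrightarrow> {x. bop_apply T x = 0} = {0} \<and> closed (range (bop_apply T))"

definition upper_semi_Fredholm :: "'z::complex_banach bop \<Rightarrow> bool" where
  "upper_semi_Fredholm T \<longleftrightarrow> upper_semi_Fredholm_on UNIV (bop_apply T)"

definition fredholm_index :: "'z::complex_banach bop \<Rightarrow> ereal" where
  "fredholm_index T = index_on UNIV (bop_apply T)"

definition upper_semi_B_Fredholm_at :: "'z::complex_banach bop \<Rightarrow> nat \<Rightarrow> bool" where
  "upper_semi_B_Fredholm_at T n \<longleftrightarrow>
     closed (range_pow T n) \<and> upper_semi_Fredholm_on (range_pow T n) (bop_apply T)"

definition upper_semi_B_Fredholm :: "'z::complex_banach bop \<Rightarrow> bool" where
  "upper_semi_B_Fredholm T \<longleftrightarrow> (\<exists>n. upper_semi_B_Fredholm_at T n)"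

(* The index of the restriction to R(T^n) is the same for all admissible n. *)
definition B_Fredholm_index :: "'z::complex_banach bop \<Rightarrow> ereal" where
  "B_Fredholm_index T =
     index_on (range_pow T (SOME n. upper_semi_B_Fredholm_at T n)) (bop_apply T)"

definition ascent :: "'z::complex_banach bop \<Rightarrow> enat" where
  "ascent T = (INF n\<in>{n. null_pow T n = null_pow T (Suc n)}. enat n)"


section \<open>Spectra and Weyl-type theorems\<close>

definition sigma_a :: "'z::complex_banach bop \<Rightarrow> complex set" where
  "sigma_a T = {\<mu>. \<not> bounded_below (shift T \<mu>)}"

definition sigma_aw :: "'z::complex_banach bop \<Rightarrow> complex set" where
  "sigma_aw T = {\<mu>\<in>sigma_a T.
     \<not> upper_semi_Fredholm (shift T \<mu>) \<or> 0 < fredholm_index (shift T \<mu>)}"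

definition sigma_SBF :: "'z::complex_banach bop \<Rightarrow> complex set" where
  "sigma_SBF T = {\<mu>.
     \<not> upper_semi_B_Fredholm (shift T \<mu>) \<or> 0 < B_Fredholm_index (shift T \<mu>)}"

definition Pi_a :: "'z::complex_banach bop \<Rightarrow> complex set" where
  "Pi_a T = {\<mu>. \<mu> isolated_in sigma_a T \<and>
     (\<exists>a. ascent (shift T \<mu>) = enat a \<and> closed (range_pow (shift T \<mu>) (a + 1)))}"

definition Pi_a0 :: "'z::complex_banach bop \<Rightarrow> complex set" where
  "Pi_a0 T = {\<mu>\<in>Pi_a T. alpha (shift T \<mu>) < \<infinity>}"

definition E_a :: "'z::complex_banach bop \<Rightarrow> complex set" where
  "E_a T = {\<mu>. \<mu> isolated_in sigma_a T \<and> 0 < alpha (shift T \<mu>)}"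

definition a_Browder :: "'z::complex_banach bop \<Rightarrow> bool" where
  "a_Browder T \<longleftrightarrow> sigma_aw T = sigma_a T - Pi_a0 T"

definition generalized_a_Weyl :: "'z::complex_banach bop \<Rightarrow> bool" where
  "generalized_a_Weyl T \<longleftrightarrow> sigma_SBF T = sigma_a T - E_a T"

end

theory Submission
  imports Defs
begin

text \<open>
Write \<open>B\<close> for the adjoint of \<open>A\<close>. Taking adjoints turns \<open>T \<mapsto> TA\<close> into the left multiplication
\<open>S \<mapsto> BS\<close>, up to complex conjugation of scalars. Left multiplication by an operator \<open>C\<close> is a very
rigid operator: its \<open>n\<close>-th power has closed range exactly when \<open>C\<^sup>n\<close> does, and then the range
consists of all \<open>S\<close> whose values lie in \<open>R(C\<^sup>n)\<close>; and its kernel within that range consists of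
the \<open>S\<close> with values in \<open>N(C) \<inter> R(C\<^sup>n)\<close>, so on an infinite dimensional space it is either zero or
infinite dimensional (rank one operators). Consequently left multiplication by \<open>C\<close> is upper semi
B-Fredholm exactly when \<open>C\<close> is left Drazin invertible, i.e. when for some \<open>n\<close> the ranges of \<open>C\<^sup>n\<close>
and \<open>C\<^bsup>n+1\<^esup>\<close> are closed and \<open>N(C) \<inter> R(C\<^sup>n) = 0\<close>; its index is then never positive. The approximate
point spectra and the sets \<open>E\<^sup>a\<close> of the two operators also correspond. So generalized a-Weyl's theorem
for \<open>R\<^sub>A\<close> says \<open>\<sigma>\<^sub>L\<^sub>D(B) = \<sigma>\<^sub>a(B) - E\<^sup>a(B)\<close>, where \<open>\<sigma>\<^sub>L\<^sub>D\<close> is the left Drazin spectrum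
(\<open>generalized_a_Weyl_right_mult_iff\<close>), whereas for \<open>B\<close> it says the same of \<open>\<sigma>\<^sub>S\<^sub>B\<^sub>F(B)\<close>.

The theorem therefore follows from two statements about a single operator: a-Browder's theorem
implies \<open>\<sigma>\<^sub>S\<^sub>B\<^sub>F = \<sigma>\<^sub>L\<^sub>D\<close>, and generalized a-Weyl's theorem implies a-Browder's theorem. Both rest on
\<open>left_Drazin_of_nearby_injective\<close>: if \<open>C\<close> is upper semi B-Fredholm and \<open>C - \<nu>\<close> is injective for
arbitrarily small \<open>\<nu>\<close>, then \<open>C\<close> is left Drazin invertible. Indeed, finite dimensionality makes
\<open>N(C) \<inter> R(C\<^sup>n)\<close> stabilise and makes \<open>C\<close> map \<open>M = \<Inter>\<^sub>n R(C\<^sup>n)\<close> onto itself; a nonzero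
\<open>x\<^sub>0 \<in> N(C) \<inter> M\<close> could be pulled back along \<open>C\<close> to \<open>x\<^sub>0, x\<^sub>1, x\<^sub>2, \<dots>\<close> in \<open>M\<close> with
\<open>\<parallel>x\<^sub>k\<parallel> \<le> K\<^sup>k \<parallel>x\<^sub>0\<parallel>\<close>, and \<open>\<Sum>\<nu>\<^sup>k x\<^sub>k\<close> would be an eigenvector for every small \<open>\<nu>\<close>.

If generalized a-Weyl's theorem holds, a point of \<open>\<sigma>\<^sub>a\<close> at which the operator is upper
semi-Fredholm with nonpositive index is isolated in \<open>\<sigma>\<^sub>a\<close>, which gives such \<open>\<nu>\<close> and hence finite
ascent. If a-Browder's theorem holds and \<open>C = B - \<mu>\<close> is upper semi B-Fredholm with nonpositive
index, then by a perturbation argument \<open>B - \<nu>\<close> is upper semi-Fredholm with nonpositive index for all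
\<open>\<nu> \<noteq> \<mu>\<close> near \<open>\<mu>\<close>; by a-Browder's theorem each such \<open>\<nu>\<close> lies outside \<open>\<sigma>\<^sub>a\<close> or is isolated in it,
so points outside \<open>\<sigma>\<^sub>a\<close> accumulate at \<open>\<mu>\<close>.

A nonpositive index means \<open>\<alpha> \<le> \<beta>\<close>, which is encoded by \<open>codim_ge\<close>, the existence of \<open>\<alpha>\<close> vectors
that are independent modulo the range; all index computations reduce to linear algebra with such
families.
\<close>

section \<open>Independence modulo a subspace and the index\<close>

abbreviation clinear :: "('a::complex_banach \<Rightarrow> 'b::complex_banach) \<Rightarrow> bool" where
  "clinear \<equiv> Vector_Spaces.linear scaleC scaleC"

abbreviation csubspace :: "'a::complex_banach set \<Rightarrow> bool" where
  "csubspace \<equiv> complex_vector.subspace"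

abbreviation cindependent :: "'a::complex_banach set \<Rightarrow> bool" where
  "cindependent B \<equiv> \<not> complex_vector.dependent B"

interpretation complex_pair: vector_space_pair
  "scaleC :: complex \<Rightarrow> 'a::complex_banach \<Rightarrow> 'a" "scaleC :: complex \<Rightarrow> 'b::complex_banach \<Rightarrow> 'b" ..

definition ssum :: "'a::complex_banach set \<Rightarrow> 'a set \<Rightarrow> 'a set" where
  "ssum V W = {x + y | x y. x \<in> V \<and> y \<in> W}"

definition indep_mod :: "'a::complex_banach set \<Rightarrow> 'a set \<Rightarrow> bool" where
  "indep_mod W G \<longleftrightarrow> cindependent G \<and> cspan G \<inter> W \<subseteq> {0}"

text \<open>A lower bound for \<open>dim V/W\<close>. Stating such bounds through finite independent families covers infinite
codimension without a case distinction.\<close>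
definition codim_ge :: "'a::complex_banach set \<Rightarrow> 'a set \<Rightarrow> nat \<Rightarrow> bool" where
  "codim_ge V W k \<longleftrightarrow> (\<exists>G. finite G \<and> card G = k \<and> G \<subseteq> V \<and> indep_mod W G)"

lemma clinear_span_image: "clinear f \<Longrightarrow> cspan (f ` S) = f ` cspan S"
  unfolding cspan_def by (rule Vector_Spaces.linear.axioms(3)[THEN module_hom.span_image])

lemma clinear_independent_image:
  "clinear f \<Longrightarrow> cindependent S \<Longrightarrow> inj_on f (cspan S) \<Longrightarrow> cindependent (f ` S)"
  unfolding cspan_def
  by (rule Vector_Spaces.linear.axioms(3)[THEN module_hom.independent_injective_image])

lemma scaleC_sum_in_cspan: "F \<subseteq> B \<Longrightarrow> (\<Sum>b\<in>F. c b *\<^sub>C b) \<in> cspan B"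
  by (intro complex_vector.span_sum complex_vector.span_scale complex_vector.span_base) auto

lemma csubspace_ssum: "csubspace V \<Longrightarrow> csubspace W \<Longrightarrow> csubspace (ssum V W)"
  unfolding ssum_def by (rule complex_vector.subspace_sums)

text \<open>This matches \<open>indep_mod\<close> with the independence clause in the definition of a quotient basis.\<close>
lemma indep_mod_iff_sum:
  assumes "csubspace W"
  shows "indep_mod W G \<longleftrightarrow>
    (\<forall>F c. finite F \<and> F \<subseteq> G \<and> (\<Sum>b\<in>F. c b *\<^sub>C b) \<in> W \<longrightarrow> (\<forall>b\<in>F. c b = 0))"
proof
  assume L: "indep_mod W G"
  show "\<forall>F c. finite F \<and> F \<subseteq> G \<and> (\<Sum>b\<in>F. c b *\<^sub>C b) \<in> W \<longrightarrow> (\<forall>b\<in>F. c b = 0)"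
  proof (intro allI impI)
    fix F c assume F: "finite F \<and> F \<subseteq> G \<and> (\<Sum>b\<in>F. c b *\<^sub>C b) \<in> W"
    then have "(\<Sum>b\<in>F. c b *\<^sub>C b) \<in> cspan G"
      by (intro scaleC_sum_in_cspan) auto
    with L F have "(\<Sum>b\<in>F. c b *\<^sub>C b) = 0"
      unfolding indep_mod_def by blast
    with L F show "\<forall>b\<in>F. c b = 0"
      unfolding indep_mod_def complex_vector.dependent_explicit by blast
  qed
next
  assume R: "\<forall>F c. finite F \<and> F \<subseteq> G \<and> (\<Sum>b\<in>F. c b *\<^sub>C b) \<in> W \<longrightarrow> (\<forall>b\<in>F. c b = 0)"
  have "cindependent G"
    unfolding complex_vector.dependent_explicit
    using R complex_vector.subspace_0[OF assms] by metis
  moreover have "cspan G \<inter> W \<subseteq> {0}"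
  proof
    fix x assume x: "x \<in> cspan G \<inter> W"
    then obtain F c where F: "finite F" "F \<subseteq> G" "x = (\<Sum>b\<in>F. c b *\<^sub>C b)"
      unfolding complex_vector.span_explicit by blast
    then have "\<forall>b\<in>F. c b = 0"
      using R x by blast
    then show "x \<in> {0}"
      using F by simp
  qed
  ultimately show "indep_mod W G"
    by (simp add: indep_mod_def)
qed

text \<open>The linear extension of \<open>r\<close> to the span of \<open>G\<close> is the identity modulo \<open>W\<close>, and so it is injective and
its image again meets \<open>W\<close> only in zero.\<close>
lemma indep_mod_representatives:
  assumes W: "csubspace W" and G: "indep_mod W G" and r: "\<And>g. g \<in> G \<Longrightarrow> g - r g \<in> W"
  shows "inj_on r G" "indep_mod W (r ` G)"
proof -
  have ind: "cindependent G"
    using G by (simp add: indep_mod_def)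
  obtain h :: "'a \<Rightarrow> 'a" where h: "clinear h" "\<And>g. g \<in> G \<Longrightarrow> h g = r g"
    using complex_pair.linear_independent_extend[OF ind] by metis
  interpret h: Vector_Spaces.linear scaleC scaleC h by (rule h)
  have hW: "x - h x \<in> W" if "x \<in> cspan G" for x
    using that
  proof (induction rule: complex_vector.span_induct_alt)
    case base
    then show ?case using complex_vector.subspace_0[OF W] by (simp add: h.zero)
  next
    case (step c x y)
    have "c *\<^sub>C x + y - h (c *\<^sub>C x + y) = c *\<^sub>C (x - h x) + (y - h y)"
      by (simp add: h.add h.scale complex_vector.scale_right_diff_distrib)
    then show ?case
      using step r[OF step(1)] h(2)[OF step(1)] W
      by (metis complex_vector.subspace_add complex_vector.subspace_scale)
  qed
  have hG0: "x = 0" if x: "x \<in> cspan G" and hx: "h x \<in> W" for x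
  proof -
    have "(x - h x) + h x \<in> W"
      using hW[OF x] hx complex_vector.subspace_add[OF W] by blast
    then show "x = 0"
      using x G unfolding indep_mod_def by auto
  qed
  have inj: "inj_on h (cspan G)"
  proof (rule inj_onI)
    fix x y assume xy: "x \<in> cspan G" "y \<in> cspan G" "h x = h y"
    then have "h (x - y) \<in> W"
      using complex_vector.subspace_0[OF W] by (simp add: h.diff)
    then have "x - y = 0"
      using hG0 complex_vector.span_diff[OF xy(1,2)] by blast
    then show "x = y" by simp
  qed
  have hr: "h ` G = r ` G"
    using h(2) by (intro image_cong) auto
  have "inj_on h G"
    using inj inj_on_subset[OF _ complex_vector.span_superset] by metis
  then show "inj_on r G"
    using h(2) by (simp add: inj_on_def)
  have "cindependent (r ` G)"
    using clinear_independent_image[OF h(1) ind inj] unfolding hr .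
  moreover have "cspan (r ` G) \<inter> W \<subseteq> {0}"
  proof
    fix y assume "y \<in> cspan (r ` G) \<inter> W"
    then obtain x where x: "x \<in> cspan G" "y = h x" "h x \<in> W"
      unfolding hr[symmetric] clinear_span_image[OF h(1)] by blast
    then show "y \<in> {0}"
      using hG0[of x] h.zero by simp
  qed
  ultimately show "indep_mod W (r ` G)"
    by (simp add: indep_mod_def)
qed

text \<open>A Steinitz bound in the quotient by \<open>W\<close>: replacing each element of \<open>G\<close> by a representative in the
span of \<open>B\<close> keeps it independent, and there the ordinary exchange lemma applies.\<close>
lemma card_le_of_cosets_spanned:
  assumes W: "csubspace W" and G: "indep_mod W G" and B: "finite B"
    and GB: "G \<subseteq> ssum W (cspan B)"
  shows "finite G \<and> card G \<le> card B"
proof -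
  have "\<exists>r. \<forall>g\<in>G. r g \<in> cspan B \<and> g - r g \<in> W"
  proof (rule bchoice, rule ballI)
    fix g assume "g \<in> G"
    then obtain w u where "g = w + u" "w \<in> W" "u \<in> cspan B"
      using GB unfolding ssum_def by blast
    then show "\<exists>r. r \<in> cspan B \<and> g - r \<in> W"
      by (intro exI[of _ u]) simp
  qed
  then obtain r where r: "\<And>g. g \<in> G \<Longrightarrow> r g \<in> cspan B" "\<And>g. g \<in> G \<Longrightarrow> g - r g \<in> W"
    by blast
  have "cindependent (r ` G)"
    using indep_mod_representatives(2)[OF W G, of r] r(2) by (simp add: indep_mod_def)
  then have "finite (r ` G) \<and> card (r ` G) \<le> card B"
    using complex_vector.independent_span_bound[OF B, of "r ` G"] r(1) by auto
  then show ?thesis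
    using indep_mod_representatives(1)[OF W G, of r] r(2) by (metis card_image finite_imageD)
qed

lemma finite_dim_obtain_basis:
  assumes "csubspace V" "finite_dim V"
  obtains B where "finite B" "cindependent B" "cspan B = V" "card B = cdim V"
proof -
  obtain C where C: "finite C" "V \<subseteq> cspan C"
    using assms unfolding finite_dim_def by blast
  obtain B where B: "B \<subseteq> V" "cindependent B" "V \<subseteq> cspan B" "card B = cdim V"
    using complex_vector.basis_exists by blast
  have "finite B"
    using complex_vector.independent_span_bound[OF C(1) B(2)] B C by blast
  moreover have "cspan B = V"
    using B assms complex_vector.span_subspace by blast
  ultimately show ?thesis
    using that B by blast
qed

lemma finite_dim_subset: "finite_dim V \<Longrightarrow> W \<subseteq> V \<Longrightarrow> finite_dim W"
  unfolding finite_dim_def by blast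

lemma finite_dim_cspan: "finite B \<Longrightarrow> finite_dim (cspan B)"
  unfolding finite_dim_def by blast

lemma extend_basis_card:
  assumes V: "csubspace V" "finite_dim V" and C: "cindependent C" "C \<subseteq> V"
  obtains D where "finite (C \<union> D)" "C \<inter> D = {}" "cindependent (C \<union> D)" "cspan (C \<union> D) = V"
    "card C + card D = cdim V"
proof -
  obtain B where B: "C \<subseteq> B" "B \<subseteq> V" "cindependent B" "V \<subseteq> cspan B"
    using complex_vector.maximal_independent_subset_extend[OF C(2,1)] by blast
  obtain A where A: "finite A" "V \<subseteq> cspan A"
    using V unfolding finite_dim_def by blast
  have fin: "finite B"
    using complex_vector.independent_span_bound[OF A(1) B(3)] B A by blast
  have "card B = cdim V"
    using complex_vector.basis_card_eq_dim B by blast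
  moreover have "card C + card (B - C) = card B"
    using fin B(1) by (metis card_Diff_subset card_mono finite_subset le_add_diff_inverse)
  moreover have "C \<union> (B - C) = B"
    using B(1) by blast
  moreover have "cspan B = V"
    using B V complex_vector.span_subspace by blast
  ultimately show ?thesis
    using that[of "B - C"] fin B(3) by (metis Diff_disjoint)
qed

lemma csubspace_eq_of_cdim_le:
  assumes V: "csubspace V" "finite_dim V" and W: "csubspace W" "W \<subseteq> V" and le: "cdim V \<le> cdim W"
  shows "W = V"
proof -
  obtain C where C: "finite C" "cindependent C" "cspan C = W" "card C = cdim W"
    using finite_dim_obtain_basis[OF W(1) finite_dim_subset[OF V(2) W(2)]] by metis
  have "C \<subseteq> V" using C W(2) complex_vector.span_superset[of C] by blast
  from extend_basis_card[OF V C(2) this]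
  obtain D where D: "finite (C \<union> D)" "cspan (C \<union> D) = V" "card C + card D = cdim V" by metis
  then have "card D = 0" using C(4) le by linarith
  then have "D = {}" using D(1) by simp
  then show ?thesis using D C by simp
qed
lemma span_disjoint_independent:
  assumes "cindependent (C \<union> D)" "C \<inter> D = {}"
  shows "cspan C \<inter> cspan D \<subseteq> {0}"
proof
  fix x assume x: "x \<in> cspan C \<inter> cspan D"
  let ?r = "complex_vector.representation"
  have "?r (C \<union> D) x = ?r C x" "?r (C \<union> D) x = ?r D x"
    using x assms by (auto intro!: complex_vector.representation_extend)
  then have "?r C x b = 0" for b
    using complex_vector.representation_ne_zero[of C x b]
      complex_vector.representation_ne_zero[of D x b] assms(2) by auto
  moreover have "x = (\<Sum>b\<in>{b. ?r C x b \<noteq> 0}. ?r C x b *\<^sub>C b)"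
    using x assms complex_vector.sum_nonzero_representation_eq[of C x]
      complex_vector.dependent_mono[of C "C \<union> D"] by (metis IntD1 Un_upper1)
  ultimately show "x \<in> {0}"
    by simp
qed

lemma independent_Un:
  assumes "finite D" "cindependent C" "cindependent D" "cspan C \<inter> cspan D \<subseteq> {0}"
  shows "cindependent (C \<union> D) \<and> C \<inter> D = {}"
  using assms
proof (induction D rule: finite_induct)
  case (insert d D)
  have D: "cindependent D" "d \<notin> cspan D"
    using insert by (auto simp: complex_vector.independent_insert)
  have sub: "cspan D \<subseteq> cspan (insert d D)"
    by (rule complex_vector.span_mono) auto
  then have IH: "cindependent (C \<union> D)" "C \<inter> D = {}"
    using insert D by blast+
  have "d \<notin> cspan (C \<union> D)"
  proof
    assume "d \<in> cspan (C \<union> D)"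
    then obtain x y where xy: "d = x + y" "x \<in> cspan C" "y \<in> cspan D"
      unfolding complex_vector.span_Un by blast
    have "d - y \<in> cspan (insert d D)"
      by (rule complex_vector.span_diff[OF complex_vector.span_base subsetD[OF sub xy(3)]]) simp
    then have "x \<in> cspan (insert d D)"
      by (metis xy(1) add_diff_cancel_right')
    with insert.prems(3) xy(2) have "x = 0"
      by blast
    then show False
      using xy D by simp
  qed
  moreover have "d \<notin> C"
    using calculation complex_vector.span_base[of d "C \<union> D"] by auto
  ultimately show ?case
    using IH complex_vector.independent_insertI[of d "C \<union> D"] by auto
qed auto

lemma codim_ge_0: "codim_ge V W 0"
  unfolding codim_ge_def indep_mod_def
  by (rule exI[of _ "{}"]) (simp add: complex_vector.dependent_def)

lemma codim_ge_mono:
  assumes "codim_ge V W k" "j \<le> k"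
  shows "codim_ge V W j"
proof -
  obtain G where G: "finite G" "card G = k" "G \<subseteq> V" "indep_mod W G"
    using assms unfolding codim_ge_def by blast
  obtain H where H: "H \<subseteq> G" "card H = j"
    using obtain_subset_with_card_n[of j G] assms G by blast
  have "indep_mod W H"
    using G(4) H(1) complex_vector.dependent_mono[OF _ H(1)] complex_vector.span_mono[OF H(1)]
    unfolding indep_mod_def by blast
  then show ?thesis
    unfolding codim_ge_def using G H finite_subset by blast
qed

lemma codim_ge_antimono: "codim_ge V W' k \<Longrightarrow> W \<subseteq> W' \<Longrightarrow> codim_ge V W k"
  unfolding codim_ge_def indep_mod_def by blast

text \<open>The part of the span of \<open>G\<close> that falls into the enlarged subspace embeds, modulo \<open>W\<close>, into the span of
\<open>B\<close>; a basis of it is discarded.\<close>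
lemma codim_ge_ssum:
  assumes W: "csubspace W" and V: "csubspace V" and k: "codim_ge V W k" and B: "finite B"
  shows "codim_ge V (ssum W (cspan B)) (k - card B)"
proof -
  obtain G where G: "finite G" "card G = k" "G \<subseteq> V" "indep_mod W G"
    using k unfolding codim_ge_def by blast
  define E where "E = cspan G \<inter> ssum W (cspan B)"
  have E: "csubspace E"
    unfolding E_def by (intro complex_vector.subspace_inter csubspace_ssum W) auto
  have "finite_dim E"
    using finite_dim_cspan[OF G(1)] finite_dim_subset unfolding E_def by blast
  then obtain C where C: "finite C" "cindependent C" "cspan C = E"
    using finite_dim_obtain_basis[OF E] by metis
  have CE: "C \<subseteq> E"
    using C complex_vector.span_superset by blast
  have "indep_mod W C"
    using C G(4) unfolding indep_mod_def E_def by blast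
  then have cC: "card C \<le> card B"
    using card_le_of_cosets_spanned[OF W _ B] CE E_def by blast
  obtain D where D: "finite (C \<union> D)" "C \<inter> D = {}" "cindependent (C \<union> D)" "cspan (C \<union> D) = cspan G"
    "card C + card D = cdim (cspan G)"
    using extend_basis_card[of "cspan G" C] C CE finite_dim_cspan[OF G(1)] unfolding E_def
    by (metis Int_subset_iff complex_vector.subspace_span)
  have "cdim (cspan G) = k"
    using G complex_vector.dim_span_eq_card_independent unfolding indep_mod_def by blast
  then have cD: "k - card B \<le> card D"
    using D cC by linarith
  have DG: "cspan D \<subseteq> cspan G"
    using D complex_vector.span_mono by (metis Un_upper2)
  have "cspan D \<inter> ssum W (cspan B) \<subseteq> cspan D \<inter> cspan C"
    using DG C E_def by blast
  also have "\<dots> \<subseteq> {0}"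
    using span_disjoint_independent[OF D(3,2)] by blast
  finally have "indep_mod (ssum W (cspan B)) D"
    using D(3) complex_vector.dependent_mono[of D "C \<union> D"] unfolding indep_mod_def by auto
  moreover have "D \<subseteq> V"
    using DG complex_vector.span_superset[of D] complex_vector.span_minimal[OF G(3) V] by blast
  ultimately have "codim_ge V (ssum W (cspan B)) (card D)"
    using D unfolding codim_ge_def by blast
  then show ?thesis
    using cD by (rule codim_ge_mono)
qed

text \<open>A family independent modulo \<open>W\<close> is never larger than a finite quotient basis; conversely an
independent family of maximal size is a quotient basis.\<close>
lemma quotient_dim_ge_iff:
  assumes W: "csubspace W" and V: "csubspace V"
  shows "enat k \<le> quotient_dim V W \<longleftrightarrow> codim_ge V W k"
proof
  assume "codim_ge V W k"
  then obtain G where G: "finite G" "card G = k" "G \<subseteq> V" "indep_mod W G"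
    unfolding codim_ge_def by blast
  show "enat k \<le> quotient_dim V W"
    unfolding quotient_dim_def
  proof (rule INF_greatest)
    fix B assume "B \<in> {B. finite B \<and> quotient_basis V W B}"
    then have B: "finite B" "quotient_basis V W B" by auto
    have "G \<subseteq> ssum W (cspan B)"
    proof
      fix g assume "g \<in> G"
      then have "g \<in> V"
        using G by blast
      with B(2) obtain F c where F: "finite F" "F \<subseteq> B" "g - (\<Sum>b\<in>F. c b *\<^sub>C b) \<in> W"
        unfolding quotient_basis_def by metis
      moreover have "(\<Sum>b\<in>F. c b *\<^sub>C b) \<in> cspan B"
        using F(2) by (rule scaleC_sum_in_cspan)
      ultimately show "g \<in> ssum W (cspan B)"
        unfolding ssum_def
        by (intro CollectI exI[of _ "g - (\<Sum>b\<in>F. c b *\<^sub>C b)"] exI[of _ "\<Sum>b\<in>F. c b *\<^sub>C b"]) auto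
    qed
    then show "enat k \<le> enat (card B)"
      using card_le_of_cosets_spanned[OF W G(4) B(1)] G by simp
  qed
next
  assume L: "enat k \<le> quotient_dim V W"
  show "codim_ge V W k"
  proof (rule ccontr)
    assume no: "\<not> codim_ge V W k"
    define j where "j = (GREATEST j. codim_ge V W j)"
    have bound: "i \<le> k" if "codim_ge V W i" for i
      using no codim_ge_mono[OF that, of k] by linarith
    have j: "codim_ge V W j"
      unfolding j_def using GreatestI_nat[of "codim_ge V W", OF codim_ge_0] bound by blast
    have jmax: "i \<le> j" if "codim_ge V W i" for i
      unfolding j_def using Greatest_le_nat[of "codim_ge V W", OF that] bound by blast
    have jk: "j < k"
      using no j bound[OF j] by (metis le_neq_implies_less)
    obtain G where G: "finite G" "card G = j" "G \<subseteq> V" "indep_mod W G"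
      using j unfolding codim_ge_def by blast
    have ind: "cindependent G" "cspan G \<inter> W \<subseteq> {0}"
      using G by (auto simp: indep_mod_def)
    have "\<exists>F c. finite F \<and> F \<subseteq> G \<and> v - (\<Sum>b\<in>F. c b *\<^sub>C b) \<in> W" if v: "v \<in> V" for v
    proof (rule ccontr)
      assume no: "\<not> ?thesis"
      have nv: "v - x \<notin> W" if "x \<in> cspan G" for x
        using that no unfolding complex_vector.span_explicit by blast
      have "v \<notin> cspan G"
        using nv[of v] complex_vector.subspace_0[OF W] by auto
      then have "cindependent (insert v G)" "v \<notin> G"
        using ind complex_vector.independent_insertI[of v G] complex_vector.span_base[of v G] by auto
      moreover have "cspan (insert v G) \<inter> W \<subseteq> {0}"
      proof
        fix x assume x: "x \<in> cspan (insert v G) \<inter> W"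
        then obtain c where c: "x - c *\<^sub>C v \<in> cspan G"
          using complex_vector.span_breakdown_eq by blast
        have "c = 0"
        proof (rule ccontr)
          assume c0: "c \<noteq> 0"
          have "inverse c *\<^sub>C (x - c *\<^sub>C v) = inverse c *\<^sub>C x - v"
            using c0 by (simp add: complex_vector.scale_right_diff_distrib scaleC_scaleC scaleC_one)
          then have "- (inverse c *\<^sub>C x - v) \<in> cspan G"
            using c complex_vector.span_scale complex_vector.span_neg by metis
          then have "v - inverse c *\<^sub>C x \<in> cspan G" by simp
          from nv[OF this] show False
            using x W by (simp add: complex_vector.subspace_scale)
        qed
        then show "x \<in> {0}"
          using c x ind by auto
      qed
      ultimately have "codim_ge V W (Suc j)"
        unfolding codim_ge_def indep_mod_def using G v
        by (intro exI[of _ "insert v G"]) auto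
      then show False
        using jmax by fastforce
    qed
    then have "quotient_basis V W G"
      unfolding quotient_basis_def using G indep_mod_iff_sum[OF W] by simp
    then have "quotient_dim V W \<le> enat j"
      unfolding quotient_dim_def using G by (intro INF_lower2[of G]) auto
    then show False
      using L jk by (meson enat_ord_simps(1) leD order_trans)
  qed
qed

lemma index_nonpos_iff:
  assumes f: "clinear f" and V: "csubspace V" and fin: "finite_dim {x\<in>V. f x = 0}"
  shows "\<not> 0 < index_on V f \<longleftrightarrow> codim_ge V (f ` V) (cdim {x\<in>V. f x = 0})"
proof -
  interpret f: Vector_Spaces.linear scaleC scaleC f by (rule f)
  have "\<not> 0 < ereal_of_enat (enat a) - ereal_of_enat b \<longleftrightarrow> enat a \<le> b" for a b
    by (cases b) auto
  then show ?thesis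
    using quotient_dim_ge_iff[OF f.subspace_image[OF V] V] fin
    unfolding index_on_def alpha_on_def beta_on_def edim_def by simp
qed

text \<open>Restricting an operator to its range preserves the index, in particular its sign. The kernel \<open>K\<close> of \<open>f\<close> on \<open>V\<close>
splits as \<open>K = K0 \<oplus> span B1\<close> with \<open>K0\<close> the part inside the range \<open>W\<close>. Replacing \<open>V\<close> by \<open>W\<close> decreases
the kernel dimension by \<open>card B1\<close>; it decreases the codimension of the range by the same amount,
because \<open>f\<close> induces an isomorphism from \<open>V/(W + K)\<close> onto \<open>W/f(W)\<close>.\<close>
lemma index_step:
  assumes f: "clinear f" and V: "csubspace V" and fV: "f ` V \<subseteq> V"
    and fin: "finite_dim {x\<in>V. f x = 0}"
  shows "codim_ge V (f ` V) (cdim {x\<in>V. f x = 0}) \<longleftrightarrow>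
    codim_ge (f ` V) (f ` f ` V) (cdim {x\<in>f ` V. f x = 0})"
proof -
  interpret f: Vector_Spaces.linear scaleC scaleC f by (rule f)
  define K where "K = {x\<in>V. f x = 0}"
  define W where "W = f ` V"
  define K0 where "K0 = {x\<in>W. f x = 0}"
  have W: "csubspace W" and WV: "W \<subseteq> V" and fW: "csubspace (f ` W)"
    unfolding W_def using f.subspace_image V fV by auto
  have K0W: "K0 = K \<inter> W" and K0K: "K0 \<subseteq> K"
    unfolding K0_def K_def using WV by auto
  have Ks: "csubspace K"
    unfolding K_def using complex_vector.subspace_inter[OF V f.subspace_kernel]
    by (simp add: Int_def)
  have K0s: "csubspace K0"
    unfolding K0W by (intro complex_vector.subspace_inter Ks W)
  have K: "finite_dim K" and K0: "finite_dim K0"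
    using fin finite_dim_subset K0K unfolding K_def by auto
  obtain B0 where B0: "finite B0" "cindependent B0" "cspan B0 = K0" "card B0 = cdim K0"
    using finite_dim_obtain_basis[OF K0s K0] by metis
  have "B0 \<subseteq> K"
    using B0 K0K complex_vector.span_superset by blast
  from extend_basis_card[OF Ks K B0(2) this]
  obtain B1 where B1: "finite (B0 \<union> B1)" "B0 \<inter> B1 = {}" "cindependent (B0 \<union> B1)"
    "cspan (B0 \<union> B1) = K" "card B0 + card B1 = cdim K" by metis
  have fB1: "finite B1" using B1 by simp
  have B1K: "cspan B1 \<subseteq> K"
    using complex_vector.span_mono[of B1 "B0 \<union> B1"] B1 by auto
  have B1i: "cindependent B1"
    using B1(3) complex_vector.dependent_mono[of B1 "B0 \<union> B1"] by auto
  have B1W: "cspan B1 \<inter> W \<subseteq> {0}"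
    using span_disjoint_independent[OF B1(3,2)] B1K B0 K0W by blast
  have "codim_ge V W (cdim K) \<longleftrightarrow> codim_ge W (f ` W) (cdim K0)"
  proof
    assume "codim_ge V W (cdim K)"
    from codim_ge_ssum[OF W V this fB1]
    have "codim_ge V (ssum W (cspan B1)) (cdim K0)"
      using B0 B1 by (metis add_diff_cancel_right')
    then obtain G where G: "finite G" "card G = cdim K0" "G \<subseteq> V" "indep_mod (ssum W (cspan B1)) G"
      unfolding codim_ge_def by blast
    have GV: "cspan G \<subseteq> V"
      using complex_vector.span_minimal[OF G(3) V] .
    have KG: "x = 0" if x: "x \<in> cspan G" and fx: "f x \<in> f ` W" for x
    proof -
      obtain w where w: "w \<in> W" "f x = f w"
        using fx by blast
      have "x - w \<in> K"
        unfolding K_def using x GV w WV V by (auto simp: f.diff intro: complex_vector.subspace_diff)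
      then obtain a b where ab: "x - w = a + b" "a \<in> cspan B0" "b \<in> cspan B1"
        using B1(4) complex_vector.span_Un by blast
      have "x = (w + a) + b"
        using ab(1) by (simp add: algebra_simps)
      moreover have "w + a \<in> W"
        using w ab B0 K0W W by (auto intro: complex_vector.subspace_add)
      ultimately have "x \<in> ssum W (cspan B1)"
        unfolding ssum_def using ab by blast
      then show "x = 0"
        using x G(4) unfolding indep_mod_def by blast
    qed
    have inj: "inj_on f (cspan G)"
    proof (rule inj_onI)
      fix x y assume xy: "x \<in> cspan G" "y \<in> cspan G" "f x = f y"
      have "0 \<in> f ` W"
        using complex_vector.subspace_0[OF fW] .
      then have "x - y = 0"
        using xy by (intro KG complex_vector.span_diff) (auto simp: f.diff)
      then show "x = y" by simp
    qed
    have "cindependent (f ` G)"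
      using clinear_independent_image[OF f] inj G(4) unfolding indep_mod_def by blast
    moreover have "cspan (f ` G) \<inter> f ` W \<subseteq> {0}"
    proof
      fix y assume "y \<in> cspan (f ` G) \<inter> f ` W"
      then obtain x where x: "x \<in> cspan G" "y = f x" "f x \<in> f ` W"
        unfolding clinear_span_image[OF f] by blast
      then show "y \<in> {0}"
        using KG[of x] f.zero by simp
    qed
    moreover have "card (f ` G) = cdim K0"
      using inj inj_on_subset[OF _ complex_vector.span_superset] card_image G(2) by metis
    moreover have "f ` G \<subseteq> W"
      unfolding W_def using G by blast
    ultimately show "codim_ge W (f ` W) (cdim K0)"
      unfolding codim_ge_def indep_mod_def using G(1) by blast
  next
    assume "codim_ge W (f ` W) (cdim K0)"
    then obtain H where H: "finite H" "card H = cdim K0" "H \<subseteq> W" "indep_mod (f ` W) H"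
      unfolding codim_ge_def by blast
    have Hi: "cindependent H"
      using H by (simp add: indep_mod_def)
    have "\<exists>r. \<forall>h\<in>H. r h \<in> V \<and> f (r h) = h"
      by (rule bchoice) (use H W_def in blast)
    then obtain r where r: "\<And>h. h \<in> H \<Longrightarrow> r h \<in> V" "\<And>h. h \<in> H \<Longrightarrow> f (r h) = h"
      by blast
    obtain R :: "'a \<Rightarrow> 'a" where R: "clinear R" "\<And>h. h \<in> H \<Longrightarrow> R h = r h"
      using complex_pair.linear_independent_extend[OF Hi] by metis
    interpret R: Vector_Spaces.linear scaleC scaleC R by (rule R)
    have fR: "f (R x) = x" if "x \<in> cspan H" for x
      using that
    proof (induction rule: complex_vector.span_induct_alt)
      case base
      then show ?case by (simp add: f.zero R.zero)
    next
      case (step c x y)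
      then show ?case by (simp add: f.add R.add f.scale R.scale R(2) r(2))
    qed
    have inj: "inj_on R (cspan H)"
      by (metis fR inj_on_inverseI)
    have RHi: "cindependent (R ` H)"
      using clinear_independent_image[OF R(1) Hi inj] .
    have cRH: "card (R ` H) = cdim K0"
      using inj inj_on_subset[OF _ complex_vector.span_superset] card_image H(2) by metis
    have key: "g = 0 \<and> b = 0" if g: "g \<in> cspan (R ` H)" and b: "b \<in> cspan B1" and gb: "g + b \<in> W" for g b
    proof -
      obtain x where x: "x \<in> cspan H" "g = R x"
        using g unfolding clinear_span_image[OF R(1)] by blast
      have "f (g + b) = x"
        using x fR b B1K by (auto simp: f.add K_def)
      then have "x \<in> f ` W"
        using gb by blast
      then have "x = 0"
        using x H(4) unfolding indep_mod_def by blast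
      then have "g = 0"
        using x by (simp add: R.zero)
      then show ?thesis
        using gb b B1W by auto
    qed
    have 0: "0 \<in> W" using complex_vector.subspace_0[OF W] .
    have "cspan (R ` H) \<inter> cspan B1 \<subseteq> {0}"
    proof
      fix x assume "x \<in> cspan (R ` H) \<inter> cspan B1"
      then show "x \<in> {0}"
        using key[of x "- x"] 0 complex_vector.span_neg[of x B1] by auto
    qed
    then have un: "cindependent (R ` H \<union> B1) \<and> R ` H \<inter> B1 = {}"
      using independent_Un[OF fB1 RHi B1i] by blast
    have "cspan (R ` H \<union> B1) \<inter> W \<subseteq> {0}"
    proof
      fix x assume "x \<in> cspan (R ` H \<union> B1) \<inter> W"
      then obtain g b where "x = g + b" "g \<in> cspan (R ` H)" "b \<in> cspan B1" "g + b \<in> W"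
        unfolding complex_vector.span_Un by blast
      then show "x \<in> {0}"
        using key[of g b] by simp
    qed
    moreover have "card (R ` H \<union> B1) = cdim K"
      using un cRH B1 B0 H(1) fB1 by (simp add: card_Un_disjoint)
    moreover have "R ` H \<union> B1 \<subseteq> V"
      using R(2) r(1) B1K complex_vector.span_superset[of B1] K_def by auto
    ultimately show "codim_ge V W (cdim K)"
      unfolding codim_ge_def indep_mod_def using un H(1) fB1
      by (intro exI[of _ "R ` H \<union> B1"]) auto
  qed
  then show ?thesis
    unfolding K_def K0_def W_def .
qed

lemma subset_ssum: "0 \<in> U \<Longrightarrow> W \<subseteq> ssum W U"
  unfolding ssum_def by (force intro: exI[of _ 0])

lemma ssum_assoc: "ssum (ssum U V) W = ssum U (ssum V W)"
  unfolding ssum_def by (auto; metis add.assoc)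

lemma ssum_cspan: "ssum (cspan A) (cspan B) = cspan (A \<union> B)"
  unfolding ssum_def complex_vector.span_Un by simp

section \<open>The open mapping theorem\<close>

text \<open>The Baire category half of the open mapping theorem: the closures of the images of the balls of
integer radius cover the closed range, so one of them contains a relative ball, which is
translated to the origin by taking differences.\<close>
lemma open_mapping_approx:
  fixes f :: "'a::banach \<Rightarrow> 'b::banach"
  assumes f: "bounded_linear f" and V: "subspace V" and cfV: "closed (f ` V)"
  shows "\<exists>L\<ge>0. \<forall>y\<in>f ` V. \<forall>e>0. \<exists>x\<in>V. norm x \<le> L * norm y \<and> norm (y - f x) < e"
proof -
  interpret f: bounded_linear f by (rule f)
  have fV: "subspace (f ` V)"
    using V f.linear_axioms real_vector.linear_subspace_image by blast
  define U where "U n = V \<inter> cball 0 (real n)" for n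
  define C where "C n = closure (f ` U n)" for n
  have CfV: "C n \<subseteq> f ` V" for n
    unfolding C_def U_def using cfV by (intro closure_minimal) auto
  have un: "\<Union> (range C) = f ` V"
  proof
    show "f ` V \<subseteq> \<Union> (range C)"
    proof
      fix y assume "y \<in> f ` V"
      then obtain x where x: "x \<in> V" "y = f x" by blast
      obtain n where "norm x \<le> real n"
        using real_arch_simple by blast
      then have "y \<in> C n"
        using x closure_subset[of "f ` U n"] unfolding C_def U_def by auto
      then show "y \<in> \<Union> (range C)" by blast
    qed
  qed (use CfV in blast)
  let ?X = "top_of_set (f ` V)"
  have "completely_metrizable_space ?X"
    using cfV completely_metrizable_space_closedin completely_metrizable_space_euclidean
    by (metis closed_closedin)
  have "\<exists>n. ?X interior_of (C n) \<noteq> {}"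
  proof (rule ccontr)
    assume no: "\<not> ?thesis"
    have "?X interior_of \<Union> (range C) = {}"
    proof (rule Baire_category_alt)
      fix T assume "T \<in> range C"
      then obtain n where n: "T = C n" by blast
      have "closed (C n)" by (simp add: C_def)
      then show "closedin ?X T \<and> ?X interior_of T = {}"
        using no CfV[of n] n closed_subset by blast
    qed (use \<open>completely_metrizable_space ?X\<close> in auto)
    then have "f ` V = {}"
      using un interior_of_topspace[of ?X] by simp
    then show False
      using subspace_0[OF V] by blast
  qed
  then obtain n y0 where y0: "y0 \<in> ?X interior_of (C n)" by blast
  then obtain T where T: "open T" "y0 \<in> T" "T \<inter> f ` V \<subseteq> C n" "y0 \<in> C n" "y0 \<in> f ` V"
    unfolding interior_of_def openin_subtopology by auto
  obtain r where r: "0 < r" "ball y0 r \<subseteq> T"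
    using T open_contains_ball by blast
  have small: "\<exists>x\<in>V. norm x \<le> 2 * real n \<and> norm (y - f x) < e"
    if y: "y \<in> f ` V" "norm y < r" and e: "0 < e" for y e
  proof -
    have "y0 + y \<in> C n"
      using y T r subspace_add[OF fV, of y0 y] by (auto simp: subset_iff dist_norm)
    then obtain x1 where x1: "x1 \<in> U n" "dist (f x1) (y0 + y) < e / 2"
      unfolding C_def closure_approachable using e by (metis half_gt_zero imageE)
    obtain x2 where x2: "x2 \<in> U n" "dist (f x2) y0 < e / 2"
      using T(4) unfolding C_def closure_approachable using e by (metis half_gt_zero imageE)
    have "norm (y - f (x1 - x2)) = norm ((f x2 - y0) - (f x1 - (y0 + y)))"
      by (simp add: f.diff algebra_simps)
    also have "\<dots> < e"
      using x1 x2 norm_triangle_ineq4[of "f x2 - y0" "f x1 - (y0 + y)"] by (simp add: dist_norm)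
    finally have "norm (y - f (x1 - x2)) < e" .
    moreover have "norm (x1 - x2) \<le> 2 * real n"
      using x1 x2 norm_triangle_ineq4[of x1 x2] by (simp add: U_def)
    ultimately show ?thesis
      using x1 x2 subspace_diff[OF V] unfolding U_def by blast
  qed
  \<comment> \<open>scaling \<open>y\<close> to norm \<open>r / 2\<close> and the bound \<open>2 * n\<close> give the constant \<open>2 * n / (r / 2)\<close>\<close>
  define L where "L = 4 * real n / r"
  have "\<exists>x\<in>V. norm x \<le> L * norm y \<and> norm (y - f x) < e"
    if y: "y \<in> f ` V" and e: "0 < e" for y e
  proof (cases "y = 0")
    case True
    then show ?thesis
      using subspace_0[OF V] e by (intro bexI[of _ 0]) (auto simp: f.zero)
  next
    case False
    define t where "t = r / (2 * norm y)"
    have t: "0 < t" using False r by (simp add: t_def)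
    have "norm (t *\<^sub>R y) < r" "t *\<^sub>R y \<in> f ` V"
      using False r t subspace_scale[OF fV y] by (auto simp: t_def)
    from small[OF this(2,1), of "t * e"] obtain x where
      x: "x \<in> V" "norm x \<le> 2 * real n" "norm (t *\<^sub>R y - f x) < t * e"
      using t e by auto
    let ?x = "(1 / t) *\<^sub>R x"
    have "norm ?x \<le> (1 / t) * (2 * real n)"
      using x t by (simp add: divide_right_mono)
    also have "\<dots> = L * norm y"
      using False r by (simp add: t_def L_def)
    finally have "norm ?x \<le> L * norm y" .
    moreover have "norm (y - f ?x) < e"
    proof -
      have "y - f ?x = (1 / t) *\<^sub>R (t *\<^sub>R y - f x)"
        using t by (simp add: f.scaleR scaleR_diff_right)
      then have "norm (y - f ?x) = norm (t *\<^sub>R y - f x) / t"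
        using t by simp
      also have "\<dots> < e"
        using x t by (simp add: divide_less_eq mult.commute)
      finally show ?thesis .
    qed
    ultimately show ?thesis
      using x subspace_scale[OF V] by blast
  qed
  moreover have "0 \<le> L" using r by (simp add: L_def)
  ultimately show ?thesis by blast
qed

text \<open>Successive approximation: each step halves the remaining error, so the corrections form a
geometric series. The section need not be linear, but it is bounded.\<close>
lemma open_mapping_section:
  fixes f :: "'a::banach \<Rightarrow> 'b::banach"
  assumes f: "bounded_linear f" and V: "subspace V" and cV: "closed V" and cfV: "closed (f ` V)"
  shows "\<exists>K>0. \<exists>h. \<forall>y\<in>f ` V. h y \<in> V \<and> f (h y) = y \<and> norm (h y) \<le> K * norm y"
proof -
  interpret f: bounded_linear f by (rule f)
  have fV: "subspace (f ` V)"
    using V f.linear_axioms real_vector.linear_subspace_image by blast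
  obtain L where L: "0 \<le> L" and
    Lx: "\<And>y e. y \<in> f ` V \<Longrightarrow> 0 < e \<Longrightarrow> \<exists>x\<in>V. norm x \<le> L * norm y \<and> norm (y - f x) < e"
    using open_mapping_approx[OF f V cfV] by blast
  have "\<exists>x\<in>V. norm x \<le> L * norm y \<and> norm (y - f x) \<le> norm y / 2" if "y \<in> f ` V" for y
  proof (cases "y = 0")
    case True
    then show ?thesis using subspace_0[OF V] by (intro bexI[of _ 0]) (auto simp: f.zero)
  next
    case False
    then show ?thesis using Lx[OF that, of "norm y / 2"] by fastforce
  qed
  then have "\<exists>g. \<forall>y\<in>f ` V. g y \<in> V \<and> norm (g y) \<le> L * norm y \<and> norm (y - f (g y)) \<le> norm y / 2"
    by (intro bchoice) blast
  then obtain g where g: "\<And>y. y \<in> f ` V \<Longrightarrow> g y \<in> V" "\<And>y. y \<in> f ` V \<Longrightarrow> norm (g y) \<le> L * norm y"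
    "\<And>y. y \<in> f ` V \<Longrightarrow> norm (y - f (g y)) \<le> norm y / 2"
    by blast
  have "\<exists>x\<in>V. f x = y \<and> norm x \<le> (2 * L + 1) * norm y" if y: "y \<in> f ` V" for y
  proof -
    define h where "h z = z - f (g z)" for z
    define Y where "Y k = (h ^^ k) y" for k
    have Y: "Y k \<in> f ` V \<and> norm (Y k) \<le> norm y * (1/2) ^ k" for k
    proof (induction k)
      case 0
      then show ?case using y by (simp add: Y_def)
    next
      case (Suc k)
      have "Y (Suc k) = Y k - f (g (Y k))"
        by (simp add: Y_def h_def)
      then show ?case
        using Suc g(1)[of "Y k"] g(3)[of "Y k"] subspace_diff[OF fV, of "Y k" "f (g (Y k))"] by auto
    qed
    have bnd: "norm (g (Y k)) \<le> (L * norm y) * (1/2) ^ k" for k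
      using g(2)[of "Y k"] Y[of k] mult_left_mono[OF conjunct2[OF Y[of k]] L]
      by (simp add: mult.assoc)
    have sm: "summable (\<lambda>k. norm (g (Y k)))"
      by (rule summable_comparison_test'[of "\<lambda>k. (L * norm y) * (1/2) ^ k"])
        (use bnd in \<open>auto intro!: summable_mult summable_geometric\<close>)
    then have sg: "summable (\<lambda>k. g (Y k))"
      by (rule summable_norm_cancel)
    define x where "x = (\<Sum>k. g (Y k))"
    have lim: "(\<lambda>n. \<Sum>k<n. g (Y k)) \<longlonglongrightarrow> x"
      unfolding x_def using sg by (rule summable_LIMSEQ)
    have xV: "x \<in> V"
      using g Y by (intro closed_sequentially[OF cV _ lim] subspace_sum[OF V]) blast
    have part: "f (\<Sum>k<n. g (Y k)) = y - Y n" for n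
    proof (induction n)
      case 0
      then show ?case by (simp add: f.zero Y_def)
    next
      case (Suc n)
      have "Y (Suc n) = Y n - f (g (Y n))"
        by (simp add: Y_def h_def)
      then show ?case using Suc by (simp add: f.add)
    qed
    have "Y \<longlonglongrightarrow> 0"
    proof (rule Lim_null_comparison)
      show "\<forall>\<^sub>F k in sequentially. norm (Y k) \<le> norm y * (1/2) ^ k"
        using Y by simp
      show "(\<lambda>k. norm y * (1/2) ^ k) \<longlonglongrightarrow> 0"
        by (intro tendsto_mult_right_zero LIMSEQ_power_zero) simp
    qed
    then have "(\<lambda>n. y - Y n) \<longlonglongrightarrow> y - 0"
      by (intro tendsto_intros)
    moreover have "(\<lambda>n. y - Y n) \<longlonglongrightarrow> f x"
      using f.tendsto[OF lim] by (simp add: part)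
    ultimately have "f x = y"
      using LIMSEQ_unique by fastforce
    moreover have "norm x \<le> 2 * L * norm y"
    proof -
      have "norm x \<le> (\<Sum>k. norm (g (Y k)))"
        unfolding x_def using sm by (rule summable_norm)
      also have "\<dots> \<le> (\<Sum>k. (L * norm y) * (1/2) ^ k)"
        using bnd sm by (intro suminf_le summable_mult summable_geometric) auto
      also have "\<dots> = (L * norm y) * 2"
        using suminf_geometric[of "1/2::real"] by (subst suminf_mult) auto
      finally show ?thesis by simp
    qed
    moreover have "2 * L * norm y \<le> (2 * L + 1) * norm y"
      by (intro mult_right_mono) auto
    ultimately show ?thesis using xV by (intro bexI[of _ x]) auto
  qed
  then have "\<exists>h. \<forall>y\<in>f ` V. h y \<in> V \<and> f (h y) = y \<and> norm (h y) \<le> (2 * L + 1) * norm y"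
    by (intro bchoice) blast
  then show ?thesis
    using L by (intro exI[of _ "2 * L + 1"]) simp
qed

lemma lift_null_sequence:
  fixes f :: "'a::banach \<Rightarrow> 'b::banach"
  assumes f: "bounded_linear f" and V: "subspace V" "closed V" and cfV: "closed (f ` V)"
    and y: "\<And>n. y n \<in> f ` V" "y \<longlonglongrightarrow> 0"
  obtains x where "\<And>n. x n \<in> V" "\<And>n. f (x n) = y n" "x \<longlonglongrightarrow> 0"
proof -
  obtain K h where h: "\<forall>y\<in>f ` V. h y \<in> V \<and> f (h y) = y \<and> norm (h y) \<le> K * norm y"
    using open_mapping_section[OF f V cfV] by blast
  define x where "x n = h (y n)" for n
  have x: "x n \<in> V" "f (x n) = y n" "norm (x n) \<le> K * norm (y n)" for n
    using h y(1)[of n] by (auto simp: x_def)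
  have "x \<longlonglongrightarrow> 0"
  proof (rule Lim_null_comparison)
    show "\<forall>\<^sub>F n in sequentially. norm (x n) \<le> K * norm (y n)"
      using x(3) by simp
    show "(\<lambda>n. K * norm (y n)) \<longlonglongrightarrow> 0"
      using y(2) by (intro tendsto_mult_right_zero tendsto_norm_zero)
  qed
  then show ?thesis using that[of x] x(1,2) by simp
qed

section \<open>Bounded operators and closed ranges\<close>

lemma bounded_clinear_clinear: "bounded_clinear f \<Longrightarrow> clinear f"
  unfolding bounded_clinear_def
  by unfold_locales (auto simp: linear_simps)

lemma bounded_clinear_bounded_linear: "bounded_clinear f \<Longrightarrow> bounded_linear f"
  unfolding bounded_clinear_def by blast

lemma bounded_clinear_shift:
  assumes "bounded_clinear f"
  shows "bounded_clinear (\<lambda>x. f x - \<mu> *\<^sub>C x)"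
  using assms unfolding bounded_clinear_def
  by (auto intro!: bounded_linear_sub bounded_linear_scaleC
      simp: complex_vector.scale_right_diff_distrib scaleC_scaleC mult.commute)

lemma bounded_clinear_funpow: "bounded_clinear f \<Longrightarrow> bounded_clinear (f ^^ n)"
proof (induction n)
  case 0
  then show ?case by (simp add: bounded_clinear_def id_def)
next
  case (Suc n)
  then show ?case
    using bounded_linear_compose[of f "f ^^ n"] by (auto simp: bounded_clinear_def o_def)
qed

lemma csubspace_imp_subspace: "csubspace V \<Longrightarrow> subspace V"
  unfolding subspace_def
  by (auto simp: scaleR_scaleC complex_vector.subspace_0 complex_vector.subspace_add
      complex_vector.subspace_scale)

lemma csubspace_image: "bounded_clinear f \<Longrightarrow> csubspace V \<Longrightarrow> csubspace (f ` V)"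
  by (rule complex_pair.linear_subspace_image[OF bounded_clinear_clinear])

lemma csubspace_kernel_on: "bounded_clinear f \<Longrightarrow> csubspace V \<Longrightarrow> csubspace {x \<in> V. f x = 0}"
proof -
  assume f: "bounded_clinear f" and V: "csubspace V"
  interpret f: Vector_Spaces.linear scaleC scaleC f by (rule bounded_clinear_clinear[OF f])
  have "{x \<in> V. f x = 0} = V \<inter> {x. f x = 0}" by blast
  then show ?thesis using complex_vector.subspace_inter[OF V f.subspace_kernel] by simp
qed

text \<open>For \<open>b\<close> outside \<open>W\<close>, the coefficient of \<open>b\<close> in \<open>w + c b\<close> is bounded by the norm divided by the
distance from \<open>b\<close> to \<open>W\<close>. Hence the coefficients of a convergent sequence are Cauchy.\<close>
lemma closed_ssum_line:
  fixes W :: "'a::complex_banach set"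
  assumes W: "csubspace W" and cW: "closed W"
  shows "closed (ssum W (cspan {b}))"
proof (cases "b \<in> W")
  case True
  have "ssum W (cspan {b}) = W"
  proof
    show "ssum W (cspan {b}) \<subseteq> W"
      using complex_vector.span_minimal[of "{b}" W] True W
      unfolding ssum_def by (auto intro: complex_vector.subspace_add)
    show "W \<subseteq> ssum W (cspan {b})"
      using subset_ssum complex_vector.span_zero by blast
  qed
  then show ?thesis using cW by simp
next
  case False
  have W0: "0 \<in> W" using complex_vector.subspace_0[OF W] .
  define d where "d = infdist b W"
  have "W \<noteq> {}" using W0 by blast
  then have d: "0 < d"
    using False cW in_closed_iff_infdist_zero[of W b] infdist_nonneg[of b W] unfolding d_def
    by (metis less_eq_real_def)
  have low: "cmod c * d \<le> norm (w + c *\<^sub>C b)" if w: "w \<in> W" for w c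
  proof (cases "c = 0")
    case c: False
    let ?v = "- inverse c *\<^sub>C w"
    have "?v \<in> W" using w W by (simp add: complex_vector.subspace_neg complex_vector.subspace_scale)
    then have "d \<le> dist b ?v" unfolding d_def by (rule infdist_le)
    moreover have "w + c *\<^sub>C b = c *\<^sub>C (b - ?v)"
      using c by (simp add: complex_vector.scale_right_diff_distrib scaleC_add_right scaleC_scaleC scaleC_one)
    then have "norm (w + c *\<^sub>C b) = cmod c * dist b ?v"
      by (simp add: norm_scaleC dist_norm)
    ultimately show ?thesis by (simp add: mult_left_mono)
  qed simp
  show ?thesis
    unfolding closed_sequential_limits
  proof (intro allI impI)
    fix y l assume "(\<forall>n. y n \<in> ssum W (cspan {b})) \<and> y \<longlonglongrightarrow> l"
    then have y: "\<And>n. y n \<in> ssum W (cspan {b})" and l: "y \<longlonglongrightarrow> l" by auto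
    have "\<exists>w c. w \<in> W \<and> y n = w + c *\<^sub>C b" for n
      using y[of n] unfolding ssum_def complex_vector.span_singleton by blast
    then obtain w c where wc: "\<And>n. w n \<in> W" "\<And>n. y n = w n + c n *\<^sub>C b"
      by metis
    have "Cauchy c"
    proof (rule CauchyI)
      fix e :: real assume e: "0 < e"
      then obtain M where M: "\<And>m n. m \<ge> M \<Longrightarrow> n \<ge> M \<Longrightarrow> norm (y m - y n) < e * d"
        using CauchyD[OF LIMSEQ_imp_Cauchy[OF l], of "e * d"] d by auto
      have "norm (c m - c n) < e" if "m \<ge> M" "n \<ge> M" for m n
      proof -
        have "y m - y n = (w m - w n) + (c m - c n) *\<^sub>C b"
          by (simp add: wc complex_vector.scale_left_diff_distrib)
        then have "cmod (c m - c n) * d \<le> norm (y m - y n)"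
          using low[of "w m - w n" "c m - c n"] wc(1) W by (simp add: complex_vector.subspace_diff)
        also have "\<dots> < e * d" using M that by blast
        finally show ?thesis using d by simp
      qed
      then show "\<exists>M. \<forall>m\<ge>M. \<forall>n\<ge>M. norm (c m - c n) < e" by blast
    qed
    then obtain c0 where c0: "c \<longlonglongrightarrow> c0"
      using Cauchy_convergent_iff convergent_def by blast
    have "(\<lambda>n. c n *\<^sub>C b) \<longlonglongrightarrow> c0 *\<^sub>C b"
    proof -
      have "(\<lambda>n. norm ((c n - c0) *\<^sub>C b)) \<longlonglongrightarrow> 0 * norm b"
        unfolding norm_scaleC using c0
        by (intro tendsto_mult tendsto_const) (simp add: LIM_zero tendsto_norm_zero)
      then have "(\<lambda>n. c n *\<^sub>C b - c0 *\<^sub>C b) \<longlonglongrightarrow> 0"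
        by (simp add: tendsto_norm_zero_iff complex_vector.scale_left_diff_distrib)
      then show ?thesis by (rule LIM_zero_cancel)
    qed
    with l have "(\<lambda>n. y n - c n *\<^sub>C b) \<longlonglongrightarrow> l - c0 *\<^sub>C b"
      by (rule tendsto_diff)
    then have "w \<longlonglongrightarrow> l - c0 *\<^sub>C b" by (simp add: wc)
    then have "l - c0 *\<^sub>C b \<in> W"
      using closed_sequentially[OF cW] wc(1) by blast
    then show "l \<in> ssum W (cspan {b})"
      unfolding ssum_def
      by (intro CollectI exI[of _ "l - c0 *\<^sub>C b"] exI[of _ "c0 *\<^sub>C b"])
        (simp add: complex_vector.span_base complex_vector.span_scale)
  qed
qed

lemma closed_ssum_cspan:
  assumes W: "csubspace W" and cW: "closed W" and B: "finite B"
  shows "closed (ssum W (cspan B))"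
  using B
proof (induction B rule: finite_induct)
  case empty
  have "ssum W (cspan {}) = W" by (simp add: ssum_def)
  then show ?case using cW by simp
next
  case (insert b B)
  have "ssum W (cspan (insert b B)) = ssum (ssum W (cspan B)) (cspan {b})"
    by (simp add: ssum_assoc ssum_cspan)
  then show ?case
    using closed_ssum_line[OF csubspace_ssum[OF W] insert.IH] by simp
qed

lemma closed_ssum_finite_dim:
  assumes W: "csubspace W" and cW: "closed W" and N: "csubspace N" "finite_dim N"
  shows "closed (ssum W N)"
proof -
  obtain B where "finite B" "cspan B = N"
    using finite_dim_obtain_basis[OF N] by metis
  then show ?thesis using closed_ssum_cspan[OF W cW] by blast
qed

lemma closed_finite_dim:
  assumes N: "csubspace N" "finite_dim N"
  shows "closed N"
proof -
  have "ssum {0} N = N" by (simp add: ssum_def)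
  then show ?thesis using closed_ssum_finite_dim[OF _ _ N, of "{0}"] by simp
qed

text \<open>The preimage of the image of \<open>W\<close> in \<open>V\<close> is \<open>W\<close> plus the finite dimensional kernel, which is closed; by
the open mapping theorem, closedness passes back to the image.\<close>
lemma closed_image_closed_subspace:
  assumes f: "bounded_clinear f" and V: "csubspace V" "closed V" and cfV: "closed (f ` V)"
    and fin: "finite_dim {x\<in>V. f x = 0}" and W: "csubspace W" "closed W" "W \<subseteq> V"
  shows "closed (f ` W)"
proof -
  let ?N = "{x\<in>V. f x = 0}"
  interpret f: bounded_linear f by (rule bounded_clinear_bounded_linear[OF f])
  have N: "csubspace ?N" using csubspace_kernel_on[OF f V(1)] .
  have cWN: "closed (ssum W ?N)" using closed_ssum_finite_dim[OF W(1,2) N fin] .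
  show ?thesis
    unfolding closed_sequential_limits
  proof (intro allI impI)
    fix y l assume "(\<forall>n. y n \<in> f ` W) \<and> y \<longlonglongrightarrow> l"
    then have y: "\<And>n. y n \<in> f ` W" and l: "y \<longlonglongrightarrow> l" by auto
    have "l \<in> f ` V"
      using closed_sequentially[OF cfV _ l] y W(3) by blast
    then obtain v where v: "v \<in> V" "l = f v" by blast
    have "y n - l \<in> f ` V" for n
    proof -
      obtain w where w: "w \<in> W" "y n = f w" using y by blast
      have "w - v \<in> V" using w(1) W(3) v(1) complex_vector.subspace_diff[OF V(1)] by blast
      then show ?thesis using w(2) v(2) f.diff[of w v] by (metis imageI)
    qed
    moreover have "(\<lambda>n. y n - l) \<longlonglongrightarrow> 0"
      using l by (simp add: LIM_zero)
    ultimately obtain x where x: "\<And>n. x n \<in> V" "\<And>n. f (x n) = y n - l" "x \<longlonglongrightarrow> 0"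
      using lift_null_sequence[OF f.bounded_linear_axioms csubspace_imp_subspace[OF V(1)] V(2) cfV]
      by (metis (no_types, lifting))
    have lim: "(\<lambda>n. v + x n) \<longlonglongrightarrow> v"
      using tendsto_add[OF tendsto_const x(3), of v] by simp
    have "v + x n \<in> ssum W ?N" for n
    proof -
      obtain w where w: "w \<in> W" "y n = f w" using y by blast
      have "v + x n \<in> V"
        using v x complex_vector.subspace_add[OF V(1)] by blast
      then have "v + x n - w \<in> ?N"
        using w x(2) v W(3) complex_vector.subspace_diff[OF V(1)] by (auto simp: f.add f.diff)
      then show ?thesis
        unfolding ssum_def using w by (intro CollectI exI[of _ w] exI[of _ "v + x n - w"]) simp
    qed
    then have "v \<in> ssum W ?N"
      using closed_sequentially[OF cWN _ lim] by blast
    then obtain w u where "v = w + u" "w \<in> W" "f u = 0"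
      unfolding ssum_def by blast
    then show "l \<in> f ` W"
      using v by (auto simp: f.add)
  qed
qed

lemma range_funpow_Suc: fixes f :: "'a \<Rightarrow> 'a" shows "range (f ^^ Suc n) = f ` range (f ^^ n)"
  by (simp add: image_comp)

lemma range_funpow_antimono: fixes f :: "'a \<Rightarrow> 'a" shows "n \<le> m \<Longrightarrow> range (f ^^ m) \<subseteq> range (f ^^ n)"
proof (induction m rule: dec_induct)
  case (step m)
  have "range (f ^^ Suc m) \<subseteq> range (f ^^ m)"
  proof
    fix y assume "y \<in> range (f ^^ Suc m)"
    then obtain x where "y = (f ^^ m) (f x)" by (auto simp: funpow_swap1)
    then show "y \<in> range (f ^^ m)" by blast
  qed
  then show ?case using step by blast
qed simp

lemma csubspace_range_funpow: "bounded_clinear f \<Longrightarrow> csubspace (range (f ^^ n))"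
  by (rule csubspace_image[OF bounded_clinear_funpow]) simp_all

lemma closed_range_funpow:
  assumes f: "bounded_clinear f" and cl: "closed (range (f ^^ n))" "closed (range (f ^^ Suc n))"
    and fin: "finite_dim {x\<in>range (f ^^ n). f x = 0}" and "n \<le> m"
  shows "closed (range (f ^^ m))"
  using \<open>n \<le> m\<close>
proof (induction m rule: dec_induct)
  case (step m)
  show ?case
    unfolding range_funpow_Suc[of m f]
    using closed_image_closed_subspace[OF f csubspace_range_funpow[OF f] cl(1) _ fin
        csubspace_range_funpow[OF f] step.IH range_funpow_antimono[OF step.hyps(1)]] cl(2)
    unfolding range_funpow_Suc[of n f] .
qed (rule cl)

text \<open>A limit \<open>l\<close> of points in the range of \<open>f\<close> is first corrected by the section of \<open>g \<circ> f\<close>; what is left over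
is a limit of points in the image of the finite dimensional kernel of \<open>g \<circ> f\<close>, which is closed.\<close>
lemma closed_range_of_comp:
  fixes f g :: "'a::complex_banach \<Rightarrow> 'a"
  assumes f: "bounded_clinear f" and g: "bounded_clinear g"
    and cl: "closed (range (g \<circ> f))" and fin: "finite_dim {x. g (f x) = 0}"
  shows "closed (range f)"
proof -
  interpret f: bounded_linear f by (rule bounded_clinear_bounded_linear[OF f])
  interpret g: bounded_linear g by (rule bounded_clinear_bounded_linear[OF g])
  have gf: "bounded_clinear (g \<circ> f)"
    using f g bounded_linear_compose[of g f] by (auto simp: bounded_clinear_def o_def)
  let ?N = "{x. g (f x) = 0}"
  have N: "csubspace ?N"
    using csubspace_kernel_on[OF gf, of UNIV] by simp
  have fN: "csubspace (f ` ?N)" using csubspace_image[OF f N] .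
  have "finite_dim (f ` ?N)"
  proof -
    obtain B where B: "finite B" "cspan B = ?N"
      using finite_dim_obtain_basis[OF N fin] by metis
    have "f ` ?N = cspan (f ` B)"
      using clinear_span_image[OF bounded_clinear_clinear[OF f]] B by metis
    then show ?thesis using finite_dim_cspan B(1) by (metis finite_imageI)
  qed
  then have cfN: "closed (f ` ?N)" using closed_finite_dim[OF fN] by blast
  show ?thesis
    unfolding closed_sequential_limits
  proof (intro allI impI)
    fix y l assume "(\<forall>n. y n \<in> range f) \<and> y \<longlonglongrightarrow> l"
    then have "\<forall>n. \<exists>x. y n = f x" and l: "y \<longlonglongrightarrow> l" by auto
    then obtain x where x: "\<And>n. y n = f (x n)" by metis
    have gl: "(\<lambda>n. g (y n)) \<longlonglongrightarrow> g l" using g.tendsto[OF l] .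
    have "g l \<in> range (g \<circ> f)"
      by (rule closed_sequentially[OF cl _ gl]) (simp add: x)
    then obtain u where u: "g l = g (f u)" by auto
    have "g (y n) - g l \<in> range (g \<circ> f)" for n
      by (rule image_eqI[of _ _ "x n - u"]) (simp_all add: x u f.diff g.diff)
    moreover have "(\<lambda>n. g (y n) - g l) \<longlonglongrightarrow> 0"
      using gl by (simp add: LIM_zero)
    ultimately obtain z where z: "\<And>n. (g \<circ> f) (z n) = g (y n) - g l" "z \<longlonglongrightarrow> 0"
      using lift_null_sequence[OF bounded_clinear_bounded_linear[OF gf] subspace_UNIV closed_UNIV cl]
      by (metis (no_types, lifting))
    from f.tendsto[OF z(2)] have fz: "(\<lambda>n. f (z n)) \<longlonglongrightarrow> 0" by (simp add: f.zero)
    have "y n - f u - f (z n) \<in> f ` ?N" for n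
      by (rule image_eqI[of _ _ "x n - u - z n"])
        (use z(1)[of n] in \<open>simp_all add: x u f.diff g.diff\<close>)
    moreover have "(\<lambda>n. y n - f u - f (z n)) \<longlonglongrightarrow> l - f u - 0"
      by (intro tendsto_intros l fz)
    ultimately have "l - f u - 0 \<in> f ` ?N"
      by (rule closed_sequentially[OF cfN])
    then obtain v where "l - f u = f v" by auto
    then have "l = f (u + v)" by (simp add: f.add algebra_simps)
    then show "l \<in> range f" by blast
  qed
qed

lemma finite_dim_vimage:
  assumes f: "clinear f" and fin: "finite_dim {x. f x = 0}" and W: "csubspace W" "finite_dim W"
  shows "finite_dim {x. f x \<in> W}"
proof -
  interpret f: Vector_Spaces.linear scaleC scaleC f by (rule f)
  obtain B where B: "finite B" "{x. f x = 0} \<subseteq> cspan B"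
    using fin unfolding finite_dim_def by blast
  have s: "csubspace (W \<inter> range f)"
    using W(1) f.subspace_image[of UNIV] by (intro complex_vector.subspace_inter) auto
  obtain C where C: "finite C" "cspan C = W \<inter> range f"
    using finite_dim_obtain_basis[OF s finite_dim_subset[OF W(2) Int_lower1]] by metis
  have "C \<subseteq> range f" using complex_vector.span_superset[of C] C(2) by simp
  then obtain D where D: "finite D" "C = f ` D"
    using C(1) finite_subset_image[of C f UNIV] by blast
  have "{x. f x \<in> W} \<subseteq> cspan (D \<union> B)"
  proof
    fix x assume "x \<in> {x. f x \<in> W}"
    then have "f x \<in> f ` cspan D"
      using C(2) D(2) clinear_span_image[OF f, of D] by auto
    then obtain d where d: "d \<in> cspan D" "f x = f d" by blast
    then have "x - d \<in> cspan B" using B by (auto simp: f.diff)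
    then have "d + (x - d) \<in> cspan (D \<union> B)"
      unfolding complex_vector.span_Un using d by blast
    then show "x \<in> cspan (D \<union> B)" by simp
  qed
  then show ?thesis
    unfolding finite_dim_def using B(1) D(1) by blast
qed

lemma finite_dim_kernel_funpow:
  assumes f: "bounded_clinear f" and fin: "finite_dim {x. f x = 0}"
  shows "finite_dim {x. (f ^^ n) x = 0}"
proof (induction n)
  case 0
  have "{x. (f ^^ 0) x = 0} \<subseteq> cspan {}" by auto
  then show ?case unfolding finite_dim_def by blast
next
  case (Suc n)
  have "csubspace {x. (f ^^ n) x = 0}"
    using csubspace_kernel_on[OF bounded_clinear_funpow[OF f], of UNIV] by simp
  from finite_dim_vimage[OF bounded_clinear_clinear[OF f] fin this Suc]
  show ?case by (simp add: funpow_Suc_right del: funpow.simps)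
qed

section \<open>Trivial kernel on the ranges of high powers\<close>

text \<open>The preimages \<open>x\<^sub>k\<close> of \<open>x\<^sub>0\<close> under iterates of \<open>f\<close> can be chosen with geometrically bounded norms, and
\<open>\<Sum>\<mu>\<^sup>k x\<^sub>k\<close> is an eigenvector for \<open>\<mu>\<close>.\<close>
lemma eigenvectors_near_zero:
  fixes f :: "'a::complex_banach \<Rightarrow> 'a"
  assumes f: "bounded_clinear f" and M: "csubspace M" "closed M" and fM: "f ` M = M"
    and x0: "x0 \<in> M" "x0 \<noteq> 0" "f x0 = 0"
  shows "\<exists>e>0. \<forall>\<mu>. cmod \<mu> < e \<longrightarrow> (\<exists>x. x \<noteq> 0 \<and> f x = \<mu> *\<^sub>C x)"
proof -
  interpret f: bounded_linear f by (rule bounded_clinear_bounded_linear[OF f])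
  have cfM: "closed (f ` M)" using M(2) fM by simp
  obtain K h where K: "0 < K"
    and "\<forall>y\<in>f ` M. h y \<in> M \<and> f (h y) = y \<and> norm (h y) \<le> K * norm y"
    using open_mapping_section[OF f.bounded_linear_axioms csubspace_imp_subspace[OF M(1)] M(2) cfM]
    by blast
  then have h: "h y \<in> M" "f (h y) = y" "norm (h y) \<le> K * norm y" if "y \<in> M" for y
    using that fM by auto
  define X where "X k = (h ^^ k) x0" for k
  have XM: "X k \<in> M" for k
    by (induction k) (auto simp: X_def x0 h)
  have Xn: "norm (X k) \<le> K ^ k * norm x0" for k
  proof (induction k)
    case (Suc k)
    have "norm (X (Suc k)) \<le> K * norm (X k)"
      using h(3)[OF XM[of k]] by (simp add: X_def)
    also have "\<dots> \<le> K * (K ^ k * norm x0)"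
      using Suc K by (intro mult_left_mono) auto
    finally show ?case by (simp add: mult.assoc)
  qed (simp add: X_def)
  have fX: "f (X (Suc k)) = X k" for k
    using h(2)[OF XM[of k]] by (simp add: X_def)
  show ?thesis
  \<comment> \<open>this radius keeps the tail of the series smaller than \<open>norm x0\<close>, so the sum is nonzero\<close>
  proof (intro exI[of _ "1 / (4 * K)"] conjI allI impI)
    show "0 < 1 / (4 * K)" using K by simp
    fix \<mu> assume mu: "cmod \<mu> < 1 / (4 * K)"
    define q where "q = cmod \<mu> * K"
    have q: "0 \<le> q" "q < 1 / 4"
      using mu K by (auto simp: q_def field_simps)
    define Y where "Y k = \<mu> ^ k *\<^sub>C X k" for k
    have Yn: "norm (Y k) \<le> q ^ k * norm x0" for k
    proof -
      have "norm (Y k) = cmod \<mu> ^ k * norm (X k)"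
        by (simp add: Y_def norm_scaleC norm_power)
      also have "\<dots> \<le> cmod \<mu> ^ k * (K ^ k * norm x0)"
        using Xn by (intro mult_left_mono) auto
      finally show ?thesis by (simp add: q_def power_mult_distrib mult.assoc)
    qed
    have geo: "summable (\<lambda>k. q ^ k * norm x0)"
      using q by (intro summable_mult2 summable_geometric) simp
    have smn: "summable (\<lambda>k. norm (Y k))"
      using Yn by (intro summable_comparison_test'[OF geo, of 0]) auto
    then have sm: "summable Y" by (rule summable_norm_cancel)
    define x where "x = suminf Y"
    have xsplit: "x = x0 + (\<Sum>k. Y (Suc k))"
      using suminf_split_head[OF sm] by (simp add: x_def Y_def X_def scaleC_one)
    have smnS: "summable (\<lambda>k. norm (Y (Suc k)))"
      using smn summable_Suc_iff[of "\<lambda>k. norm (Y k)"] by simp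
    have geoS: "summable (\<lambda>k. (q * norm x0) * q ^ k)"
      using q by (intro summable_mult summable_geometric) simp
    have "norm (\<Sum>k. Y (Suc k)) \<le> (\<Sum>k. norm (Y (Suc k)))"
      using smnS by (rule summable_norm)
    also have "\<dots> \<le> (\<Sum>k. (q * norm x0) * q ^ k)"
    proof (rule suminf_le[OF _ smnS geoS])
      show "norm (Y (Suc k)) \<le> (q * norm x0) * q ^ k" for k
        using Yn[of "Suc k"] by (simp add: mult.commute mult.left_commute)
    qed
    also have "\<dots> = q / (1 - q) * norm x0"
      using q suminf_mult[OF summable_geometric[of q], of "q * norm x0"] suminf_geometric[of q] by simp
    also have "\<dots> < norm x0"
    proof -
      have "q / (1 - q) < 1" using q by (simp add: field_simps)
      then have "q / (1 - q) * norm x0 < 1 * norm x0"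
        using x0(2) by (intro mult_strict_right_mono) auto
      then show ?thesis by simp
    qed
    finally have "x \<noteq> 0"
      using xsplit by (metis add_eq_0_iff norm_minus_cancel less_irrefl)
    moreover have "f x = \<mu> *\<^sub>C x"
    proof -
      have s: "summable (\<lambda>k. Y (Suc k))" using sm by (simp add: summable_Suc_iff)
      have "f (Y (Suc k)) = \<mu> *\<^sub>C Y k" for k
        using f fX[of k] unfolding Y_def bounded_clinear_def
        by (simp add: scaleC_scaleC del: funpow.simps)
      then have "f (\<Sum>k. Y (Suc k)) = (\<Sum>k. \<mu> *\<^sub>C Y k)"
        using f.suminf[OF s] by simp
      also have "\<dots> = \<mu> *\<^sub>C x"
        unfolding x_def using bounded_linear.suminf[OF bounded_linear_scaleC sm] by simp
      finally show ?thesis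
        using xsplit x0(3) by (simp add: f.add)
    qed
    ultimately show "\<exists>x. x \<noteq> 0 \<and> f x = \<mu> *\<^sub>C x" by blast
  qed
qed

text \<open>The kernels within the ranges of the powers decrease and are finite dimensional, so they become
constant. A nonzero constant value would lie in the intersection of all ranges, on which \<open>f\<close> is
surjective, and so would produce eigenvectors for all small scalars.\<close>
lemma kernel_meets_range_funpow_trivially:
  fixes f :: "'a::complex_banach \<Rightarrow> 'a"
  assumes f: "bounded_clinear f" and cl: "closed (range (f ^^ n))" "closed (range (f ^^ Suc n))"
    and fin: "finite_dim {x\<in>range (f ^^ n). f x = 0}"
    and inj: "\<And>e. 0 < e \<Longrightarrow> \<exists>\<mu>. cmod \<mu> < e \<and> (\<forall>x. f x = \<mu> *\<^sub>C x \<longrightarrow> x = 0)"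
  shows "\<exists>m\<ge>n. {x\<in>range (f ^^ m). f x = 0} = {0}"
proof -
  interpret f: bounded_linear f by (rule bounded_clinear_bounded_linear[OF f])
  define R where "R m = range (f ^^ m)" for m
  define N where "N m = {x\<in>R m. f x = 0}" for m
  have Rs: "csubspace (R m)" for m
    unfolding R_def by (rule csubspace_range_funpow[OF f])
  have Rmono: "R m \<subseteq> R k" if "k \<le> m" for k m
    unfolding R_def using that by (rule range_funpow_antimono)
  have RSuc: "R (Suc m) = f ` R m" for m
    unfolding R_def by (rule range_funpow_Suc)
  have Ns: "csubspace (N m)" for m
    unfolding N_def by (rule csubspace_kernel_on[OF f Rs])
  have Rc: "closed (R m)" if "n \<le> m" for m
    unfolding R_def by (rule closed_range_funpow[OF f cl fin that])
  have Nfin: "finite_dim (N m)" if "n \<le> m" for m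
    by (rule finite_dim_subset[OF fin]) (use Rmono[OF that] in \<open>auto simp: N_def R_def\<close>)
  obtain m where m: "n \<le> m" "\<And>k. n \<le> k \<Longrightarrow> cdim (N m) \<le> cdim (N k)"
    using ex_has_least_nat[of "\<lambda>k. n \<le> k" n "\<lambda>k. cdim (N k)"] by blast
  have stable: "N k = N m" if "m \<le> k" for k
  proof (rule csubspace_eq_of_cdim_le[OF Ns Nfin[OF m(1)] Ns])
    show "N k \<subseteq> N m" using Rmono[OF that] by (auto simp: N_def)
    show "cdim (N m) \<le> cdim (N k)" using m that by simp
  qed
  define M where "M = (\<Inter>k\<in>{m..}. R k)"
  have Ms: "csubspace M" unfolding M_def by (intro complex_vector.subspace_Int Rs)
  have Mc: "closed M" unfolding M_def using Rc m(1) by (intro closed_INT) auto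
  have NM: "N m \<subseteq> M"
  proof
    fix x assume x: "x \<in> N m"
    have "x \<in> R k" if "m \<le> k" for k
      using x unfolding stable[OF that, symmetric] by (simp add: N_def)
    then show "x \<in> M" by (simp add: M_def)
  qed
  have fM: "f ` M = M"
  proof
    show "f ` M \<subseteq> M"
    proof
      fix y assume "y \<in> f ` M"
      then obtain x where x: "x \<in> M" "y = f x" by blast
      have "y \<in> R k" if "m \<le> k" for k
      proof -
        have "x \<in> R k" using x that by (simp add: M_def)
        then have "y \<in> R (Suc k)" using x RSuc by blast
        then show ?thesis using Rmono[of k "Suc k"] by auto
      qed
      then show "y \<in> M" by (simp add: M_def)
    qed
    show "M \<subseteq> f ` M"
    proof
      fix y assume y: "y \<in> M"
      have "y \<in> f ` R k" if "m \<le> k" for k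
        using y that RSuc[of k] by (auto simp: M_def)
      then have pre: "\<exists>x\<in>R k. f x = y" if "m \<le> k" for k
        using that by blast
      \<comment> \<open>any two preimages of \<open>y\<close> differ by an element of the stable kernel, so one preimage lies in every range\<close>
      obtain x where x: "x \<in> R m" "f x = y" using pre by blast
      have "x \<in> R k" if k: "m \<le> k" for k
      proof -
        obtain z where z: "z \<in> R k" "f z = y" using pre k by blast
        have "x - z \<in> N m"
          using x z Rmono[OF k] Rs[of m] by (auto simp: N_def f.diff intro: complex_vector.subspace_diff)
        then have "x - z \<in> R k" unfolding stable[OF k, symmetric] by (simp add: N_def)
        then have "(x - z) + z \<in> R k" using z complex_vector.subspace_add[OF Rs] by blast
        then show ?thesis by simp
      qed
      then show "y \<in> f ` M" using x by (auto simp: M_def)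
    qed
  qed
  have "N m = {0}"
  proof (rule ccontr)
    assume "N m \<noteq> {0}"
    then obtain x0 where x0: "x0 \<in> N m" "x0 \<noteq> 0"
      using complex_vector.subspace_0[OF Ns[of m]] by blast
    then have "x0 \<in> M" "f x0 = 0" using NM by (auto simp: N_def)
    then obtain e where "e > 0" "\<And>\<mu>. cmod \<mu> < e \<Longrightarrow> \<exists>x. x \<noteq> 0 \<and> f x = \<mu> *\<^sub>C x"
      using eigenvectors_near_zero[OF f Ms Mc fM _ x0(2)] by blast
    then show False using inj by blast
  qed
  then show ?thesis using m(1) unfolding N_def R_def by blast
qed

section \<open>Orthogonal complements in Hilbert spaces\<close>

text \<open>The component \<open>p\<close> is the nearest point of \<open>V\<close>: minimising sequences are Cauchy by the parallelogram
law, and the first variation at the minimum is the orthogonality relation.\<close>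
lemma closed_orthogonal_decomposition:
  fixes V :: "'a::complex_hilbert set"
  assumes V: "csubspace V" and cV: "closed V"
  shows "\<exists>p\<in>V. \<forall>v\<in>V. cinner (x - p) v = 0"
proof -
  define J where "J v = (norm (x - v))\<^sup>2" for v
  define d where "d = Inf (J ` V)"
  have "0 \<in> V" using complex_vector.subspace_0[OF V] .
  have bdd: "bdd_below (J ` V)"
    by (rule bdd_belowI[of _ 0]) (auto simp: J_def)
  have d: "d \<le> J v" if "v \<in> V" for v
    unfolding d_def using that bdd by (intro cInf_lower) auto
  have "\<exists>v\<in>V. J v < d + 1 / real (Suc n)" for n
    using cInf_lessD[of "J ` V" "d + 1 / real (Suc n)"] \<open>0 \<in> V\<close> by (auto simp: d_def)
  then obtain X where X: "\<And>n. X n \<in> V" "\<And>n. J (X n) < d + 1 / real (Suc n)"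
    by metis
  have Vr: "subspace V" using csubspace_imp_subspace[OF V] .
  have mid: "(norm (a - b))\<^sup>2 \<le> 2 * (J a - d) + 2 * (J b - d)" if "a \<in> V" "b \<in> V" for a b
  proof -
    have "(1/2) *\<^sub>R (a + b) \<in> V"
      using that subspace_add[OF Vr] subspace_scale[OF Vr] by blast
    then have "d \<le> J ((1/2) *\<^sub>R (a + b))" by (rule d)
    also have "x - (1/2) *\<^sub>R (a + b) = (1/2) *\<^sub>R ((x - a) + (x - b))"
      by (simp add: algebra_simps flip: scaleR_add_left)
    then have "J ((1/2) *\<^sub>R (a + b)) = (norm ((x - a) + (x - b)))\<^sup>2 / 4"
      by (simp add: J_def power_divide)
    finally show ?thesis
      using parallelogram[of "x - a" "x - b"] by (simp add: J_def norm_minus_commute)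
  qed
  have "Cauchy X"
  proof (rule CauchyI)
    fix e :: real assume e: "0 < e"
    then obtain N where N: "4 / e\<^sup>2 < real N" using reals_Archimedean2 by blast
    have small: "J (X i) - d < e\<^sup>2 / 4" if "N \<le> i" for i
    proof -
      have "4 / e\<^sup>2 < real (Suc i)" using N that by linarith
      then have "1 / real (Suc i) < e\<^sup>2 / 4" using e by (simp add: field_simps)
      then show ?thesis using X(2)[of i] by linarith
    qed
    show "\<exists>N. \<forall>m\<ge>N. \<forall>n\<ge>N. norm (X m - X n) < e"
    proof (intro exI[of _ N] allI impI)
      fix m n assume "N \<le> m" "N \<le> n"
      then have "(norm (X m - X n))\<^sup>2 < e\<^sup>2"
        using mid[OF X(1) X(1), of m n] small[of m] small[of n] by argo
      then show "norm (X m - X n) < e"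
        using e power_less_imp_less_base by (metis less_imp_le)
    qed
  qed
  then obtain p where p: "X \<longlonglongrightarrow> p"
    using Cauchy_convergent_iff convergent_def by blast
  have pV: "p \<in> V" using closed_sequentially[OF cV X(1) p] .
  have "(\<lambda>n. J (X n)) \<longlonglongrightarrow> J p"
    unfolding J_def by (intro tendsto_intros p)
  moreover have "(\<lambda>n. d + 1 / real (Suc n)) \<longlonglongrightarrow> d + 0"
    by (intro tendsto_intros LIMSEQ_Suc[OF lim_1_over_n])
  moreover have "\<exists>N. \<forall>n\<ge>N. J (X n) \<le> d + 1 / real (Suc n)"
    by (intro exI[of _ 0] allI impI less_imp_le X(2))
  ultimately have "J p \<le> d + 0"
    by (rule LIMSEQ_le)
  then have min: "J p \<le> J v" if "v \<in> V" for v
    using d[OF that] by simp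
  have re: "Re (cinner (x - p) v) = 0" if v: "v \<in> V" for v
  proof -
    have "- Re (cinner (x - p) v) = 0"
    proof (rule quadratic_nonneg_imp_zero)
      fix t :: real
      have "J (p + t *\<^sub>R v) = (norm ((x - p) - t *\<^sub>R v))\<^sup>2"
        by (simp add: J_def algebra_simps)
      also have "\<dots> = J p + (norm v)\<^sup>2 * t\<^sup>2 + 2 * (- Re (cinner (x - p) v)) * t"
        unfolding norm_diff_square[of "x - p"] J_def
        by (simp add: Re_cinner_scaleR_right power_mult_distrib mult.commute)
      finally show "0 \<le> (norm v)\<^sup>2 * t\<^sup>2 + 2 * (- Re (cinner (x - p) v)) * t"
        using min[of "p + t *\<^sub>R v"] pV v subspace_add[OF Vr] subspace_scale[OF Vr] by simp
    qed
    then show ?thesis by simp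
  qed
  have "cinner (x - p) v = 0" if v: "v \<in> V" for v
  proof (rule complex_eqI)
    show "Re (cinner (x - p) v) = Re 0" using re[OF v] by simp
    show "Im (cinner (x - p) v) = Im 0"
      using re[of "\<i> *\<^sub>C v"] v complex_vector.subspace_scale[OF V]
      by (simp add: cinner_scaleC_right)
  qed
  then show ?thesis using pV by blast
qed

lemma cinner_zero_left: "cinner 0 y = 0"
  using cinner_scaleC_left[of 0 0 y] by simp

lemma cinner_zero_right: "cinner x 0 = 0"
  using cinner_scaleC_right[of x 0 0] by simp

lemma csubspace_orthogonal_to: "csubspace {x. \<forall>y\<in>S. cinner x y = 0}"
  by (rule complex_vector.subspaceI) (auto simp: cinner_zero_left cinner_add_left cinner_scaleC_left)

lemma bounded_linear_cinner_left: "bounded_linear (\<lambda>x. cinner x y)"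
  by (rule bounded_linear_intro[where K = "norm y"])
    (simp_all add: cinner_add_left scaleR_scaleC cinner_scaleC_left scaleR_conv_of_real cauchy_schwarz)

lemma closed_orthogonal_to: "closed {x. \<forall>y\<in>S. cinner x y = 0}"
proof -
  have "{x. \<forall>y\<in>S. cinner x y = 0} = (\<Inter>y\<in>S. (\<lambda>x. cinner x y) -` {0})" by auto
  then show ?thesis
    by (simp only:) (intro closed_INT ballI closed_vimage closed_singleton
      linear_continuous_on bounded_linear_cinner_left)
qed

lemma pythagoras_le:
  assumes "cinner x y = 0"
  shows "norm x \<le> norm (x - y)" "norm y \<le> norm (x - y)"
proof -
  have "(norm (x - y))\<^sup>2 = (norm x)\<^sup>2 + (norm y)\<^sup>2"
    using assms by (simp add: norm_diff_square)
  then have "(norm x)\<^sup>2 \<le> (norm (x - y))\<^sup>2" "(norm y)\<^sup>2 \<le> (norm (x - y))\<^sup>2" by simp_all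
  then show "norm x \<le> norm (x - y)" "norm y \<le> norm (x - y)"
    using power2_le_imp_le norm_ge_zero by blast+
qed

section \<open>Perturbation of semi-Fredholm operators with nonpositive index\<close>

lemma closed_image_bounded_below:
  fixes f :: "'a::banach \<Rightarrow> 'b::banach"
  assumes f: "bounded_linear f" and V: "subspace V" "closed V"
    and low: "\<And>x. x \<in> V \<Longrightarrow> norm x \<le> C * norm (f x)" and C: "0 < C"
  shows "closed (f ` V)"
proof -
  have "complete (f ` V)"
  proof (rule complete_isometric_image[of "1 / C"])
    show "\<forall>x\<in>V. 1 / C * norm x \<le> norm (f x)"
      using low C by (simp add: field_simps)
    show "complete V" using V(2) by (simp add: complete_eq_closed)
  qed (use C f V(1) in auto)
  then show ?thesis by (rule complete_imp_closed)
qed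

text \<open>Let \<open>M0\<close> be the orthogonal complement of the kernel \<open>N\<close> in \<open>M\<close>, on which \<open>f\<close> is bounded below with
constant \<open>1 / K\<close>. For \<open>\<bar>\<mu>\<bar> < 1 / (2 K)\<close> the map \<open>g = f - \<mu>\<close> is still bounded below on \<open>M0\<close>, so that
\<open>g(M) = g(M0) + g(N)\<close> is closed and the kernel \<open>Z\<close> of \<open>g\<close> embeds into \<open>M/M0\<close>, that is, into \<open>N\<close>.

For the index, the \<open>d = dim N\<close> vectors witnessing the codimension of \<open>f(M)\<close> can be taken orthogonal to
\<open>f(M)\<close>; the span of such vectors meets \<open>g(M0)\<close> only in zero, so \<open>g(M0)\<close> still has codimension at least
\<open>d\<close>. Finally \<open>M = M0 + Z + span D\<close> with \<open>card D = d - dim Z\<close>, so adding the span of \<open>g(D)\<close> to get \<open>g(M)\<close>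
leaves codimension at least \<open>dim Z\<close>.\<close>
lemma semi_Fredholm_perturbation:
  fixes f :: "'a::complex_hilbert \<Rightarrow> 'a"
  assumes f: "bounded_clinear f" and M: "csubspace M" "closed M" and fMM: "f ` M \<subseteq> M"
    and cl: "closed (f ` M)" and fin: "finite_dim {x\<in>M. f x = 0}"
    and ind: "codim_ge M (f ` M) (cdim {x\<in>M. f x = 0})"
  shows "\<exists>e>0. \<forall>\<mu>. cmod \<mu> < e \<longrightarrow>
    closed ((\<lambda>x. f x - \<mu> *\<^sub>C x) ` M) \<and> finite_dim {x\<in>M. f x - \<mu> *\<^sub>C x = 0} \<and>
    codim_ge M ((\<lambda>x. f x - \<mu> *\<^sub>C x) ` M) (cdim {x\<in>M. f x - \<mu> *\<^sub>C x = 0})"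
proof -
  interpret f: bounded_linear f by (rule bounded_clinear_bounded_linear[OF f])
  define N where "N = {x\<in>M. f x = 0}"
  define d where "d = cdim N"
  define M0 where "M0 = M \<inter> {x. \<forall>n\<in>N. cinner x n = 0}"
  have N: "csubspace N" "finite_dim N" "closed N" and NM: "N \<subseteq> M"
    using csubspace_kernel_on[OF f M(1)] fin closed_finite_dim unfolding N_def by auto
  have M0: "csubspace M0" "closed M0" and M0M: "M0 \<subseteq> M"
    unfolding M0_def
    by (intro complex_vector.subspace_inter M csubspace_orthogonal_to)
      (intro closed_Int M closed_orthogonal_to, blast)
  have split: "\<exists>n\<in>N. x - n \<in> M0" if x: "x \<in> M" for x
  proof -
    obtain p where p: "p \<in> N" "\<forall>n\<in>N. cinner (x - p) n = 0"
      using closed_orthogonal_decomposition[OF N(1,3)] by blast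
    then have "x - p \<in> M0"
      unfolding M0_def using x NM complex_vector.subspace_diff[OF M(1)] by blast
    then show ?thesis using p by blast
  qed
  obtain K h where K: "0 < K"
    and h: "\<forall>y\<in>f ` M. h y \<in> M \<and> f (h y) = y \<and> norm (h y) \<le> K * norm y"
    using open_mapping_section[OF f.bounded_linear_axioms csubspace_imp_subspace[OF M(1)] M(2) cl]
    by blast
  have low: "norm x \<le> K * norm (f x)" if x: "x \<in> M0" for x
  proof -
    have fx: "f x \<in> f ` M" using x M0M by blast
    have "x - h (f x) \<in> N"
      unfolding N_def using h fx x M0M complex_vector.subspace_diff[OF M(1)]
      by (auto simp: f.diff)
    then have "cinner x (x - h (f x)) = 0" using x unfolding M0_def by blast
    from pythagoras_le(1)[OF this] have "norm x \<le> norm (h (f x))" by simp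
    also have "\<dots> \<le> K * norm (f x)" using h fx by blast
    finally show ?thesis .
  qed
  have fMs: "csubspace (f ` M)" using csubspace_image[OF f M(1)] .
  obtain G where G: "finite G" "card G = d" "G \<subseteq> M" "indep_mod (f ` M) G"
    using ind unfolding codim_ge_def d_def N_def by blast
  have "\<exists>r. \<forall>g\<in>G. r g \<in> f ` M \<and> (\<forall>v\<in>f ` M. cinner (g - r g) v = 0)"
    using closed_orthogonal_decomposition[OF fMs cl] by (intro bchoice) blast
  then obtain r where r: "\<And>g. g \<in> G \<Longrightarrow> r g \<in> f ` M"
    "\<And>g v. g \<in> G \<Longrightarrow> v \<in> f ` M \<Longrightarrow> cinner (g - r g) v = 0"
    by blast
  define P where "P = {x. \<forall>v\<in>f ` M. cinner x v = 0}"
  define s where "s g = g - r g" for g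
  have sG: "inj_on s G" "indep_mod (f ` M) (s ` G)"
    using indep_mod_representatives[OF fMs G(4), of s] r(1) by (auto simp: s_def)
  have sGM: "s ` G \<subseteq> M"
  proof
    fix y assume "y \<in> s ` G"
    then obtain g where "g \<in> G" "y = g - r g" by (auto simp: s_def)
    then show "y \<in> M"
      using r(1)[of g] G(3) fMM complex_vector.subspace_diff[OF M(1), of g "r g"] by blast
  qed
  have "s ` G \<subseteq> P" using r(2) by (auto simp: P_def s_def)
  then have sGP: "cspan (s ` G) \<subseteq> P"
    unfolding P_def by (rule complex_vector.span_minimal[OF _ csubspace_orthogonal_to])
  show ?thesis
  proof (intro exI[of _ "1 / (2 * K)"] conjI[of "0 < _"] allI impI)
    show "0 < 1 / (2 * K)" using K by simp
    fix \<mu> assume mu: "cmod \<mu> < 1 / (2 * K)"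
    define g where "g x = f x - \<mu> *\<^sub>C x" for x
    have g: "bounded_clinear g"
      unfolding g_def[abs_def] by (rule bounded_clinear_shift[OF f])
    interpret g: bounded_linear g by (rule bounded_clinear_bounded_linear[OF g])
    have muK: "cmod \<mu> * K < 1 / 2" using mu K by (simp add: field_simps)
    have mux: "cmod \<mu> * norm x \<le> norm (f x) / 2" if "x \<in> M0" for x
    proof -
      have "cmod \<mu> * norm x \<le> cmod \<mu> * (K * norm (f x))"
        using low[OF that] by (intro mult_left_mono) auto
      also have "\<dots> = (cmod \<mu> * K) * norm (f x)" by simp
      also have "\<dots> \<le> 1 / 2 * norm (f x)" using muK by (intro mult_right_mono) auto
      finally show ?thesis by simp
    qed
    have glow: "norm x \<le> (2 * K) * norm (g x)" if x: "x \<in> M0" for x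
    proof -
      have "norm (f x) \<le> norm (g x) + cmod \<mu> * norm x"
        using norm_triangle_ineq[of "g x" "\<mu> *\<^sub>C x"] by (simp add: g_def norm_scaleC)
      then have "norm (f x) \<le> 2 * norm (g x)" using mux[OF x] by linarith
      then have "K * norm (f x) \<le> K * (2 * norm (g x))" using K by (intro mult_left_mono) auto
      then show ?thesis using low[OF x] by simp
    qed
    have cgM0: "closed (g ` M0)"
      using closed_image_bounded_below[OF g.bounded_linear_axioms csubspace_imp_subspace[OF M0(1)]
          M0(2) glow] K by simp
    have gM0s: "csubspace (g ` M0)" using csubspace_image[OF g M0(1)] .
    have gNs: "csubspace (g ` N)" using csubspace_image[OF g N(1)] .
    obtain B where B: "finite B" "cspan B = N" "card B = d"
      using finite_dim_obtain_basis[OF N(1,2)] d_def by metis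
    have gNspan: "g ` N = cspan (g ` B)"
      using clinear_span_image[OF bounded_clinear_clinear[OF g], of B] B by simp
    have gM: "g ` M = ssum (g ` M0) (g ` N)"
    proof
      show "g ` M \<subseteq> ssum (g ` M0) (g ` N)"
      proof
        fix y assume "y \<in> g ` M"
        then obtain x where x: "x \<in> M" "y = g x" by blast
        obtain n where n: "n \<in> N" "x - n \<in> M0" using split[OF x(1)] by blast
        have "y = g (x - n) + g n" using x by (simp add: g.diff)
        then show "y \<in> ssum (g ` M0) (g ` N)" unfolding ssum_def using n by blast
      qed
      show "ssum (g ` M0) (g ` N) \<subseteq> g ` M"
      proof
        fix y assume "y \<in> ssum (g ` M0) (g ` N)"
        then obtain a b where "y = g a + g b" "a \<in> M0" "b \<in> N" unfolding ssum_def by blast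
        then show "y \<in> g ` M"
          using M0M NM complex_vector.subspace_add[OF M(1), of a b] g.add[of a b]
          by (metis image_eqI subsetD)
      qed
    qed
    have cgM: "closed (g ` M)"
      unfolding gM gNspan using B(1) by (intro closed_ssum_cspan gM0s cgM0) simp
    define Z where "Z = {x\<in>M. g x = 0}"
    have Zs: "csubspace Z" unfolding Z_def using csubspace_kernel_on[OF g M(1)] .
    have ZM0: "Z \<inter> M0 \<subseteq> {0}"
    proof
      fix x assume "x \<in> Z \<inter> M0"
      then have "norm x \<le> (2 * K) * norm (g x)" "g x = 0" using glow[of x] by (simp_all add: Z_def)
      then show "x \<in> {0}" by simp
    qed
    obtain C where C: "C \<subseteq> Z" "cindependent C" "Z \<subseteq> cspan C" "card C = cdim Z"
      using complex_vector.basis_exists by blast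
    have CZ: "cspan C = Z" using C Zs complex_vector.span_subspace by blast
    have Cind: "indep_mod M0 C" using C(2) CZ ZM0 by (simp add: indep_mod_def)
    have "C \<subseteq> ssum M0 (cspan B)"
    proof
      fix x assume "x \<in> C"
      then have "x \<in> M" using C(1) by (auto simp: Z_def)
      then obtain n where n: "n \<in> N" "x - n \<in> M0" using split by blast
      have "x = (x - n) + n" by simp
      then show "x \<in> ssum M0 (cspan B)"
        unfolding ssum_def B(2) using n by blast
    qed
    then have finC: "finite C" and cardC: "card C \<le> card B"
      using card_le_of_cosets_spanned[OF M0(1) Cind B(1)] by auto
    have finZ: "finite_dim Z" using finC finite_dim_cspan[of C] CZ by simp
    have "\<exists>t. \<forall>x\<in>C. t x \<in> N \<and> x - t x \<in> M0"
      using split C(1) by (intro bchoice) (auto simp: Z_def)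
    then obtain t where t: "\<And>x. x \<in> C \<Longrightarrow> t x \<in> N" "\<And>x. x \<in> C \<Longrightarrow> x - t x \<in> M0"
      by blast
    have tC: "inj_on t C" "indep_mod M0 (t ` C)"
      using indep_mod_representatives[OF M0(1) Cind, of t] t(2) by auto
    have tCi: "cindependent (t ` C)" "t ` C \<subseteq> N"
      using tC(2) t(1) by (auto simp: indep_mod_def)
    have ctC: "card (t ` C) = cdim Z" using card_image[OF tC(1)] C(4) by simp
    from extend_basis_card[OF N(1,2) tCi]
    obtain D where D: "finite (t ` C \<union> D)" "cspan (t ` C \<union> D) = N" "card (t ` C) + card D = d"
      unfolding d_def by metis
    have tCspan: "cspan (t ` C) \<subseteq> ssum M0 Z"
    proof (rule complex_vector.span_minimal[OF _ csubspace_ssum[OF M0(1) Zs]])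
      show "t ` C \<subseteq> ssum M0 Z"
      proof
        fix y assume "y \<in> t ` C"
        then obtain x where x: "x \<in> C" "y = t x" by blast
        have "- (x - t x) \<in> M0" using t(2)[OF x(1)] complex_vector.subspace_neg[OF M0(1)] by blast
        moreover have "y = - (x - t x) + x" using x by simp
        moreover have "x \<in> Z" using x C(1) by blast
        ultimately show "y \<in> ssum M0 Z" unfolding ssum_def by blast
      qed
    qed
    have gsub: "g ` M \<subseteq> ssum (g ` M0) (cspan (g ` D))"
    proof
      fix y assume "y \<in> g ` M"
      then obtain x where x: "x \<in> M" "y = g x" by blast
      obtain n where n: "n \<in> N" "x - n \<in> M0" using split[OF x(1)] by blast
      obtain n1 n2 where n12: "n = n1 + n2" "n1 \<in> cspan (t ` C)" "n2 \<in> cspan D"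
        using n(1) D(2) complex_vector.span_Un by blast
      obtain a z where az: "n1 = a + z" "a \<in> M0" "z \<in> Z"
        using tCspan n12(2) unfolding ssum_def by blast
      have "g z = 0" using az by (simp add: Z_def)
      then have "y = g ((x - n) + a) + g n2"
        using x n12 az by (simp add: g.add g.diff)
      moreover have "(x - n) + a \<in> M0" using n az complex_vector.subspace_add[OF M0(1)] by blast
      moreover have "g n2 \<in> cspan (g ` D)"
        using n12(3) clinear_span_image[OF bounded_clinear_clinear[OF g], of D] by blast
      ultimately show "y \<in> ssum (g ` M0) (cspan (g ` D))" unfolding ssum_def by blast
    qed
    have PgM0: "P \<inter> g ` M0 \<subseteq> {0}"
    proof
      fix z assume "z \<in> P \<inter> g ` M0"
      then obtain x where x: "x \<in> M0" "z = g x" "z \<in> P" by blast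
      have "cinner z (f x) = 0" using x M0M by (auto simp: P_def)
      then have "norm (f x) \<le> norm (z - f x)" by (rule pythagoras_le(2))
      also have "\<dots> = cmod \<mu> * norm x" using x(2) by (simp add: g_def norm_scaleC)
      also have "\<dots> \<le> norm (f x) / 2" using mux[OF x(1)] .
      finally have "norm (f x) \<le> 0" by simp
      then have "norm x \<le> 0" using low[OF x(1)] by simp
      then show "z \<in> {0}" using x(2) g.zero by simp
    qed
    have "indep_mod (g ` M0) (s ` G)"
      using sG(2) sGP PgM0 unfolding indep_mod_def by blast
    moreover have "card (s ` G) = d" using card_image[OF sG(1)] G(2) by simp
    ultimately have "codim_ge M (g ` M0) d"
      unfolding codim_ge_def using sGM G(1) by (intro exI[of _ "s ` G"]) simp
    from codim_ge_ssum[OF gM0s M(1) this, of "g ` D"]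
    have "codim_ge M (ssum (g ` M0) (cspan (g ` D))) (d - card (g ` D))"
      using D(1) by simp
    moreover have "cdim Z \<le> d - card (g ` D)"
      using D(1,3) ctC card_image_le[of D g] by simp
    ultimately have "codim_ge M (g ` M) (cdim Z)"
      using codim_ge_mono codim_ge_antimono gsub by metis
    then show "closed ((\<lambda>x. f x - \<mu> *\<^sub>C x) ` M) \<and> finite_dim {x\<in>M. f x - \<mu> *\<^sub>C x = 0} \<and>
      codim_ge M ((\<lambda>x. f x - \<mu> *\<^sub>C x) ` M) (cdim {x\<in>M. f x - \<mu> *\<^sub>C x = 0})"
      using cgM finZ unfolding Z_def g_def[abs_def] by simp
  qed
qed

text \<open>On the quotient by the range of \<open>f\<^sup>n\<close> the operator is nilpotent, hence \<open>f - \<mu>\<close> is injective there.\<close>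
lemma in_range_funpow_of_shift:
  assumes f: "bounded_clinear f" and mu: "\<mu> \<noteq> 0" and x: "f x - \<mu> *\<^sub>C x \<in> range (f ^^ n)"
  shows "x \<in> range (f ^^ n)"
proof -
  have "x \<in> range (f ^^ k)" if "k \<le> n" for k
    using that
  proof (induction k)
    case (Suc k)
    have s: "csubspace (range (f ^^ Suc k))" by (rule csubspace_range_funpow[OF f])
    have "f x \<in> range (f ^^ Suc k)"
      using Suc unfolding range_funpow_Suc by auto
    moreover have "f x - \<mu> *\<^sub>C x \<in> range (f ^^ Suc k)"
      using x range_funpow_antimono[OF Suc.prems, of f] by blast
    ultimately have "f x - (f x - \<mu> *\<^sub>C x) \<in> range (f ^^ Suc k)"
      by (rule complex_vector.subspace_diff[OF s])
    then have "\<mu> *\<^sub>C x \<in> range (f ^^ Suc k)" by simp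
    then have "inverse \<mu> *\<^sub>C \<mu> *\<^sub>C x \<in> range (f ^^ Suc k)"
      by (rule complex_vector.subspace_scale[OF s])
    then show ?case using mu by (simp add: scaleC_scaleC scaleC_one)
  qed simp
  then show ?thesis by blast
qed

text \<open>On the quotient by the range of \<open>f - \<mu>\<close> the operator \<open>f\<close> acts as the nonzero scalar \<open>\<mu>\<close>.\<close>
lemma in_range_shift_of_funpow:
  assumes f: "bounded_clinear f" and mu: "\<mu> \<noteq> 0"
    and y: "(f ^^ n) y \<in> range (\<lambda>x. f x - \<mu> *\<^sub>C x)"
  shows "y \<in> range (\<lambda>x. f x - \<mu> *\<^sub>C x)"
  using y
proof (induction n)
  case (Suc n)
  let ?R = "range (\<lambda>x. f x - \<mu> *\<^sub>C x)"
  have s: "csubspace ?R" by (intro csubspace_image[OF bounded_clinear_shift[OF f]]) simp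
  let ?z = "(f ^^ n) y"
  have "f ?z \<in> ?R" using Suc.prems by simp
  from complex_vector.subspace_diff[OF s this rangeI[of _ ?z]]
  have "f ?z - (f ?z - \<mu> *\<^sub>C ?z) \<in> ?R" .
  then have "\<mu> *\<^sub>C ?z \<in> ?R" by simp
  then have "inverse \<mu> *\<^sub>C \<mu> *\<^sub>C ?z \<in> ?R" by (rule complex_vector.subspace_scale[OF s])
  then have "?z \<in> ?R" using mu by (simp add: scaleC_scaleC scaleC_one)
  then show ?case by (rule Suc.IH)
qed simp

text \<open>For \<open>\<mu> \<noteq> 0\<close> the kernel and the cokernel of \<open>f - \<mu>\<close> on the whole space are those of its restriction
to the range of \<open>f\<^sup>n\<close>, to which the perturbation lemma applies.\<close>
lemma semi_B_Fredholm_punctured_neighbourhood: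
  fixes f :: "'a::complex_hilbert \<Rightarrow> 'a"
  assumes f: "bounded_clinear f" and cl: "closed (range (f ^^ n))" "closed (range (f ^^ Suc n))"
    and fin: "finite_dim {x\<in>range (f ^^ n). f x = 0}"
    and ind: "codim_ge (range (f ^^ n)) (range (f ^^ Suc n)) (cdim {x\<in>range (f ^^ n). f x = 0})"
  shows "\<exists>e>0. \<forall>\<mu>. \<mu> \<noteq> 0 \<and> cmod \<mu> < e \<longrightarrow>
    closed (range (\<lambda>x. f x - \<mu> *\<^sub>C x)) \<and> finite_dim {x. f x - \<mu> *\<^sub>C x = 0} \<and>
    codim_ge UNIV (range (\<lambda>x. f x - \<mu> *\<^sub>C x)) (cdim {x. f x - \<mu> *\<^sub>C x = 0})"
proof -
  let ?M = "range (f ^^ n)"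
  have M: "csubspace ?M" by (rule csubspace_range_funpow[OF f])
  have fM: "f ` ?M \<subseteq> ?M"
    using range_funpow_antimono[of n "Suc n" f] unfolding range_funpow_Suc by simp
  obtain e where e: "e > 0" and E: "\<And>\<mu>. cmod \<mu> < e \<Longrightarrow>
    closed ((\<lambda>x. f x - \<mu> *\<^sub>C x) ` ?M) \<and> finite_dim {x\<in>?M. f x - \<mu> *\<^sub>C x = 0} \<and>
    codim_ge ?M ((\<lambda>x. f x - \<mu> *\<^sub>C x) ` ?M) (cdim {x\<in>?M. f x - \<mu> *\<^sub>C x = 0})"
    using semi_Fredholm_perturbation[OF f M cl(1) fM _ fin] cl(2) ind
    unfolding range_funpow_Suc by blast
  show ?thesis
  proof (intro exI[of _ e] conjI[of "0 < e"] allI impI e)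
    fix \<mu> assume mu: "\<mu> \<noteq> 0 \<and> cmod \<mu> < e"
    define g where "g x = f x - \<mu> *\<^sub>C x" for x
    have g: "bounded_clinear g"
      unfolding g_def[abs_def] by (rule bounded_clinear_shift[OF f])
    interpret g: bounded_linear g by (rule bounded_clinear_bounded_linear[OF g])
    interpret fn: bounded_linear "f ^^ n"
      by (rule bounded_clinear_bounded_linear[OF bounded_clinear_funpow[OF f]])
    have E: "closed (g ` ?M)" "finite_dim {x\<in>?M. g x = 0}"
      "codim_ge ?M (g ` ?M) (cdim {x\<in>?M. g x = 0})"
      using E mu unfolding g_def[abs_def] by auto
    have inM: "x \<in> ?M" if "g x \<in> ?M" for x
      using in_range_funpow_of_shift[OF f, of \<mu> x n] mu that by (simp add: g_def)
    have ker: "{x\<in>?M. g x = 0} = {x. g x = 0}"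
      using inM complex_vector.subspace_0[OF M] by auto
    have comm: "(f ^^ n) (g x) = g ((f ^^ n) x)" for x
    proof -
      have "(f ^^ n) (\<mu> *\<^sub>C x) = \<mu> *\<^sub>C (f ^^ n) x"
        using bounded_clinear_funpow[OF f, of n] by (simp add: bounded_clinear_def)
      then show ?thesis by (simp add: g_def fn.diff funpow_swap1)
    qed
    have fin_ker: "finite_dim {x. g x = 0}" using E(2) unfolding ker .
    have "closed (range g)"
      unfolding closed_sequential_limits
    proof (intro allI impI)
      fix y l assume "(\<forall>n. y n \<in> range g) \<and> y \<longlonglongrightarrow> l"
      then have "\<forall>k. \<exists>x. y k = g x" and l: "y \<longlonglongrightarrow> l" by auto
      have lim: "(\<lambda>k. (f ^^ n) (y k)) \<longlonglongrightarrow> (f ^^ n) l"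
        by (rule fn.tendsto[OF l])
      have "(f ^^ n) (y k) \<in> g ` ?M" for k
        using \<open>\<forall>k. \<exists>x. y k = g x\<close> comm by (metis imageI rangeI)
      from closed_sequentially[OF E(1) this lim]
      have "(f ^^ n) l \<in> range (\<lambda>x. f x - \<mu> *\<^sub>C x)" by (auto simp: g_def)
      from in_range_shift_of_funpow[OF f _ this]
      show "l \<in> range g" using mu by (simp add: g_def[abs_def])
    qed
    moreover have "codim_ge UNIV (range g) (cdim {x. g x = 0})"
    proof -
      obtain G where G: "finite G" "card G = cdim {x. g x = 0}" "G \<subseteq> ?M" "indep_mod (g ` ?M) G"
        using E(3) unfolding codim_ge_def ker by blast
      have "cspan G \<subseteq> ?M" by (rule complex_vector.span_minimal[OF G(3) M])
      then have "cspan G \<inter> range g \<subseteq> cspan G \<inter> g ` ?M" using inM by blast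
      then have "indep_mod (range g) G" using G(4) unfolding indep_mod_def by blast
      then show ?thesis unfolding codim_ge_def using G(1,2) by blast
    qed
    ultimately show "closed (range (\<lambda>x. f x - \<mu> *\<^sub>C x)) \<and> finite_dim {x. f x - \<mu> *\<^sub>C x = 0} \<and>
      codim_ge UNIV (range (\<lambda>x. f x - \<mu> *\<^sub>C x)) (cdim {x. f x - \<mu> *\<^sub>C x = 0})"
      using fin_ker unfolding g_def[abs_def] by simp
  qed
qed

section \<open>Spectra described by kernels and ranges of powers\<close>

definition kernel_in_range :: "'z::complex_banach bop \<Rightarrow> nat \<Rightarrow> 'z set" where
  "kernel_in_range T n = {x\<in>range_pow T n. bop_apply T x = 0}"

text \<open>Left Drazin invertibility with the exponent made explicit. The last condition says that the
ascent is at most \<open>n\<close>.\<close>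
definition left_Drazin_at :: "'z::complex_banach bop \<Rightarrow> nat \<Rightarrow> bool" where
  "left_Drazin_at T n \<longleftrightarrow> closed (range_pow T n) \<and> closed (range_pow T (Suc n)) \<and>
     kernel_in_range T n = {0}"

text \<open>The restriction to the range of the \<open>n\<close>-th power is upper semi-Fredholm with nonpositive index
(\<open>semi_Weyl_at_iff\<close>); the last conjunct is \<open>\<alpha> \<le> \<beta>\<close>.\<close>
definition semi_Weyl_at :: "'z::complex_banach bop \<Rightarrow> nat \<Rightarrow> bool" where
  "semi_Weyl_at T n \<longleftrightarrow> closed (range_pow T n) \<and> closed (range_pow T (Suc n)) \<and>
     finite_dim (kernel_in_range T n) \<and>
     codim_ge (range_pow T n) (range_pow T (Suc n)) (cdim (kernel_in_range T n))"

definition sigma_LD :: "'z::complex_banach bop \<Rightarrow> complex set" where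
  "sigma_LD T = {\<mu>. \<nexists>n. left_Drazin_at (shift T \<mu>) n}"

lemma range_pow_Suc: "range_pow T (Suc n) = bop_apply T ` range_pow T n"
  unfolding range_pow_def by (rule range_funpow_Suc)

lemma range_pow_0: "range_pow T 0 = UNIV"
  by (simp add: range_pow_def)

lemma range_pow_1: "range_pow T (Suc 0) = range (bop_apply T)"
  by (simp add: range_pow_def)

lemma csubspace_range_pow: "csubspace (range_pow T n)"
  unfolding range_pow_def by (rule csubspace_range_funpow[OF bounded_clinear_bop_apply])

lemma range_pow_antimono: "n \<le> m \<Longrightarrow> range_pow T m \<subseteq> range_pow T n"
  unfolding range_pow_def by (rule range_funpow_antimono)

lemma csubspace_kernel_in_range: "csubspace (kernel_in_range T n)"
  unfolding kernel_in_range_def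
  by (rule csubspace_kernel_on[OF bounded_clinear_bop_apply csubspace_range_pow])

lemma kernel_in_range_antimono: "n \<le> m \<Longrightarrow> kernel_in_range T m \<subseteq> kernel_in_range T n"
  using range_pow_antimono[of n m T] unfolding kernel_in_range_def by blast

lemma zero_in_kernel_in_range: "0 \<in> kernel_in_range T n"
  by (rule complex_vector.subspace_0[OF csubspace_kernel_in_range])

lemma shift_apply: "bop_apply (shift T \<mu>) x = bop_apply T x - \<mu> *\<^sub>C x"
  by (simp add: shift_def minus_bop.rep_eq scaleC_bop.rep_eq bop_id.rep_eq)

lemma edim_less_infinity_iff: "edim V < \<infinity> \<longleftrightarrow> finite_dim V"
  by (simp add: edim_def)

lemma finite_dim_zero: "finite_dim {0}"
  unfolding finite_dim_def by (rule exI[of _ "{}"]) simp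

lemma cdim_zero: "cdim {0} = 0"
  using complex_vector.dim_span[of "{}"] complex_vector.dim_le_card[of "{0}" "{}"] by simp

lemma edim_pos_iff:
  assumes "csubspace V"
  shows "0 < edim V \<longleftrightarrow> V \<noteq> {0}"
proof
  assume "0 < edim V"
  then show "V \<noteq> {0}" by (auto simp: edim_def finite_dim_zero cdim_zero zero_enat_def)
next
  assume V: "V \<noteq> {0}"
  show "0 < edim V"
  proof (cases "finite_dim V")
    case True
    obtain B where B: "finite B" "cspan B = V" "card B = cdim V"
      using finite_dim_obtain_basis[OF assms True] by metis
    have "B \<noteq> {}" using B(2) V by auto
    then show ?thesis using B True by (simp add: edim_def zero_enat_def card_gt_0_iff flip: B(3))
  qed (simp add: edim_def)
qed

lemma upper_semi_B_Fredholm_at_iff: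
  "upper_semi_B_Fredholm_at T n \<longleftrightarrow>
    closed (range_pow T n) \<and> closed (range_pow T (Suc n)) \<and> finite_dim (kernel_in_range T n)"
  unfolding upper_semi_B_Fredholm_at_def upper_semi_Fredholm_on_def alpha_on_def
    edim_less_infinity_iff range_pow_Suc kernel_in_range_def by blast

lemma index_range_pow_nonpos_iff:
  assumes "finite_dim (kernel_in_range T n)"
  shows "\<not> 0 < index_on (range_pow T n) (bop_apply T) \<longleftrightarrow>
    codim_ge (range_pow T n) (range_pow T (Suc n)) (cdim (kernel_in_range T n))"
  using index_nonpos_iff[OF bounded_clinear_clinear[OF bounded_clinear_bop_apply] csubspace_range_pow[of T n], of T]
    assms unfolding kernel_in_range_def range_pow_Suc by simp

lemma index_range_pow_independent:
  assumes fin: "finite_dim (kernel_in_range T n)" and nm: "n \<le> m"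
  shows "codim_ge (range_pow T n) (range_pow T (Suc n)) (cdim (kernel_in_range T n)) \<longleftrightarrow>
    codim_ge (range_pow T m) (range_pow T (Suc m)) (cdim (kernel_in_range T m))"
  using nm
proof (induction m rule: dec_induct)
  case (step m)
  have sub: "bop_apply T ` range_pow T m \<subseteq> range_pow T m"
    using range_pow_antimono[of m "Suc m" T] by (simp add: range_pow_Suc)
  have "finite_dim {x\<in>range_pow T m. bop_apply T x = 0}"
    using finite_dim_subset[OF fin kernel_in_range_antimono[OF step.hyps(1)]]
    unfolding kernel_in_range_def .
  from index_step[OF bounded_clinear_clinear[OF bounded_clinear_bop_apply] csubspace_range_pow sub this]
  show ?case
    using step.IH unfolding kernel_in_range_def range_pow_Suc by simp
qed simp

lemma semi_Weyl_at_iff: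
  "semi_Weyl_at T n \<longleftrightarrow>
    upper_semi_B_Fredholm_at T n \<and> \<not> 0 < index_on (range_pow T n) (bop_apply T)"
  using index_range_pow_nonpos_iff[of T n]
  unfolding semi_Weyl_at_def upper_semi_B_Fredholm_at_iff by blast

text \<open>Both exponents are compared with the larger one by restricting step by step to the ranges.\<close>
lemma semi_Weyl_at_transfer:
  assumes n: "semi_Weyl_at T n" and m: "upper_semi_B_Fredholm_at T m"
  shows "semi_Weyl_at T m"
proof -
  have "finite_dim (kernel_in_range T n)" "finite_dim (kernel_in_range T m)"
    using n m unfolding semi_Weyl_at_def upper_semi_B_Fredholm_at_iff by auto
  then show ?thesis
    using index_range_pow_independent[of T n "max n m"] index_range_pow_independent[of T m "max n m"] n m
    unfolding semi_Weyl_at_def upper_semi_B_Fredholm_at_iff by simp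
qed

text \<open>The exponent picked by choice in the definition of the index gives the same sign as any other one.\<close>
lemma notin_sigma_SBF_iff: "\<mu> \<notin> sigma_SBF T \<longleftrightarrow> (\<exists>n. semi_Weyl_at (shift T \<mu>) n)"
proof -
  let ?C = "shift T \<mu>"
  let ?s = "SOME n. upper_semi_B_Fredholm_at ?C n"
  have s: "upper_semi_B_Fredholm_at ?C ?s" if "upper_semi_B_Fredholm ?C"
    using that unfolding upper_semi_B_Fredholm_def by (rule someI_ex)
  show ?thesis
  proof
    assume "\<mu> \<notin> sigma_SBF T"
    then have "semi_Weyl_at ?C ?s"
      using s unfolding sigma_SBF_def B_Fredholm_index_def semi_Weyl_at_iff by auto
    then show "\<exists>n. semi_Weyl_at ?C n" by blast
  next
    assume "\<exists>n. semi_Weyl_at ?C n"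
    then obtain n where n: "semi_Weyl_at ?C n" by blast
    then have F: "upper_semi_B_Fredholm ?C"
      unfolding upper_semi_B_Fredholm_def semi_Weyl_at_iff by blast
    have "semi_Weyl_at ?C ?s" using semi_Weyl_at_transfer[OF n s[OF F]] .
    then show "\<mu> \<notin> sigma_SBF T"
      using F unfolding sigma_SBF_def B_Fredholm_index_def semi_Weyl_at_iff by simp
  qed
qed

lemma left_Drazin_at_imp_semi_Weyl_at: "left_Drazin_at T n \<Longrightarrow> semi_Weyl_at T n"
  unfolding left_Drazin_at_def semi_Weyl_at_def
  by (simp add: finite_dim_zero cdim_zero codim_ge_0)

lemma bounded_below_iff_left_Drazin_at: "bounded_below T \<longleftrightarrow> left_Drazin_at T 0"
  by (auto simp: bounded_below_def left_Drazin_at_def range_pow_0 range_pow_1 kernel_in_range_def)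

lemma notin_sigma_a_iff: "\<mu> \<notin> sigma_a T \<longleftrightarrow> left_Drazin_at (shift T \<mu>) 0"
  by (simp add: sigma_a_def bounded_below_iff_left_Drazin_at)

lemma sigma_aw_iff: "\<mu> \<in> sigma_aw T \<longleftrightarrow> \<mu> \<in> sigma_a T \<and> \<not> semi_Weyl_at (shift T \<mu>) 0"
  unfolding sigma_aw_def semi_Weyl_at_iff upper_semi_B_Fredholm_at_def upper_semi_Fredholm_def
    fredholm_index_def range_pow_0 by simp

lemma sigma_SBF_subset_sigma_LD: "sigma_SBF T \<subseteq> sigma_LD T"
proof
  fix \<mu> assume "\<mu> \<in> sigma_SBF T"
  then have "\<not> semi_Weyl_at (shift T \<mu>) n" for n using notin_sigma_SBF_iff by blast
  then show "\<mu> \<in> sigma_LD T"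
    unfolding sigma_LD_def using left_Drazin_at_imp_semi_Weyl_at by blast
qed

lemma injective_of_notin_sigma_a:
  assumes "\<mu> \<notin> sigma_a T" "bop_apply T x = \<mu> *\<^sub>C x"
  shows "x = 0"
proof -
  have "x \<in> kernel_in_range (shift T \<mu>) 0"
    using assms(2) by (simp add: kernel_in_range_def range_pow_0 shift_apply)
  then show ?thesis
    using assms(1) unfolding notin_sigma_a_iff left_Drazin_at_def by blast
qed

text \<open>The mechanism that turns a Fredholm property into finite ascent: see
\<open>kernel_meets_range_funpow_trivially\<close>.\<close>
lemma left_Drazin_of_nearby_injective:
  assumes W: "semi_Weyl_at (shift T \<mu>) n"
    and near: "\<And>e. 0 < e \<Longrightarrow> \<exists>\<nu>. dist \<mu> \<nu> < e \<and> \<nu> \<notin> sigma_a T"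
  shows "\<exists>m\<ge>n. left_Drazin_at (shift T \<mu>) m"
proof -
  let ?f = "bop_apply (shift T \<mu>)"
  have f: "bounded_clinear ?f" by (rule bounded_clinear_bop_apply)
  have W': "closed (range (?f ^^ n))" "closed (range (?f ^^ Suc n))"
    "finite_dim {x\<in>range (?f ^^ n). ?f x = 0}"
    using W unfolding semi_Weyl_at_def kernel_in_range_def range_pow_def by auto
  have "\<exists>\<nu>. cmod \<nu> < e \<and> (\<forall>x. ?f x = \<nu> *\<^sub>C x \<longrightarrow> x = 0)" if e: "0 < e" for e
  proof -
    obtain \<nu> where nu: "dist \<mu> \<nu> < e" "\<nu> \<notin> sigma_a T" using near[OF e] by blast
    have "x = 0" if "?f x = (\<nu> - \<mu>) *\<^sub>C x" for x
      using that by (intro injective_of_notin_sigma_a[OF nu(2)])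
        (simp add: shift_apply complex_vector.scale_left_diff_distrib)
    then show ?thesis using nu(1)
      by (intro exI[of _ "\<nu> - \<mu>"]) (auto simp: dist_norm norm_minus_commute)
  qed
  from kernel_meets_range_funpow_trivially[OF f W' this]
  obtain m where m: "n \<le> m" "{x\<in>range (?f ^^ m). ?f x = 0} = {0}" by blast
  then show ?thesis
    using closed_range_funpow[OF f W' m(1)] closed_range_funpow[OF f W', of "Suc m"]
    unfolding left_Drazin_at_def kernel_in_range_def range_pow_def by auto
qed

lemma points_off_sigma_a_near_isolated:
  assumes "\<mu> isolated_in sigma_a T" "0 < e"
  shows "\<exists>\<nu>. dist \<mu> \<nu> < e \<and> \<nu> \<notin> sigma_a T"
proof -
  obtain d where d: "d > 0" "\<And>\<nu>. \<nu> \<in> sigma_a T \<Longrightarrow> dist \<mu> \<nu> < d \<Longrightarrow> \<nu> = \<mu>"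
    using assms(1) unfolding isolated_in_dist_Ex_iff by blast
  define \<nu> where "\<nu> = \<mu> + complex_of_real (min d e / 2)"
  have "dist \<mu> \<nu> = min d e / 2" using d assms(2) by (simp add: \<nu>_def dist_norm)
  then have "dist \<mu> \<nu> < e" "dist \<mu> \<nu> < d" "\<nu> \<noteq> \<mu>" using d assms(2) by auto
  then show ?thesis using d(2) by blast
qed

lemma ascent_of_left_Drazin_at:
  assumes "left_Drazin_at T n"
  shows "\<exists>a. ascent T = enat a"
proof -
  let ?f = "bop_apply T"
  interpret bounded_linear ?f by (rule bounded_linear_bop_apply)
  have "null_pow T n = null_pow T (Suc n)"
  proof
    show "null_pow T n \<subseteq> null_pow T (Suc n)" by (auto simp: null_pow_def zero)
    show "null_pow T (Suc n) \<subseteq> null_pow T n"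
    proof
      fix x assume "x \<in> null_pow T (Suc n)"
      then have "(?f ^^ n) x \<in> kernel_in_range T n"
        by (simp add: null_pow_def kernel_in_range_def range_pow_def)
      then show "x \<in> null_pow T n"
        using assms by (simp add: left_Drazin_at_def null_pow_def)
    qed
  qed
  then have "ascent T \<le> enat n" unfolding ascent_def by (intro INF_lower) simp
  then show ?thesis using enat_ile by blast
qed

lemma kernel_in_range_of_ascent:
  assumes "ascent T = enat a"
  shows "kernel_in_range T a = {0}"
proof -
  let ?S = "{n. null_pow T n = null_pow T (Suc n)}"
  have "?S \<noteq> {}"
  proof
    assume "?S = {}"
    then have "ascent T = \<infinity>" unfolding ascent_def by (simp only:) (simp add: top_enat_def)
    then show False using assms by simp
  qed
  then obtain n where n: "n \<in> ?S" by blast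
  have "(LEAST x. x \<in> enat ` ?S) \<in> enat ` ?S"
    by (rule LeastI[of _ "enat n"]) (use n in blast)
  then have "ascent T \<in> enat ` ?S"
    unfolding ascent_def Inf_enat_def using n by auto
  then have "null_pow T a = null_pow T (Suc a)" using assms by auto
  then have "x = 0" if "x \<in> kernel_in_range T a" for x
    using that unfolding kernel_in_range_def range_pow_def null_pow_def
    by (auto simp: set_eq_iff)
  then show ?thesis using zero_in_kernel_in_range[of T a] by blast
qed

lemma alpha_finite_iff: "alpha T < \<infinity> \<longleftrightarrow> finite_dim (kernel_in_range T 0)"
  unfolding alpha_def alpha_on_def edim_less_infinity_iff kernel_in_range_def range_pow_0 by simp

lemma alpha_pos_iff: "0 < alpha T \<longleftrightarrow> kernel_in_range T 0 \<noteq> {0}"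
  using edim_pos_iff[OF csubspace_kernel_in_range[of T 0]]
  by (simp add: alpha_def alpha_on_def kernel_in_range_def range_pow_0)

text \<open>With ascent \<open>a\<close> the power \<open>T\<^bsup>a+1\<^esup>\<close> has closed range and finite dimensional kernel, which forces the
range of \<open>T\<close> to be closed. On the range of \<open>T\<^sup>a\<close> the kernel vanishes, so the index is nonpositive
there, and hence also on the whole space.\<close>
lemma semi_Weyl_at_of_ascent:
  assumes asc: "ascent T = enat a" and cl: "closed (range_pow T (a + 1))" and al: "alpha T < \<infinity>"
  shows "semi_Weyl_at T 0"
proof -
  let ?f = "bop_apply T"
  have f: "bounded_clinear ?f" by (rule bounded_clinear_bop_apply)
  have fin: "finite_dim (kernel_in_range T 0)" using al alpha_finite_iff by blast
  have "finite_dim {x. (?f ^^ Suc a) x = 0}"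
    using finite_dim_kernel_funpow[OF f, of "Suc a"] fin
    by (simp add: kernel_in_range_def range_pow_0 del: funpow.simps)
  moreover have "(?f ^^ a) (?f x) = (?f ^^ Suc a) x" for x
    by (simp add: funpow_swap1)
  moreover have "range ((?f ^^ a) \<circ> ?f) = range_pow T (a + 1)"
    unfolding range_pow_def by (simp add: o_def funpow_swap1)
  ultimately have "closed (range ?f)"
    using closed_range_of_comp[OF f bounded_clinear_funpow[OF f, of a]] cl by simp
  moreover have "codim_ge (range_pow T a) (range_pow T (Suc a)) (cdim (kernel_in_range T a))"
    unfolding kernel_in_range_of_ascent[OF asc] cdim_zero
    by (rule codim_ge_0)
  then have "codim_ge (range_pow T 0) (range_pow T (Suc 0)) (cdim (kernel_in_range T 0))"
    using index_range_pow_independent[OF fin, of a] by simp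
  ultimately show ?thesis
    unfolding semi_Weyl_at_def using fin by (simp add: range_pow_1 range_pow_0)
qed

lemma Pi_a0_imp_semi_Weyl: "\<mu> \<in> Pi_a0 T \<Longrightarrow> semi_Weyl_at (shift T \<mu>) 0"
  unfolding Pi_a0_def Pi_a_def using semi_Weyl_at_of_ascent by blast

text \<open>Near an isolated point of the approximate point spectrum the operator is injective, so the ascent
is finite; closed ranges of the powers come from the semi-Fredholm property.\<close>
lemma isolated_semi_Weyl_imp_Pi_a0:
  assumes iso: "\<mu> isolated_in sigma_a T" and W: "semi_Weyl_at (shift T \<mu>) 0"
  shows "\<mu> \<in> Pi_a0 T"
proof -
  let ?f = "bop_apply (shift T \<mu>)"
  have "\<exists>m\<ge>0. left_Drazin_at (shift T \<mu>) m"
    by (rule left_Drazin_of_nearby_injective[OF W points_off_sigma_a_near_isolated[OF iso]])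
  then obtain a where a: "ascent (shift T \<mu>) = enat a"
    using ascent_of_left_Drazin_at by blast
  have "closed (range (?f ^^ (a + 1)))"
    by (rule closed_range_funpow[OF bounded_clinear_bop_apply, of 0])
      (use W in \<open>auto simp: semi_Weyl_at_def kernel_in_range_def range_pow_def\<close>)
  moreover have "alpha (shift T \<mu>) < \<infinity>"
    using W unfolding alpha_finite_iff semi_Weyl_at_def by blast
  ultimately show ?thesis
    unfolding Pi_a0_def Pi_a_def range_pow_def using a iso by blast
qed

text \<open>A point of \<open>\<sigma>\<^sub>a\<close> where the operator is upper semi-Fredholm with nonpositive index lies outside
\<open>\<sigma>\<^sub>S\<^sub>B\<^sub>F\<close>, hence in \<open>E\<^sup>a\<close>, and so it is isolated in \<open>\<sigma>\<^sub>a\<close>.\<close>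
lemma generalized_a_Weyl_imp_a_Browder:
  assumes "generalized_a_Weyl T"
  shows "a_Browder T"
proof -
  have "\<mu> \<in> Pi_a0 T" if W: "semi_Weyl_at (shift T \<mu>) 0" and s: "\<mu> \<in> sigma_a T" for \<mu>
  proof (rule isolated_semi_Weyl_imp_Pi_a0[OF _ W])
    have "\<mu> \<notin> sigma_SBF T" using W notin_sigma_SBF_iff by blast
    then have "\<mu> \<in> E_a T" using assms s unfolding generalized_a_Weyl_def by blast
    then show "\<mu> isolated_in sigma_a T" by (simp add: E_a_def)
  qed
  moreover have "\<mu> \<in> sigma_a T" if "\<mu> \<in> sigma_aw T" for \<mu>
    using that by (simp add: sigma_aw_def)
  ultimately show ?thesis
    using Pi_a0_imp_semi_Weyl[of _ T] unfolding a_Browder_def set_eq_iff Diff_iff sigma_aw_iff by blast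
qed

lemma semi_Weyl_at_shift_near:
  fixes T :: "'z::complex_hilbert bop"
  assumes "semi_Weyl_at (shift T \<mu>) n"
  shows "\<exists>e>0. \<forall>\<nu>. \<nu> \<noteq> \<mu> \<and> dist \<mu> \<nu> < e \<longrightarrow> semi_Weyl_at (shift T \<nu>) 0"
proof -
  let ?f = "bop_apply (shift T \<mu>)"
  have W': "closed (range (?f ^^ n))" "closed (range (?f ^^ Suc n))"
    "finite_dim {x\<in>range (?f ^^ n). ?f x = 0}"
    "codim_ge (range (?f ^^ n)) (range (?f ^^ Suc n)) (cdim {x\<in>range (?f ^^ n). ?f x = 0})"
    using assms unfolding semi_Weyl_at_def kernel_in_range_def range_pow_def by auto
  obtain e where e: "e > 0" "\<And>\<nu>. \<nu> \<noteq> 0 \<and> cmod \<nu> < e \<Longrightarrow>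
    closed (range (\<lambda>x. ?f x - \<nu> *\<^sub>C x)) \<and> finite_dim {x. ?f x - \<nu> *\<^sub>C x = 0} \<and>
    codim_ge UNIV (range (\<lambda>x. ?f x - \<nu> *\<^sub>C x)) (cdim {x. ?f x - \<nu> *\<^sub>C x = 0})"
    using semi_B_Fredholm_punctured_neighbourhood[OF bounded_clinear_bop_apply W'] by blast
  have "semi_Weyl_at (shift T \<nu>) 0" if nu: "\<nu> \<noteq> \<mu>" "dist \<mu> \<nu> < e" for \<nu>
  proof -
    have eq: "(\<lambda>x. ?f x - (\<nu> - \<mu>) *\<^sub>C x) = bop_apply (shift T \<nu>)"
      by (simp add: fun_eq_iff shift_apply complex_vector.scale_left_diff_distrib)
    have "\<nu> - \<mu> \<noteq> 0 \<and> cmod (\<nu> - \<mu>) < e"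
      using nu by (auto simp: dist_norm norm_minus_commute)
    from e(2)[OF this] show ?thesis
      unfolding semi_Weyl_at_def kernel_in_range_def range_pow_0 range_pow_1
      using fun_cong[OF eq] by (simp add: eq)
  qed
  then show ?thesis using e(1) by blast
qed

text \<open>If \<open>T - \<mu>\<close> is upper semi B-Fredholm with nonpositive index, then all \<open>\<nu> \<noteq> \<mu>\<close> near \<open>\<mu>\<close> avoid
\<open>\<sigma>\<^sub>a\<^sub>w\<close>. By a-Browder's theorem each of them is outside \<open>\<sigma>\<^sub>a\<close> or isolated in it, so there are points
outside \<open>\<sigma>\<^sub>a\<close> arbitrarily close to \<open>\<mu>\<close>.\<close>
lemma a_Browder_imp_sigma_SBF_eq_sigma_LD:
  fixes T :: "'z::complex_hilbert bop"
  assumes "a_Browder T"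
  shows "sigma_SBF T = sigma_LD T"
proof (intro equalityI sigma_SBF_subset_sigma_LD subsetI)
  fix \<mu> assume mu: "\<mu> \<in> sigma_LD T"
  show "\<mu> \<in> sigma_SBF T"
  proof (rule ccontr)
    assume "\<mu> \<notin> sigma_SBF T"
    then obtain n where n: "semi_Weyl_at (shift T \<mu>) n" using notin_sigma_SBF_iff by blast
    obtain d where d: "d > 0" "\<And>\<nu>. \<nu> \<noteq> \<mu> \<Longrightarrow> dist \<mu> \<nu> < d \<Longrightarrow> semi_Weyl_at (shift T \<nu>) 0"
      using semi_Weyl_at_shift_near[OF n] by blast
    have "\<exists>\<nu>. dist \<mu> \<nu> < e \<and> \<nu> \<notin> sigma_a T" if e: "0 < e" for e
    proof -
      define \<nu> where "\<nu> = \<mu> + complex_of_real (min d e / 2)"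
      have dn: "dist \<mu> \<nu> = min d e / 2" using d e by (simp add: \<nu>_def dist_norm)
      then have "\<nu> \<noteq> \<mu>" using d e by auto
      then have W: "semi_Weyl_at (shift T \<nu>) 0" using d dn e by (intro d(2)) auto
      show ?thesis
      proof (cases "\<nu> \<in> sigma_a T")
        case True
        then have "\<nu> \<in> Pi_a0 T"
          using W assms sigma_aw_iff unfolding a_Browder_def by blast
        then have "\<nu> isolated_in sigma_a T" by (simp add: Pi_a0_def Pi_a_def)
        then obtain \<xi> where "dist \<nu> \<xi> < e / 2" "\<xi> \<notin> sigma_a T"
          using points_off_sigma_a_near_isolated e half_gt_zero by blast
        moreover have "dist \<mu> \<nu> \<le> e / 2" using dn by simp
        ultimately show ?thesis using dist_triangle[of \<mu> \<xi> \<nu>] by (intro exI[of _ \<xi>]) auto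
      next
        case False
        then show ?thesis using dn d e by (intro exI[of _ \<nu>]) auto
      qed
    qed
    from left_Drazin_of_nearby_injective[OF n this] show False
      using mu unfolding sigma_LD_def by blast
  qed
qed

section \<open>Right multiplication and the adjoint\<close>

text \<open>Douglas factorization in the case of closed range. The preimages orthogonal to the kernel of \<open>g\<close> are unique and
therefore depend linearly on the point; the open mapping theorem bounds them.\<close>
lemma bounded_linear_lift_through_closed_range:
  fixes g h :: "'a::complex_hilbert \<Rightarrow> 'a"
  assumes g: "bounded_clinear g" and h: "bounded_clinear h" and cl: "closed (range g)"
    and sub: "range h \<subseteq> range g"
  shows "\<exists>s. bounded_clinear s \<and> (\<forall>x. g (s x) = h x)"
proof -
  interpret g: bounded_linear g by (rule bounded_clinear_bounded_linear[OF g])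
  interpret h: bounded_linear h by (rule bounded_clinear_bounded_linear[OF h])
  have gs: "g (a *\<^sub>C x) = a *\<^sub>C g x" and hs: "h (a *\<^sub>C x) = a *\<^sub>C h x" for a x
    using g h by (auto simp: bounded_clinear_def)
  define N where "N = {x. g x = 0}"
  define P where "P = {x. \<forall>n\<in>N. cinner x n = 0}"
  have N: "csubspace N" using csubspace_kernel_on[OF g, of UNIV] by (simp add: N_def)
  have P: "csubspace P" unfolding P_def by (rule csubspace_orthogonal_to)
  have "N = g -` {0}" by (auto simp: N_def)
  then have cN: "closed N"
    by (simp add: closed_vimage g.continuous_on linear_continuous_on g.bounded_linear_axioms)
  obtain K k where k: "\<forall>y\<in>range g. k y \<in> UNIV \<and> g (k y) = y \<and> norm (k y) \<le> K * norm y"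
    using open_mapping_section[OF g.bounded_linear_axioms subspace_UNIV closed_UNIV cl] by blast
  have "\<exists>s. s \<in> P \<and> g s = h x \<and> norm s \<le> K * norm (h x)" for x
  proof -
    have hx: "h x \<in> range g" using sub by blast
    obtain p where p: "p \<in> N" "\<forall>n\<in>N. cinner (k (h x) - p) n = 0"
      using closed_orthogonal_decomposition[OF N cN] by blast
    have khx: "g (k (h x)) = h x" "norm (k (h x)) \<le> K * norm (h x)" using bspec[OF k hx] by auto
    have "g (k (h x) - p) = h x" using khx p(1) by (simp add: g.diff N_def)
    moreover have "norm (k (h x) - p) \<le> norm ((k (h x) - p) - (- p))"
      using p complex_vector.subspace_neg[OF N] by (intro pythagoras_le) blast
    then have "norm (k (h x) - p) \<le> K * norm (h x)" using khx by simp
    ultimately show ?thesis using p(2) by (intro exI[of _ "k (h x) - p"]) (simp add: P_def)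
  qed
  then obtain s where s: "\<And>x. s x \<in> P" "\<And>x. g (s x) = h x" "\<And>x. norm (s x) \<le> K * norm (h x)"
    by metis
  have uniq: "a = b" if "a \<in> P" "b \<in> P" "g a = g b" for a b
  proof -
    have "a - b \<in> P" using complex_vector.subspace_diff[OF P] that by blast
    moreover have "a - b \<in> N" using that by (simp add: N_def g.diff)
    ultimately have "cinner (a - b) (a - b) = 0" by (simp add: P_def)
    then show "a = b" by (simp add: cinner_self)
  qed
  have ss: "s (a *\<^sub>C x) = a *\<^sub>C s x" for a x
    by (rule uniq) (use s complex_vector.subspace_scale[OF P] in \<open>auto simp: gs hs\<close>)
  have "bounded_linear s"
  proof (rule bounded_linear_intro[where K = "\<bar>K\<bar> * onorm h"])
    show "s (x + y) = s x + s y" for x y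
      by (rule uniq) (use s complex_vector.subspace_add[OF P] in \<open>auto simp: g.add h.add\<close>)
    show "s (r *\<^sub>R x) = r *\<^sub>R s x" for r x
      by (simp add: scaleR_scaleC ss)
    show "norm (s x) \<le> norm x * (\<bar>K\<bar> * onorm h)" for x
    proof -
      have "norm (s x) \<le> \<bar>K\<bar> * norm (h x)"
        using s(3)[of x] by (meson abs_ge_self mult_right_mono norm_ge_zero order_trans)
      also have "\<dots> \<le> \<bar>K\<bar> * (onorm h * norm x)"
        by (intro mult_left_mono onorm h.bounded_linear_axioms) simp
      finally show ?thesis by (simp add: mult.commute mult.left_commute)
    qed
  qed
  then show ?thesis using s(2) ss by (auto simp: bounded_clinear_def)
qed

lemma bop_eqI: "(\<And>x. bop_apply S x = bop_apply T x) \<Longrightarrow> S = T"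
  by (metis bop_apply_inject ext)

lemma adj_eqI:
  assumes "\<And>x y. cinner (bop_apply A x) y = cinner x (bop_apply B y)"
  shows "adj A = B"
  by (rule bop_eqI, rule cinner_ext) (metis assms cinner_adj)

lemma cinner_adj': "cinner (bop_apply (adj A) x) y = cinner x (bop_apply A y)"
  by (metis cinner_adj cinner_commute)

lemma adj_adj: "adj (adj A) = A"
  by (rule adj_eqI) (rule cinner_adj')

lemma adj_inject: "adj S = adj T \<Longrightarrow> S = T"
  by (metis adj_adj)

lemma adj_shift: "adj (shift A \<mu>) = shift (adj A) (cnj \<mu>)"
  by (rule adj_eqI)
    (simp add: shift_def minus_bop.rep_eq scaleC_bop.rep_eq bop_id.rep_eq cinner_diff_left
      cinner_diff_right cinner_scaleC_left cinner_scaleC_right cinner_adj)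

lemma adj_right_mult: "adj (bop_apply (right_mult D) S) = bop_comp (adj D) (adj S)"
  by (rule adj_eqI) (simp add: bop_apply_right_mult bop_comp.rep_eq cinner_adj)

lemma adj_right_mult_funpow:
  "bop_apply (adj ((bop_apply (right_mult D) ^^ n) S)) x = (bop_apply (adj D) ^^ n) (bop_apply (adj S) x)"
  by (induction n arbitrary: x) (simp_all add: adj_right_mult bop_comp.rep_eq)

lemma norm_adj_apply: "norm (bop_apply (adj A) y) \<le> norm A * norm y"
proof (cases "bop_apply (adj A) y = 0")
  case False
  let ?z = "bop_apply (adj A) y"
  have "(norm ?z)\<^sup>2 = cmod (cinner (bop_apply A ?z) y)"
    by (simp add: cinner_adj cinner_self norm_power)
  also have "\<dots> \<le> norm (bop_apply A ?z) * norm y" by (rule cauchy_schwarz)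
  also have "\<dots> \<le> norm A * norm ?z * norm y"
    by (intro mult_right_mono norm_bop_apply) simp
  finally show ?thesis using False by (simp add: power2_eq_square ac_simps)
qed simp

lemma adj_diff: "adj (S - T) = adj S - adj T"
  by (rule adj_eqI) (simp add: minus_bop.rep_eq cinner_diff_left cinner_diff_right cinner_adj)

lemma tendsto_adj_apply:
  assumes "X \<longlonglongrightarrow> T"
  shows "(\<lambda>n. bop_apply (adj (X n)) x) \<longlonglongrightarrow> bop_apply (adj T) x"
proof (rule LIM_zero_cancel, rule Lim_null_comparison)
  show "\<forall>\<^sub>F n in sequentially. norm (bop_apply (adj (X n)) x - bop_apply (adj T) x) \<le> norm (X n - T) * norm x"
    using norm_adj_apply[of "X n - T" x for n] by (simp add: adj_diff minus_bop.rep_eq)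
  show "(\<lambda>n. norm (X n - T) * norm x) \<longlonglongrightarrow> 0"
    using assms by (intro tendsto_mult_left_zero tendsto_norm_zero LIM_zero)
qed

text \<open>Through adjoints, \<open>T = S D\<^sup>n\<close> becomes the factorization of the adjoint of \<open>T\<close> through the \<open>n\<close>-th power of
the adjoint of \<open>D\<close>.\<close>
lemma range_right_mult_funpow:
  assumes cl: "closed (range (bop_apply (adj D) ^^ n))"
  shows "range (bop_apply (right_mult D) ^^ n) =
    {T. \<forall>x. bop_apply (adj T) x \<in> range (bop_apply (adj D) ^^ n)}"
proof (intro set_eqI iffI)
  fix T assume "T \<in> range (bop_apply (right_mult D) ^^ n)"
  then show "T \<in> {T. \<forall>x. bop_apply (adj T) x \<in> range (bop_apply (adj D) ^^ n)}"
    by (auto simp: adj_right_mult_funpow)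
next
  fix T assume T: "T \<in> {T. \<forall>x. bop_apply (adj T) x \<in> range (bop_apply (adj D) ^^ n)}"
  obtain s where s: "bounded_clinear s" "\<And>x. (bop_apply (adj D) ^^ n) (s x) = bop_apply (adj T) x"
    using bounded_linear_lift_through_closed_range[OF bounded_clinear_funpow[OF bounded_clinear_bop_apply]
        bounded_clinear_bop_apply cl, of "adj T"] T by blast
  have "(bop_apply (right_mult D) ^^ n) (adj (Bop s)) = T"
    by (rule adj_inject, rule bop_eqI)
      (simp add: adj_right_mult_funpow adj_adj bop_apply_Bop[OF s(1)] s(2))
  then show "T \<in> range (bop_apply (right_mult D) ^^ n)" by (metis rangeI)
qed

definition rank_one :: "'a::complex_hilbert \<Rightarrow> 'a \<Rightarrow> 'a bop" where
  "rank_one a b = Bop (\<lambda>x. cinner x b *\<^sub>C a)"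

lemma rank_one_apply: "bop_apply (rank_one a b) x = cinner x b *\<^sub>C a"
proof -
  have "bounded_clinear (\<lambda>x. cinner x b *\<^sub>C a)"
    unfolding bounded_clinear_def
  proof (intro conjI allI bounded_linear_intro[where K = "norm b * norm a"])
    show "norm (cinner x b *\<^sub>C a) \<le> norm x * (norm b * norm a)" for x
      using mult_right_mono[OF cauchy_schwarz[of x b], of "norm a"]
      by (simp add: norm_scaleC mult.assoc)
  qed (simp_all add: cinner_add_left scaleC_add_left scaleR_scaleC cinner_scaleC_left scaleC_scaleC)
  then show ?thesis by (simp add: rank_one_def bop_apply_Bop)
qed

lemma adj_rank_one: "adj (rank_one a b) = rank_one b a"
proof (rule adj_eqI)
  fix x y :: 'a
  show "cinner (bop_apply (rank_one a b) x) y = cinner x (bop_apply (rank_one b a) y)"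
    using cinner_commute[of a y] by (simp add: rank_one_apply cinner_scaleC_left cinner_scaleC_right)
qed

lemma right_mult_funpow_rank_one:
  "(bop_apply (right_mult D) ^^ n) (rank_one a u) = rank_one a ((bop_apply (adj D) ^^ n) u)"
proof (rule adj_inject, rule bop_eqI)
  fix x
  have "(bop_apply (adj D) ^^ n) (c *\<^sub>C u) = c *\<^sub>C (bop_apply (adj D) ^^ n) u" for c
    using bounded_clinear_funpow[OF bounded_clinear_bop_apply, of n "adj D"]
    by (simp add: bounded_clinear_def)
  then show "bop_apply (adj ((bop_apply (right_mult D) ^^ n) (rank_one a u))) x =
    bop_apply (adj (rank_one a ((bop_apply (adj D) ^^ n) u))) x"
    by (simp add: adj_right_mult_funpow adj_rank_one rank_one_apply)
qed

lemma rank_one_diff_right: "rank_one a b - rank_one a c = rank_one a (b - c)"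
  by (rule bop_eqI)
    (simp add: minus_bop.rep_eq rank_one_apply cinner_diff_right complex_vector.scale_left_diff_distrib)

lemma norm_rank_one_le: "norm (rank_one a b) \<le> norm a * norm b"
  unfolding norm_bop.rep_eq
proof (rule onorm_bound)
  show "norm (bop_apply (rank_one a b) x) \<le> norm a * norm b * norm x" for x
    using mult_right_mono[OF cauchy_schwarz[of x b], of "norm a"]
    by (simp add: rank_one_apply norm_scaleC mult_ac)
qed simp

text \<open>Right multiplication maps the rank one operators with a fixed left factor \<open>e\<close> to themselves and acts
on the right factor as the adjoint of \<open>D\<close>. This transports closedness of the range from right multiplication
to the adjoint; the converse is the description of the range by pointwise conditions.\<close>
lemma closed_range_right_mult_funpow_iff:
  fixes D :: "'x::complex_hilbert bop"
  assumes e: "(e::'x) \<noteq> 0"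
  shows "closed (range (bop_apply (right_mult D) ^^ n)) \<longleftrightarrow> closed (range (bop_apply (adj D) ^^ n))"
    (is "closed ?S \<longleftrightarrow> closed ?R")
proof
  assume cl: "closed ?R"
  show "closed ?S"
    unfolding closed_sequential_limits
  proof (intro allI impI)
    fix X T assume X: "(\<forall>k. X k \<in> ?S) \<and> X \<longlonglongrightarrow> T"
    have "bop_apply (adj T) x \<in> ?R" for x
    proof (rule closed_sequentially[OF cl])
      show "bop_apply (adj (X k)) x \<in> ?R" for k
        using X range_right_mult_funpow[OF cl] by auto
      show "(\<lambda>k. bop_apply (adj (X k)) x) \<longlonglongrightarrow> bop_apply (adj T) x"
        using X tendsto_adj_apply by blast
    qed
    then show "T \<in> ?S" using range_right_mult_funpow[OF cl] by blast
  qed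
next
  assume cl: "closed ?S"
  have R: "csubspace ?R" by (rule csubspace_range_funpow[OF bounded_clinear_bop_apply])
  show "closed ?R"
    unfolding closed_sequential_limits
  proof (intro allI impI)
    fix y l assume "(\<forall>k. y k \<in> ?R) \<and> y \<longlonglongrightarrow> l"
    then have y: "\<And>k. y k \<in> ?R" and l: "y \<longlonglongrightarrow> l" by auto
    have "rank_one e (y k) \<in> ?S" for k
    proof -
      obtain u where u: "y k = (bop_apply (adj D) ^^ n) u" using y[of k] by blast
      show ?thesis unfolding u using right_mult_funpow_rank_one[of n D e u] by (metis rangeI)
    qed
    moreover have "(\<lambda>k. rank_one e (y k)) \<longlonglongrightarrow> rank_one e l"
    proof (rule LIM_zero_cancel, rule Lim_null_comparison)
      show "\<forall>\<^sub>F k in sequentially. norm (rank_one e (y k) - rank_one e l) \<le> norm e * norm (y k - l)"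
        by (intro always_eventually allI) (simp add: rank_one_diff_right norm_rank_one_le)
      show "(\<lambda>k. norm e * norm (y k - l)) \<longlonglongrightarrow> 0"
        using l by (intro tendsto_mult_right_zero tendsto_norm_zero LIM_zero)
    qed
    ultimately have "rank_one e l \<in> ?S" by (rule closed_sequentially[OF cl])
    then obtain S where "rank_one e l = (bop_apply (right_mult D) ^^ n) S" by blast
    then have "bop_apply (adj (rank_one e l)) e \<in> ?R"
      by (simp add: adj_right_mult_funpow)
    then have "cinner e e *\<^sub>C l \<in> ?R" by (simp add: adj_rank_one rank_one_apply)
    then have "inverse (cinner e e) *\<^sub>C cinner e e *\<^sub>C l \<in> ?R"
      by (rule complex_vector.subspace_scale[OF R])
    then show "l \<in> ?R" using e by (simp add: scaleC_scaleC scaleC_one cinner_self)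
  qed
qed

lemma kernel_right_mult_trivial:
  assumes "{x\<in>range (bop_apply (adj D) ^^ n). bop_apply (adj D) x = 0} = {0}"
  shows "{T\<in>range (bop_apply (right_mult D) ^^ n). bop_apply (right_mult D) T = 0} = {0}"
proof
  let ?r = "bop_apply (right_mult D)"
  show "{T\<in>range (?r ^^ n). ?r T = 0} \<subseteq> {0}"
  proof
    fix T assume T: "T \<in> {T\<in>range (?r ^^ n). ?r T = 0}"
    have "bop_apply (adj T) x = 0" for x
    proof -
      have "bop_apply (adj T) x \<in> range (bop_apply (adj D) ^^ n)"
        using T by (auto simp: adj_right_mult_funpow)
      moreover have "adj (?r T) = 0"
        using T by (intro adj_eqI) (simp add: zero_bop.rep_eq cinner_zero_left cinner_zero_right)
      then have "bop_apply (bop_comp (adj D) (adj T)) x = 0"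
        by (simp add: adj_right_mult zero_bop.rep_eq)
      then have "bop_apply (adj D) (bop_apply (adj T) x) = 0" by (simp add: bop_comp.rep_eq)
      ultimately show ?thesis using assms by blast
    qed
    then have "bop_apply T y = 0" for y
      by (intro cinner_ext) (simp add: cinner_adj' [symmetric] cinner_zero_left cinner_zero_right)
    then show "T \<in> {0}" by (auto intro!: bop_eqI simp: zero_bop.rep_eq)
  qed
  have "csubspace (range (?r ^^ n))"
    by (rule csubspace_range_funpow[OF bounded_clinear_bop_apply])
  from complex_vector.subspace_0[OF csubspace_kernel_on[OF bounded_clinear_bop_apply this]]
  show "{0} \<subseteq> {T\<in>range (?r ^^ n). ?r T = 0}" by blast
qed

text \<open>A nonzero \<open>z\<close> in the kernel within the range gives a whole copy \<open>{rank_one a z}\<close> of the space inside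
the corresponding kernel of right multiplication.\<close>
lemma kernel_right_mult_infinite_dim:
  fixes D :: "'x::complex_hilbert bop"
  assumes inf: "\<not> finite_dim (UNIV :: 'x set)"
    and z: "z \<in> range (bop_apply (adj D) ^^ n)" "bop_apply (adj D) z = 0" "z \<noteq> 0"
  shows "\<not> finite_dim {T\<in>range (bop_apply (right_mult D) ^^ n). bop_apply (right_mult D) T = 0}"
proof
  let ?r = "bop_apply (right_mult D)"
  let ?W = "{T\<in>range (?r ^^ n). ?r T = 0}"
  assume fin: "finite_dim ?W"
  have W: "csubspace ?W"
    by (intro csubspace_kernel_on csubspace_range_funpow bounded_clinear_bop_apply)
  have lin: "clinear (\<lambda>a. rank_one a z)"
    by unfold_locales
      (auto intro!: bop_eqI simp: rank_one_apply plus_bop.rep_eq scaleC_bop.rep_eq scaleC_add_right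
        scaleC_scaleC mult.commute)
  have "a = 0" if "rank_one a z = 0" for a
  proof -
    have "bop_apply (rank_one a z) z = 0" using that by (simp add: zero_bop.rep_eq)
    then show "a = 0" using z(3) by (simp add: rank_one_apply cinner_self)
  qed
  then have "{a. rank_one a z = 0} \<subseteq> cspan {}" by auto
  then have "finite_dim {a. rank_one a z = 0}" unfolding finite_dim_def by blast
  from finite_dim_vimage[OF lin this W fin] have "finite_dim {a. rank_one a z \<in> ?W}" .
  moreover have "rank_one a z \<in> ?W" for a
  proof -
    obtain u where u: "z = (bop_apply (adj D) ^^ n) u" using z(1) by blast
    have "rank_one a z \<in> range (?r ^^ n)"
      unfolding u using right_mult_funpow_rank_one[of n D a u] by (metis rangeI)
    moreover have "?r (rank_one a z) = 0"
      using right_mult_funpow_rank_one[of 1 D a z] z(2)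
      by (auto intro!: bop_eqI simp: rank_one_apply cinner_zero_right zero_bop.rep_eq)
    ultimately show ?thesis by blast
  qed
  ultimately show False using inf by simp
qed

section \<open>Spectra of right multiplication\<close>

lemma shift_right_mult:
  fixes A :: "'x::complex_banach bop"
  shows "shift (right_mult A) \<mu> = right_mult (shift A \<mu>)"
proof (rule bop_eqI, rule bop_eqI)
  fix S :: "'x bop" and x :: 'x
  interpret bounded_linear "bop_apply S" by (rule bounded_linear_bop_apply)
  show "bop_apply (bop_apply (shift (right_mult A) \<mu>) S) x =
    bop_apply (bop_apply (right_mult (shift A \<mu>)) S) x"
    by (simp add: shift_apply bop_apply_right_mult bop_comp.rep_eq minus_bop.rep_eq
        scaleC_bop.rep_eq diff bop_apply_scaleC)
qed

lemma exists_nonzero: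
  assumes "\<not> finite_dim (UNIV :: 'x::complex_banach set)"
  obtains e :: "'x::complex_banach" where "e \<noteq> 0"
proof -
  have "\<not> UNIV \<subseteq> {0::'x}" using assms finite_dim_subset[OF finite_dim_zero] by blast
  then show ?thesis using that by blast
qed

lemma closed_range_pow_right_mult_iff:
  fixes D :: "'x::complex_hilbert bop"
  assumes "\<not> finite_dim (UNIV :: 'x set)"
  shows "closed (range_pow (right_mult D) n) \<longleftrightarrow> closed (range_pow (adj D) n)"
proof -
  obtain e :: 'x where "e \<noteq> 0" using exists_nonzero[OF assms] .
  then show ?thesis unfolding range_pow_def by (rule closed_range_right_mult_funpow_iff)
qed

lemma kernel_in_range_right_mult:
  fixes D :: "'x::complex_hilbert bop"
  assumes inf: "\<not> finite_dim (UNIV :: 'x set)"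
  shows "finite_dim (kernel_in_range (right_mult D) n) \<longleftrightarrow> kernel_in_range (adj D) n = {0}"
    and "kernel_in_range (right_mult D) n = {0} \<longleftrightarrow> kernel_in_range (adj D) n = {0}"
proof -
  have triv: "kernel_in_range (right_mult D) n = {0}" if "kernel_in_range (adj D) n = {0}"
    using kernel_right_mult_trivial[of n D] that unfolding kernel_in_range_def range_pow_def .
  have inf: "\<not> finite_dim (kernel_in_range (right_mult D) n)" if k: "kernel_in_range (adj D) n \<noteq> {0}"
  proof -
    obtain z where z: "z \<in> kernel_in_range (adj D) n" "z \<noteq> 0"
      using k zero_in_kernel_in_range[of "adj D" n] by blast
    then show ?thesis
      using kernel_right_mult_infinite_dim[OF inf, of z n D]
      unfolding kernel_in_range_def range_pow_def by blast
  qed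
  show "finite_dim (kernel_in_range (right_mult D) n) \<longleftrightarrow> kernel_in_range (adj D) n = {0}"
    using triv inf finite_dim_zero by metis
  show "kernel_in_range (right_mult D) n = {0} \<longleftrightarrow> kernel_in_range (adj D) n = {0}"
    using triv inf finite_dim_zero by metis
qed

text \<open>For right multiplication the kernels within the ranges are zero or infinite dimensional, so upper semi
B-Fredholm with nonpositive index and left Drazin invertible coincide, and the latter property is
shared with the adjoint.\<close>
lemma right_mult_spectra:
  fixes A :: "'x::complex_hilbert bop"
  assumes inf: "\<not> finite_dim (UNIV :: 'x set)"
  shows "\<mu> \<in> sigma_SBF (right_mult A) \<longleftrightarrow> cnj \<mu> \<in> sigma_LD (adj A)"
    and "\<mu> \<in> sigma_a (right_mult A) \<longleftrightarrow> cnj \<mu> \<in> sigma_a (adj A)"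
    and "\<mu> \<in> E_a (right_mult A) \<longleftrightarrow> cnj \<mu> \<in> E_a (adj A)"
proof -
  note cl = closed_range_pow_right_mult_iff[OF inf] and ker = kernel_in_range_right_mult[OF inf]
  have sh: "shift (adj A) (cnj \<mu>) = adj (shift A \<mu>)" for \<mu>
    by (simp add: adj_shift)
  have LD: "left_Drazin_at (shift (right_mult A) \<mu>) n \<longleftrightarrow> left_Drazin_at (shift (adj A) (cnj \<mu>)) n" for \<mu> n
    unfolding left_Drazin_at_def shift_right_mult sh cl ker ..
  have W: "semi_Weyl_at (shift (right_mult A) \<mu>) n \<longleftrightarrow> left_Drazin_at (shift (right_mult A) \<mu>) n" for n
  proof
    assume "semi_Weyl_at (shift (right_mult A) \<mu>) n"
    then show "left_Drazin_at (shift (right_mult A) \<mu>) n"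
      unfolding semi_Weyl_at_def left_Drazin_at_def shift_right_mult ker by blast
  qed (rule left_Drazin_at_imp_semi_Weyl_at)
  show "\<mu> \<in> sigma_SBF (right_mult A) \<longleftrightarrow> cnj \<mu> \<in> sigma_LD (adj A)"
    using notin_sigma_SBF_iff[of \<mu> "right_mult A"] W LD[of \<mu>] by (auto simp: sigma_LD_def)
  have a: "\<mu> \<in> sigma_a (right_mult A) \<longleftrightarrow> cnj \<mu> \<in> sigma_a (adj A)" for \<mu>
    using notin_sigma_a_iff[of \<mu> "right_mult A"] notin_sigma_a_iff[of "cnj \<mu>" "adj A"] LD[of \<mu> 0]
    by blast
  then show "\<mu> \<in> sigma_a (right_mult A) \<longleftrightarrow> cnj \<mu> \<in> sigma_a (adj A)" .
  have dist_cnj: "dist (cnj x) (cnj y) = dist x y" for x y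
    by (metis complex_cnj_diff complex_mod_cnj dist_norm)
  have img: "sigma_a (adj A) = cnj ` sigma_a (right_mult A)"
  proof (intro equalityI subsetI)
    fix \<nu> assume "\<nu> \<in> sigma_a (adj A)"
    then have "cnj \<nu> \<in> sigma_a (right_mult A)" by (simp add: a)
    then show "\<nu> \<in> cnj ` sigma_a (right_mult A)" by (metis complex_cnj_cnj imageI)
  qed (auto simp: a)
  have "\<mu> isolated_in sigma_a (right_mult A) \<longleftrightarrow> cnj \<mu> isolated_in sigma_a (adj A)"
    unfolding isolated_in_dist_Ex_iff a[of \<mu>] img by (simp add: dist_cnj)
  then show "\<mu> \<in> E_a (right_mult A) \<longleftrightarrow> cnj \<mu> \<in> E_a (adj A)"
    unfolding E_a_def mem_Collect_eq alpha_pos_iff shift_right_mult sh ker by simp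
qed

lemma generalized_a_Weyl_right_mult_iff:
  fixes A :: "'x::complex_hilbert bop"
  assumes inf: "\<not> finite_dim (UNIV :: 'x set)"
  shows "generalized_a_Weyl (right_mult A) \<longleftrightarrow> sigma_LD (adj A) = sigma_a (adj A) - E_a (adj A)"
proof -
  have "generalized_a_Weyl (right_mult A) \<longleftrightarrow>
    (\<forall>\<mu>. cnj \<mu> \<in> sigma_LD (adj A) \<longleftrightarrow> cnj \<mu> \<in> sigma_a (adj A) - E_a (adj A))"
    unfolding generalized_a_Weyl_def set_eq_iff Diff_iff right_mult_spectra[OF inf] ..
  also have "\<dots> \<longleftrightarrow> sigma_LD (adj A) = sigma_a (adj A) - E_a (adj A)"
    unfolding set_eq_iff by (metis complex_cnj_cnj)
  finally show ?thesis .
qed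

theorem theorem3p11:
  fixes A :: "'x::complex_hilbert bop"
  assumes "\<not> finite_dim (UNIV :: 'x set)"
  shows "generalized_a_Weyl (adj A) \<longleftrightarrow>
    generalized_a_Weyl (right_mult A) \<and> a_Browder (adj A)"
proof (cases "a_Browder (adj A)")
  case True
  then have "sigma_SBF (adj A) = sigma_LD (adj A)"
    by (rule a_Browder_imp_sigma_SBF_eq_sigma_LD)
  then show ?thesis
    unfolding generalized_a_Weyl_right_mult_iff[OF assms] generalized_a_Weyl_def[of "adj A"]
    using True by simp
next
  case False
  then show ?thesis
    using generalized_a_Weyl_imp_a_Browder by blast
qed

end
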